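(* Let $\mathbb{F}$ be an arbitrary field and let $P(\lambda)$ be a regular $n\times n$ matrix polynomial over $\mathbb{F}$ of grade $g$ and degree $d$. Define $k$ to be the maximum degree among all of the $\mathbb{F}$-irreducible divisors of $P(\lambda)$. If $P(\lambda)$ is not strictly regular, suppose further that there is some $\omega\in\mathbb{F}$ such that $s_n(\omega)\neq 0$, where $s_n(\lambda)$ is the $n$th (last) invariant polynomial of $P(\lambda)$ (i.e., there is some $\omega\in\mathbb{F}$ that is not an eigenvalue of $P$). Then there exists a regular $k$-quasi-triangular matrix polynomial $Q(\lambda)$ over $\mathbb{F}$ that has exactly the same size, grade, degree, and complete spectral data as $P(\lambda)$. When $P(\lambda)$ is strictly regular, then the $k$-quasi-triangular $Q(\lambda)$ is strictly regular, and may be chosen to have the additional property that all of its off-diagonal blocks have degree strictly less than $d$.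
   Context: A matrix polynomial over $\mathbb{F}$ is a matrix with entries in $\mathbb{F}[\lambda]$; it is regular if it is square with determinant not identically zero. Unimodular means square with nonzero constant determinant. The Smith form of a regular $n\times n$ $P(\lambda)$ is the unique $\mathrm{diag}(s_1,\dots,s_n)=U(\lambda)P(\lambda)V(\lambda)$, with $U,V$ unimodular, $s_i$ monic and $s_i\mid s_{i+1}$; the $s_i$ are the invariant polynomials, and their zeros are the finite eigenvalues of $P$. An irreducible divisor of $P$ is a non-constant irreducible polynomial in $\mathbb{F}[\lambda]$ dividing some invariant polynomial. The finite spectral structure of $P$ is the list of all its invariant polynomials (including those equal to 1). The degree of $P$ is the largest $j$ with nonzero matrix coefficient of $\lambda^j$ (the zero polynomial has degree $-\infty$). A grade of $P$ is a chosen integer $g\ge \deg P$, attached to $P$ as part of the data. The grade-$g$ reversal is $(\mathrm{rev}_g P)(\lambda)=\lambda^g P(1/\lambda)$. The partial multiplicity sequence of a regular matrix polynomial with invariant polynomials $s_1\mid\dots\mid s_n$ at an irreducible $\chi$ is $(\alpha_1\le\dots\le\alpha_n)$ where $\alpha_i$ is the exponent of the exact power of $\chi$ dividing $s_i$. The partial multiplicity sequence of $P$ at $\infty$ is that of $\mathrm{rev}_gP$ at the irreducible $\lambda$. The infinite spectral structure is the eigenvalue at infinity (if it exists, i.e., if this sequence is not all zero) together with its partial multiplicity sequence; the complete spectral data is the combination of the finite and infinite spectral structures. $P$ of grade $g$ is strictly regular if it is regular and has no infinite spectral structure, i.e., all partial multiplicities at $\infty$ are zero; equivalently, the coefficient of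 $\lambda^g$ is nonsingular (in particular $g=\deg P$). A matrix is $k$-quasi-triangular if it is block upper (or lower) triangular with square blocks along the main diagonal, none of which is larger than $k\times k$. "Off-diagonal blocks" refers to this block partition. *)

theory Defs
  imports
    "HOL-Library.Extended"
    "Jordan_Normal_Form.Determinant"
begin

definition regular_mp :: "'a::field poly mat \<Rightarrow> bool" where
  "regular_mp P \<longleftrightarrow> square_mat P \<and> det P \<noteq> 0"

definition unimodular_mp :: "'a::field poly mat \<Rightarrow> bool" where
  "unimodular_mp U \<longleftrightarrow> square_mat U \<and> (\<exists>c. c \<noteq> 0 \<and> det U = [:c:])"

definition coeff_mp :: "'a::field poly mat \<Rightarrow> nat \<Rightarrow> 'a mat" where
  "coeff_mp P j = map_mat (\<lambda>p. coeff p j) P"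

(* The zero matrix polynomial has degree -\<infinity>, unlike the zero polynomial in the library,
   whose degree is 0. *)
definition degree_mp :: "'a::field poly mat \<Rightarrow> nat extended" where
  "degree_mp P =
     (if P = 0\<^sub>m (dim_row P) (dim_col P) then Minf
      else Fin (Max {j. coeff_mp P j \<noteq> 0\<^sub>m (dim_row P) (dim_col P)}))"

(* The i-th coefficient of lambda^g P(1/lambda) is the (g-i)-th one of P;
   only meaningful for g at least the degree of P. *)
definition reversal_mp :: "nat \<Rightarrow> 'a::field poly mat \<Rightarrow> 'a poly mat" where
  "reversal_mp g P = map_mat (\<lambda>p. \<Sum>i\<le>g. monom (coeff p (g - i)) i) P"


definition smith_diagonal :: "'a::field poly mat \<Rightarrow> 'a poly list \<Rightarrow> bool" where
  "smith_diagonal P ss \<longleftrightarrow>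
     length ss = dim_row P \<and>
     (\<forall>s\<in>set ss. lead_coeff s = 1) \<and>
     (\<forall>i. Suc i < length ss \<longrightarrow> ss ! i dvd ss ! Suc i) \<and>
     (\<exists>U V. U \<in> carrier_mat (dim_row P) (dim_row P) \<and> unimodular_mp U \<and>
            V \<in> carrier_mat (dim_col P) (dim_col P) \<and> unimodular_mp V \<and>
            U * P * V = mat_diag (dim_row P) (\<lambda>i. ss ! i))"

(* Well defined for regular P, by existence and uniqueness of the Smith form. The paper's
   s_1, ..., s_n are entries 0, ..., n-1 of this list. *)
definition invariant_polys :: "'a::field poly mat \<Rightarrow> 'a poly list" where
  "invariant_polys P = (THE ss. smith_diagonal P ss)"

definition irreducible_divisors :: "'a::field poly mat \<Rightarrow> 'a poly set" where
  "irreducible_divisors P =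
     {\<chi>. irreducible \<chi> \<and> 0 < degree \<chi> \<and> (\<exists>s\<in>set (invariant_polys P). \<chi> dvd s)}"

(* Irreducible divisors have degree at least 1, so inserting 1 only matters if there are none,
   i.e. if P is unimodular. The maximum is then read as 1: blocks have size at least 1. *)
definition max_irreducible_degree :: "'a::field poly mat \<Rightarrow> nat" where
  "max_irreducible_degree P = Max (insert 1 (degree ` irreducible_divisors P))"

(* The library's multiplicity is not available over an arbitrary field: polynomials are an
   instance of its class only over fields with a normalization structure. *)
definition exact_exponent :: "'a::field poly \<Rightarrow> 'a poly \<Rightarrow> nat" where
  "exact_exponent \<chi> s = (GREATEST m. \<chi> ^ m dvd s)"

definition partial_mults :: "'a::field poly \<Rightarrow> 'a poly mat \<Rightarrow> nat list" where
  "partial_mults \<chi> P = map (exact_exponent \<chi>) (invariant_polys P)"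

definition partial_mults_infinity :: "nat \<Rightarrow> 'a::field poly mat \<Rightarrow> nat list" where
  "partial_mults_infinity g P = partial_mults [:0, 1:] (reversal_mp g P)"

(* None if infinity is not an eigenvalue of P, viewed as a matrix polynomial of grade g. *)
definition infinite_spectral_structure :: "nat \<Rightarrow> 'a::field poly mat \<Rightarrow> nat list option" where
  "infinite_spectral_structure g P =
     (if \<forall>\<alpha>\<in>set (partial_mults_infinity g P). \<alpha> = 0 then None
      else Some (partial_mults_infinity g P))"

definition complete_spectral_data ::
    "nat \<Rightarrow> 'a::field poly mat \<Rightarrow> 'a poly list \<times> nat list option" where
  "complete_spectral_data g P = (invariant_polys P, infinite_spectral_structure g P)"

definition strictly_regular_mp :: "nat \<Rightarrow> 'a::field poly mat \<Rightarrow> bool" where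
  "strictly_regular_mp g P \<longleftrightarrow> regular_mp P \<and> infinite_spectral_structure g P = None"

definition same_size_grade_degree_data ::
    "nat \<Rightarrow> 'a::field poly mat \<Rightarrow> 'a poly mat \<Rightarrow> bool" where
  "same_size_grade_degree_data g P Q \<longleftrightarrow>
     dim_row Q = dim_row P \<and> dim_col Q = dim_col P \<and>
     degree_mp P \<le> Fin g \<and> degree_mp Q \<le> Fin g \<and>
     degree_mp Q = degree_mp P \<and>
     complete_spectral_data g Q = complete_spectral_data g P"


(* bs lists the sizes of the diagonal blocks; blocks are indexed from 0. *)
definition block_mp :: "nat list \<Rightarrow> 'a mat \<Rightarrow> nat \<Rightarrow> nat \<Rightarrow> 'a mat" where
  "block_mp bs Q a b =
     mat (bs ! a) (bs ! b)
       (\<lambda>(i, j). Q $$ (sum_list (take a bs) + i, sum_list (take b bs) + j))"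

definition block_triangular :: "nat list \<Rightarrow> 'a::zero mat \<Rightarrow> bool" where
  "block_triangular bs Q \<longleftrightarrow>
     (\<forall>a<length bs. \<forall>b<a. block_mp bs Q a b = 0\<^sub>m (bs ! a) (bs ! b)) \<or>
     (\<forall>b<length bs. \<forall>a<b. block_mp bs Q a b = 0\<^sub>m (bs ! a) (bs ! b))"

definition quasi_triangular_wrt :: "nat \<Rightarrow> nat list \<Rightarrow> 'a::zero mat \<Rightarrow> bool" where
  "quasi_triangular_wrt k bs Q \<longleftrightarrow>
     square_mat Q \<and> sum_list bs = dim_row Q \<and> (\<forall>b\<in>set bs. 1 \<le> b \<and> b \<le> k) \<and>
     block_triangular bs Q"

definition quasi_triangular :: "nat \<Rightarrow> 'a::zero mat \<Rightarrow> bool" where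
  "quasi_triangular k Q \<longleftrightarrow> (\<exists>bs. quasi_triangular_wrt k bs Q)"

end

theory Submission
  imports Defs "Jordan_Normal_Form.Column_Operations"
begin

text \<open>
Suppose first that \<open>P\<close> is strictly regular, so that \<open>d = g\<close> and \<open>det P\<close> has degree
\<open>n d\<close>. Unimodular equivalence keeps the finite spectral structure, and a matrix of degree \<open>d\<close>
whose coefficient of \<open>\<lambda>\<^sup>d\<close> is nonsingular has no infinite one. Hence it suffices to find, inside
the equivalence class of \<open>P\<close>, a block triangular matrix whose diagonal blocks are monic of degree
\<open>d\<close> and have size at most \<open>k\<close>; division by the monic blocks then lowers the degrees of the other
blocks below \<open>d\<close>.

The Smith form is a triangular matrix in the class. Two neighbouring diagonal entries \<open>a\<close>, \<open>b\<close> of a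
triangular matrix span a \<open>2 \<times> 2\<close> block with Smith form \<open>diag (h, a b / h)\<close>, and the same Smith form
belongs to the block with diagonal \<open>a'\<close>, \<open>b'\<close> and corner \<open>h\<close> whenever \<open>a' b' = a b\<close> and \<open>h\<close>
divides both. So \<open>a\<close> and \<open>b\<close> may be exchanged, and a factor of \<open>b / h\<close> may be moved from \<open>b\<close> to
\<open>a\<close> (\<open>triangularizable_to_exchange\<close>). Since \<open>b / h\<close> has a factor of degree at most \<open>k\<close> as long
as \<open>b\<close> has larger degree than \<open>a\<close>, the degrees of the diagonal entries can be brought within \<open>k\<close> of
each other, in any order (\<open>triangularizable_to_balanced\<close>). Their mean is \<open>d\<close>, and integers with
sum zero and spread at most \<open>k\<close> split into zero-sum parts with at most \<open>k\<close> members
(\<open>short_zero_sum_partition\<close>). Each part gives a diagonal block of some size \<open>m \<le> k\<close> whose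
determinant has degree \<open>m d\<close>, and such a block is equivalent to a monic one of degree \<open>d\<close>
(\<open>monic_block_exists\<close>).

If \<open>P\<close> is not strictly regular but \<open>\<omega>\<close> is not an eigenvalue, then the substitution
\<open>\<lambda> \<mapsto> \<omega> + 1 / \<lambda>\<close>, with denominators cleared by \<open>\<lambda>\<^sup>g\<close>, moves \<open>\<omega>\<close> to infinity and makes
the matrix strictly regular of degree \<open>g\<close>. It acts on each entry separately, so the block triangular
shape survives the way back. It turns a unimodular equivalence into an equivalence up to powers of one
linear polynomial: \<open>\<lambda> - \<omega>\<close> for the matrices themselves and \<open>1 - \<omega> \<lambda>\<close> for their reversals.
By \<open>smith_form_dvd_transfer\<close> the invariant polynomials then agree up to such powers. As neither
matrix has the eigenvalue \<open>\<omega>\<close>, and as \<open>1 - \<omega> \<lambda>\<close> is prime to \<open>\<lambda>\<close>, the invariant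
polynomials and the partial multiplicities at infinity coincide. The degree coincides too, because
\<open>g\<close> minus the degree is the exponent of \<open>\<lambda>\<close> common to all entries of the reversal.
\<close>

section \<open>Unimodular equivalence\<close>

definition mp_equiv :: "nat \<Rightarrow> 'a::field poly mat \<Rightarrow> 'a poly mat \<Rightarrow> bool" where
  "mp_equiv n A B \<longleftrightarrow> A \<in> carrier_mat n n \<and> B \<in> carrier_mat n n \<and>
     (\<exists>U V. U \<in> carrier_mat n n \<and> unimodular_mp U \<and> V \<in> carrier_mat n n \<and> unimodular_mp V \<and>
        U * A * V = B)"

lemma unimodular_mp_mult:
  assumes "U \<in> carrier_mat n n" "V \<in> carrier_mat n n" "unimodular_mp U" "unimodular_mp V"
  shows "unimodular_mp (U * V)"
proof -
  from assms(3,4) obtain c d where "c \<noteq> 0" "det U = [:c:]" "d \<noteq> 0" "det V = [:d:]"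
    unfolding unimodular_mp_def by blast
  then have "c * d \<noteq> 0" "det (U * V) = [:c * d:]"
    using det_mult[OF assms(1,2)] by auto
  then show ?thesis using assms(1,2) unfolding unimodular_mp_def by auto
qed

lemma unimodular_mp_one [simp]: "unimodular_mp (1\<^sub>m n)"
  unfolding unimodular_mp_def by (auto intro!: exI[of _ 1] simp: one_pCons)

lemma unimodular_mp_if_det:
  "U \<in> carrier_mat n n \<Longrightarrow> c \<noteq> 0 \<Longrightarrow> det U = [:c:] \<Longrightarrow> unimodular_mp U"
  unfolding unimodular_mp_def by auto

text \<open>The adjugate is a polynomial matrix, and it has to be divided only by the constant \<open>det U\<close>.\<close>

lemma unimodular_mp_inverse:
  fixes U :: "'a::field poly mat"
  assumes U: "U \<in> carrier_mat n n" "unimodular_mp U"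
  obtains U' where "U' \<in> carrier_mat n n" "unimodular_mp U'" "U * U' = 1\<^sub>m n" "U' * U = 1\<^sub>m n"
proof -
  have smult_smult_times: "a \<cdot>\<^sub>m (b \<cdot>\<^sub>m (1\<^sub>m n)) = (a * b) \<cdot>\<^sub>m (1\<^sub>m n)" for a b :: "'a poly"
    by (rule eq_matI) auto
  have smult_one_mat: "(1::'a poly) \<cdot>\<^sub>m 1\<^sub>m n = 1\<^sub>m n" by (rule eq_matI) auto
  from U obtain c where c: "c \<noteq> 0" "det U = [:c:]"
    unfolding unimodular_mp_def by blast
  define U' where "U' = [:inverse c:] \<cdot>\<^sub>m adj_mat U"
  have adj: "adj_mat U \<in> carrier_mat n n" using adj_mat[OF U(1)] by simp
  have U': "U' \<in> carrier_mat n n" using adj unfolding U'_def by simp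
  have e: "[:inverse c:] * [:c:] = (1::'a poly)" using c(1) by (simp add: one_pCons)
  have 1: "U * U' = 1\<^sub>m n"
    unfolding U'_def mult_smult_distrib[OF U(1) adj] adj_mat(2)[OF U(1)] c(2) smult_smult_times e
    by (rule smult_one_mat)
  have 2: "U' * U = 1\<^sub>m n"
    unfolding U'_def mult_smult_assoc_mat[OF adj U(1)] adj_mat(3)[OF U(1)] c(2) smult_smult_times e
    by (rule smult_one_mat)
  have "det U * det U' = 1" using det_mult[OF U(1) U'] 1 by simp
  then have "det U' dvd 1" by (metis dvd_triv_right)
  then obtain d where "det U' = [:d:]" "d \<noteq> 0"
    by (metis is_unit_polyE not_is_unit_0 is_unit_pCons_iff)
  then have "unimodular_mp U'" using U' by (intro unimodular_mp_if_det) auto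
  with U' 1 2 show ?thesis using that by blast
qed

lemma mp_equivI:
  assumes "A \<in> carrier_mat n n" "U \<in> carrier_mat n n" "unimodular_mp U"
    "V \<in> carrier_mat n n" "unimodular_mp V" "B = U * A * V"
  shows "mp_equiv n A B"
  unfolding mp_equiv_def using assms by (intro conjI exI[of _ U] exI[of _ V]) auto

lemma mp_equiv_carrier:
  "mp_equiv n A B \<Longrightarrow> A \<in> carrier_mat n n" "mp_equiv n A B \<Longrightarrow> B \<in> carrier_mat n n"
  unfolding mp_equiv_def by auto

lemma mp_equiv_refl: "A \<in> carrier_mat n n \<Longrightarrow> mp_equiv n A A"
  by (rule mp_equivI[of _ _ "1\<^sub>m n" "1\<^sub>m n"]) auto

lemma mp_equiv_left:
  assumes "A \<in> carrier_mat n n" "U \<in> carrier_mat n n" "unimodular_mp U"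
  shows "mp_equiv n A (U * A)"
  by (rule mp_equivI[of _ _ U "1\<^sub>m n"]) (use assms in auto)

lemma mp_equiv_right:
  assumes "A \<in> carrier_mat n n" "U \<in> carrier_mat n n" "unimodular_mp U"
  shows "mp_equiv n A (A * U)"
  by (rule mp_equivI[of _ _ "1\<^sub>m n" U]) (use assms in auto)

lemma mp_equiv_trans:
  assumes "mp_equiv n A B" "mp_equiv n B C"
  shows "mp_equiv n A C"
proof -
  from assms(1) obtain U V where 1: "A \<in> carrier_mat n n" "U \<in> carrier_mat n n" "unimodular_mp U"
    "V \<in> carrier_mat n n" "unimodular_mp V" "U * A * V = B" unfolding mp_equiv_def by blast
  from assms(2) obtain U' V' where 2: "U' \<in> carrier_mat n n" "unimodular_mp U'"
    "V' \<in> carrier_mat n n" "unimodular_mp V'" "U' * B * V' = C" unfolding mp_equiv_def by blast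
  show ?thesis
  proof (rule mp_equivI[of _ _ "U' * U" "V * V'"])
    show "C = U' * U * A * (V * V')"
      using 1(1,2,4) 2(1,3) unfolding 2(5)[symmetric] 1(6)[symmetric]
      by (simp add: assoc_mult_mat[of _ n n _ n _ n])
  qed (use 1 2 in \<open>auto intro: unimodular_mp_mult\<close>)
qed

lemma mp_equiv_sym:
  assumes "mp_equiv n A B"
  shows "mp_equiv n B A"
proof -
  from assms obtain U V where 1: "A \<in> carrier_mat n n" "U \<in> carrier_mat n n" "unimodular_mp U"
    "V \<in> carrier_mat n n" "unimodular_mp V" "U * A * V = B" unfolding mp_equiv_def by blast
  from unimodular_mp_inverse[OF 1(2,3)] obtain U' where
    U': "U' \<in> carrier_mat n n" "unimodular_mp U'" "U' * U = 1\<^sub>m n" by metis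
  from unimodular_mp_inverse[OF 1(4,5)] obtain V' where
    V': "V' \<in> carrier_mat n n" "unimodular_mp V'" "V * V' = 1\<^sub>m n" by metis
  have "U' * B * V' = U' * (U * (A * (V * V')))"
    using 1(1,2,4) U'(1) V'(1) unfolding 1(6)[symmetric]
    by (simp add: assoc_mult_mat[of _ n n _ n _ n])
  also have "\<dots> = (U' * U) * A"
    using 1(1,2,4) U'(1) V' by (simp add: assoc_mult_mat[of _ n n _ n _ n])
  finally have "U' * B * V' = A" using U'(3) 1(1) by simp
  then show ?thesis
    by (intro mp_equivI[OF mp_equiv_carrier(2)[OF assms] U'(1,2) V'(1,2)]) simp
qed

lemma unimodular_mp_transpose:
  "U \<in> carrier_mat n n \<Longrightarrow> unimodular_mp U \<Longrightarrow> unimodular_mp (transpose_mat U)"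
  unfolding unimodular_mp_def by (auto simp: det_transpose)

lemma mp_equiv_transpose:
  assumes "mp_equiv n A B"
  shows "mp_equiv n (transpose_mat A) (transpose_mat B)"
proof -
  from assms obtain U V where 1: "A \<in> carrier_mat n n" "U \<in> carrier_mat n n" "unimodular_mp U"
    "V \<in> carrier_mat n n" "unimodular_mp V" "U * A * V = B" unfolding mp_equiv_def by blast
  show ?thesis
  proof (rule mp_equivI[of _ _ "transpose_mat V" "transpose_mat U"])
    show "transpose_mat B = transpose_mat V * transpose_mat A * transpose_mat U"
      using 1(1,2,4) unfolding 1(6)[symmetric]
      by (simp add: transpose_mult[of _ n n _ n] assoc_mult_mat[of _ n n _ n _ n])
  qed (use 1 in \<open>auto intro: unimodular_mp_transpose\<close>)
qed

lemma mp_equiv_addrow: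
  assumes "A \<in> carrier_mat n n" "k < n" "l < n" "k \<noteq> l"
  shows "mp_equiv n A (addrow a k l A)"
  using mp_equiv_left[OF assms(1), of "addrow_mat n a k l"] assms
  by (auto simp: addrow_mat[OF assms(1,3)] unimodular_mp_def det_addrow_mat one_pCons)

lemma mp_equiv_swaprows:
  assumes "A \<in> carrier_mat n n" "k < n" "l < n"
  shows "mp_equiv n A (swaprows k l A)"
proof (cases "k = l")
  case True
  then have "swaprows k l A = A" using assms by auto
  then show ?thesis using mp_equiv_refl assms by simp
next
  case False
  have "unimodular_mp (swaprows_mat n k l :: 'a poly mat)"
    by (rule unimodular_mp_if_det[of _ n "-1"]) (auto simp: det_swaprows_mat assms False one_pCons)
  then show ?thesis
    using mp_equiv_left[OF assms(1), of "swaprows_mat n k l"] assms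
    by (auto simp: swaprows_mat[OF assms])
qed

lemma mp_equiv_multrow:
  assumes "A \<in> carrier_mat n n" "k < n" "c \<noteq> 0"
  shows "mp_equiv n A (multrow k [:c:] A)"
proof -
  have "unimodular_mp (multrow_mat n k [:c:])"
    by (rule unimodular_mp_if_det[of _ n c]) (auto simp: det_multrow_mat assms)
  then show ?thesis
    using mp_equiv_left[OF assms(1), of "multrow_mat n k [:c:]"] assms
    by (auto simp: multrow_mat[OF assms(1)])
qed

text \<open>This turns row operations into column operations.\<close>

lemma mp_equiv_via_transpose:
  assumes "A \<in> carrier_mat n n" "mp_equiv n (transpose_mat A) B"
  shows "mp_equiv n A (transpose_mat B)"
  using mp_equiv_transpose[OF assms(2)] by simp

lemma mp_equiv_det:
  assumes "mp_equiv n A B"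
  obtains c where "c \<noteq> 0" "det B = smult c (det A)"
proof -
  from assms obtain U V where 1: "A \<in> carrier_mat n n" "U \<in> carrier_mat n n" "unimodular_mp U"
    "V \<in> carrier_mat n n" "unimodular_mp V" "U * A * V = B" unfolding mp_equiv_def by blast
  from 1 obtain u v where "u \<noteq> 0" "det U = [:u:]" "v \<noteq> 0" "det V = [:v:]"
    unfolding unimodular_mp_def by blast
  then have "det B = smult (u * v) (det A)" "u * v \<noteq> 0"
    unfolding 1(6)[symmetric] using 1(1,2,4)
    by (auto simp: det_mult[of _ n] mult.commute)
  then show ?thesis using that by blast
qed

lemma mp_equiv_det_nonzero: "mp_equiv n A B \<Longrightarrow> det A \<noteq> 0 \<longleftrightarrow> det B \<noteq> 0"
  by (metis mp_equiv_det smult_eq_0_iff)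

lemma mp_equiv_degree_det: "mp_equiv n A B \<Longrightarrow> degree (det B) = degree (det A)"
  by (metis mp_equiv_det degree_smult_eq)

lemma unimodular_mp_four_block_upper:
  assumes "U \<in> carrier_mat n n" "unimodular_mp U" "V \<in> carrier_mat m m" "unimodular_mp V"
    "X \<in> carrier_mat n m"
  shows "unimodular_mp (four_block_mat U X (0\<^sub>m m n) V)"
proof -
  from assms obtain u v where u: "u \<noteq> 0" "det U = [:u:]" "v \<noteq> 0" "det V = [:v:]"
    unfolding unimodular_mp_def by blast
  show ?thesis
    by (rule unimodular_mp_if_det[of _ "n + m" "u * v"])
      (use assms u in \<open>auto simp: det_four_block_mat_lower_left_zero[OF assms(1,5) _ assms(3)]\<close>)
qed

lemma unimodular_mp_four_block_lower:
  assumes "U \<in> carrier_mat n n" "unimodular_mp U" "V \<in> carrier_mat m m" "unimodular_mp V"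
    "X \<in> carrier_mat m n"
  shows "unimodular_mp (four_block_mat U (0\<^sub>m n m) X V)"
proof -
  from assms obtain u v where u: "u \<noteq> 0" "det U = [:u:]" "v \<noteq> 0" "det V = [:v:]"
    unfolding unimodular_mp_def by blast
  show ?thesis
    by (rule unimodular_mp_if_det[of _ "n + m" "u * v"])
      (use assms u in \<open>auto simp: det_four_block_mat_upper_right_zero[OF assms(1) _ assms(5,3)]\<close>)
qed

text \<open>Diagonal blocks may be replaced by equivalent ones independently: block diagonal factors act on
each diagonal block by its own equivalence and affect only the block above the diagonal.\<close>

lemma mp_equiv_four_block:
  assumes "mp_equiv n A A'" "mp_equiv m D D'" "X \<in> carrier_mat n m"
  obtains X' where "X' \<in> carrier_mat n m"
    "mp_equiv (n + m) (four_block_mat A X (0\<^sub>m m n) D) (four_block_mat A' X' (0\<^sub>m m n) D')"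
    "X = 0\<^sub>m n m \<Longrightarrow> X' = 0\<^sub>m n m"
proof -
  from assms(1) obtain U V where 1: "A \<in> carrier_mat n n" "U \<in> carrier_mat n n" "unimodular_mp U"
    "V \<in> carrier_mat n n" "unimodular_mp V" "U * A * V = A'" unfolding mp_equiv_def by blast
  from assms(2) obtain U' V' where 2: "D \<in> carrier_mat m m" "U' \<in> carrier_mat m m" "unimodular_mp U'"
    "V' \<in> carrier_mat m m" "unimodular_mp V'" "U' * D * V' = D'" unfolding mp_equiv_def by blast
  let ?U = "four_block_mat U (0\<^sub>m n m) (0\<^sub>m m n) U'"
  let ?V = "four_block_mat V (0\<^sub>m n m) (0\<^sub>m m n) V'"
  have e1: "?U * four_block_mat A X (0\<^sub>m m n) D = four_block_mat (U * A) (U * X) (0\<^sub>m m n) (U' * D)"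
    using 1 2 assms(3) by (subst mult_four_block_mat[of _ n n _ m _ m _ _ n _ m]) auto
  have e2: "?U * four_block_mat A X (0\<^sub>m m n) D * ?V = four_block_mat A' (U * X * V') (0\<^sub>m m n) D'"
    unfolding e1 using 1 2 assms(3) by (subst mult_four_block_mat[of _ n n _ m _ m _ _ n _ m]) auto
  show ?thesis
  proof (rule that[of "U * X * V'"])
    show "mp_equiv (n + m) (four_block_mat A X (0\<^sub>m m n) D)
        (four_block_mat A' (U * X * V') (0\<^sub>m m n) D')"
      by (rule mp_equivI[OF _ _ _ _ _ e2[symmetric]])
        (use 1 2 in \<open>auto intro!: unimodular_mp_four_block_upper\<close>)
  qed (use 1 2 assms in auto)
qed

section \<open>Existence of the Smith form\<close>

text \<open>A nonzero entry of least degree in the whole equivalence class divides its column: otherwise a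
row operation would put the remainder of a division, of smaller degree, in place of the dividend.\<close>

lemma mp_equiv_minimal_entry_dvd_column:
  fixes A B :: "'a::field poly mat"
  assumes min: "\<And>C i j. mp_equiv n A C \<Longrightarrow> i < n \<Longrightarrow> j < n \<Longrightarrow> C $$ (i, j) \<noteq> 0 \<Longrightarrow>
      degree (B $$ (k, l)) \<le> degree (C $$ (i, j))"
    and B: "mp_equiv n A B" "B $$ (k, l) \<noteq> 0" and "k < n" "l < n" "i < n"
  shows "B $$ (k, l) dvd B $$ (i, l)"
proof (cases "i = k")
  case False
  have Bc: "B \<in> carrier_mat n n" using mp_equiv_carrier[OF B(1)] by simp
  define q where "q = B $$ (i, l) div B $$ (k, l)"
  define C where "C = addrow (- q) i k B"
  have C: "mp_equiv n A C"
    unfolding C_def using mp_equiv_trans[OF B(1) mp_equiv_addrow[OF Bc]] assms False by simp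
  have Cil: "C $$ (i, l) = B $$ (i, l) mod B $$ (k, l)"
    unfolding C_def q_def using Bc assms by (auto simp: minus_div_mult_eq_mod algebra_simps)
  have "B $$ (i, l) mod B $$ (k, l) = 0"
  proof (rule ccontr)
    assume ne: "B $$ (i, l) mod B $$ (k, l) \<noteq> 0"
    then have "degree (B $$ (k, l)) \<le> degree (B $$ (i, l) mod B $$ (k, l))"
      using min[OF C, of i l] assms Cil by simp
    then show False using degree_mod_less[OF B(2), of "B $$ (i, l)"] ne by simp
  qed
  then show ?thesis by (simp add: mod_eq_0_iff_dvd)
qed simp

lemma mp_equiv_minimal_entry_dvd_row:
  fixes A B :: "'a::field poly mat"
  assumes min: "\<And>C i j. mp_equiv n A C \<Longrightarrow> i < n \<Longrightarrow> j < n \<Longrightarrow> C $$ (i, j) \<noteq> 0 \<Longrightarrow>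
      degree (B $$ (k, l)) \<le> degree (C $$ (i, j))"
    and B: "mp_equiv n A B" "B $$ (k, l) \<noteq> 0" and kl: "k < n" "l < n" "j < n"
  shows "B $$ (k, l) dvd B $$ (k, j)"
proof -
  have Bc: "B \<in> carrier_mat n n" using mp_equiv_carrier[OF B(1)] by simp
  have "transpose_mat B $$ (l, k) dvd transpose_mat B $$ (j, k)"
  proof (rule mp_equiv_minimal_entry_dvd_column[where A = "transpose_mat A" and n = n])
    fix C i j assume C: "mp_equiv n (transpose_mat A) C" "i < n" "j < n" "C $$ (i, j) \<noteq> 0"
    have "mp_equiv n A (transpose_mat C)"
      using mp_equiv_via_transpose[OF mp_equiv_carrier(1)[OF B(1)] C(1)] .
    from min[OF this C(3,2)] C mp_equiv_carrier(2)[OF C(1)] Bc kl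
    show "degree (transpose_mat B $$ (l, k)) \<le> degree (C $$ (i, j))" by simp
  qed (use Bc kl B mp_equiv_transpose[OF B(1)] in auto)
  then show ?thesis using Bc kl by simp
qed

text \<open>One elimination step on the left and one on the right, written with blocks so that a single
product clears the whole column or row.\<close>

lemma mp_equiv_clear_corner:
  fixes B :: "'a::field poly mat"
  assumes B: "B \<in> carrier_mat (Suc n) (Suc n)"
    and col: "\<And>i. i < Suc n \<Longrightarrow> B $$ (0, 0) dvd B $$ (i, 0)"
    and row: "\<And>j. j < Suc n \<Longrightarrow> B $$ (0, 0) dvd B $$ (0, j)"
  obtains D where "D \<in> carrier_mat n n"
    "mp_equiv (Suc n) B (four_block_mat (mat 1 1 (\<lambda>_. B $$ (0, 0))) (0\<^sub>m 1 n) (0\<^sub>m n 1) D)"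
proof -
  define a where "a = B $$ (0, 0)"
  define r where "r j = B $$ (0, Suc j) div a" for j
  define c where "c i = B $$ (Suc i, 0) div a" for i
  define D0 where "D0 = mat n n (\<lambda>(i, j). B $$ (Suc i, Suc j))"
  define R where "R = mat 1 n (\<lambda>(i, j). r j)"
  define C where "C = mat n 1 (\<lambda>(i, j). c i)"
  define a1 where "a1 = mat 1 1 (\<lambda>_::nat \<times> nat. a)"
  have carr [simp]: "D0 \<in> carrier_mat n n" "R \<in> carrier_mat 1 n" "C \<in> carrier_mat n 1"
    "a1 \<in> carrier_mat 1 1"
    by (auto simp: D0_def R_def C_def a1_def)
  have carr2 [simp]: "a1 * R \<in> carrier_mat 1 n" "C * a1 \<in> carrier_mat n 1" "- C * a1 \<in> carrier_mat n 1"
    "- C * (a1 * R) \<in> carrier_mat n n" "- R \<in> carrier_mat 1 n" "- C \<in> carrier_mat n 1"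
    by (auto simp: D0_def R_def C_def a1_def)
  note carr' [simp] = carr[unfolded One_nat_def] carr2[unfolded One_nat_def]
  have r: "B $$ (0, Suc j) = a * r j" if "j < n" for j
    using row[of "Suc j"] that unfolding r_def a_def by simp
  have c: "B $$ (Suc i, 0) = a * c i" if "i < n" for i
    using col[of "Suc i"] that unfolding c_def a_def by simp
  have aR: "a1 * R = mat 1 n (\<lambda>(i, j). a * r j)"
    by (rule eq_matI) (auto simp: a1_def R_def scalar_prod_def)
  have Ca: "C * a1 = mat n 1 (\<lambda>(i, j). a * c i)"
    by (rule eq_matI) (auto simp: a1_def C_def scalar_prod_def)
  have B_eq: "B = four_block_mat a1 (a1 * R) (C * a1) D0"
    unfolding aR Ca
  proof (rule eq_matI)
    fix i j assume ij: "i < dim_row (four_block_mat a1 (mat 1 n (\<lambda>(i, j). a * r j)) (mat n 1 (\<lambda>(i, j). a * c i)) D0)"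
      "j < dim_col (four_block_mat a1 (mat 1 n (\<lambda>(i, j). a * r j)) (mat n 1 (\<lambda>(i, j). a * c i)) D0)"
    show "B $$ (i, j) = four_block_mat a1 (mat 1 n (\<lambda>(i, j). a * r j)) (mat n 1 (\<lambda>(i, j). a * c i)) D0 $$ (i, j)"
      using ij r c by (cases i; cases j) (auto simp: a1_def D0_def a_def)
  qed (use B in \<open>auto simp: a1_def D0_def\<close>)
  define L where "L = four_block_mat (1\<^sub>m 1) (0\<^sub>m 1 n) (- C) (1\<^sub>m n)"
  define Q where "Q = four_block_mat (1\<^sub>m 1) (- R) (0\<^sub>m n 1) (1\<^sub>m n)"
  define D where "D = (- C) * (a1 * R) + D0"
  have mCa: "- C * a1 + C * a1 = 0\<^sub>m n 1"
    by (rule eq_matI) (auto simp: a1_def C_def scalar_prod_def)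
  have maR: "a1 * (- R) + a1 * R = 0\<^sub>m 1 n"
    by (rule eq_matI) (auto simp: a1_def R_def scalar_prod_def)
  have D: "D \<in> carrier_mat n n" unfolding D_def by (rule add_carrier_mat) (rule carr)
  have L: "L * B = four_block_mat a1 (a1 * R) (0\<^sub>m n 1) D"
  proof -
    have "L * B = four_block_mat (1\<^sub>m 1 * a1 + 0\<^sub>m 1 n * (C * a1)) (1\<^sub>m 1 * (a1 * R) + 0\<^sub>m 1 n * D0)
        (- C * a1 + 1\<^sub>m n * (C * a1)) (- C * (a1 * R) + 1\<^sub>m n * D0)"
      unfolding L_def B_eq by (rule mult_four_block_mat) (rule carr carr2 one_carrier_mat zero_carrier_mat)+
    then show ?thesis
      by (simp add: left_mult_one_mat[OF carr(1)] left_mult_one_mat[OF carr(4)] left_mult_one_mat[OF carr2(1)]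
          left_mult_one_mat[OF carr2(2)] left_mult_zero_mat[OF carr2(2)] left_mult_zero_mat[OF carr(1)]
          right_add_zero_mat[OF carr2(1)] right_add_zero_mat[OF carr(4)] mCa D_def del: One_nat_def)
  qed
  have LQ: "L * B * Q = four_block_mat a1 (0\<^sub>m 1 n) (0\<^sub>m n 1) D"
  proof -
    have "L * B * Q = four_block_mat (a1 * 1\<^sub>m 1 + a1 * R * 0\<^sub>m n 1) (a1 * (- R) + a1 * R * 1\<^sub>m n)
        (0\<^sub>m n 1 * 1\<^sub>m 1 + D * 0\<^sub>m n 1) (0\<^sub>m n 1 * (- R) + D * 1\<^sub>m n)"
      unfolding L Q_def by (rule mult_four_block_mat) (rule carr carr2 one_carrier_mat zero_carrier_mat D)+
    then show ?thesis
      using D by (simp add: right_mult_one_mat[OF carr(4)] right_mult_zero_mat[OF carr2(1)]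
          right_add_zero_mat[OF carr(4)] right_mult_one_mat[OF carr2(1)] maR
          left_mult_zero_mat[OF carr2(5)] right_mult_one_mat[OF D] left_add_zero_mat[OF D] right_mult_zero_mat[OF D]
          del: One_nat_def)
  qed
  have "mp_equiv (Suc n) B (four_block_mat a1 (0\<^sub>m 1 n) (0\<^sub>m n 1) D)"
  proof (rule mp_equivI[OF B _ _ _ _ LQ[symmetric]])
    show "L \<in> carrier_mat (Suc n) (Suc n)" "Q \<in> carrier_mat (Suc n) (Suc n)"
      unfolding L_def Q_def by auto
    show "unimodular_mp L" unfolding L_def by (intro unimodular_mp_four_block_lower) auto
    show "unimodular_mp Q" unfolding Q_def by (intro unimodular_mp_four_block_upper) auto
  qed
  then show ?thesis using that[OF D] unfolding a1_def a_def by blast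
qed

lemma mat_diag_Cons:
  "mat_diag (Suc (length ss)) (\<lambda>i. (s # ss) ! i) =
     four_block_mat (mat 1 1 (\<lambda>_. s)) (0\<^sub>m 1 (length ss)) (0\<^sub>m (length ss) 1)
       (mat_diag (length ss) (\<lambda>i. ss ! i))"
  by (rule eq_matI) (auto simp: mat_diag_def nth_Cons')

lemma det_mat_diag: "det (mat_diag n f) = (\<Prod>i<n. f i)"
  by (subst det_upper_triangular[of _ n])
    (auto simp: mat_diag_def diag_mat_def prod.list_conv_set_nth atLeast0LessThan)

text \<open>The corner of the Smith form is an entry of least degree in the equivalence class. Minimality in the
whole class, and not only in the given matrix, makes it divide every other entry after elimination.\<close>

theorem smith_form_exists:
  fixes A :: "'a::field poly mat"
  assumes "A \<in> carrier_mat n n" "det A \<noteq> 0"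
  shows "\<exists>ss. length ss = n \<and> (\<forall>s\<in>set ss. lead_coeff s = 1) \<and>
    (\<forall>i. Suc i < n \<longrightarrow> ss ! i dvd ss ! Suc i) \<and> mp_equiv n A (mat_diag n (\<lambda>i. ss ! i))"
  using assms
proof (induction n arbitrary: A)
  case 0
  then have "A = mat_diag 0 (\<lambda>i. [] ! i)" by (intro eq_matI) (auto simp: mat_diag_def)
  then show ?case using mp_equiv_refl[OF 0(1)] by auto
next
  case (Suc n)
  let ?N = "Suc n"
  define P where "P m \<longleftrightarrow> (\<exists>C i j. mp_equiv ?N A C \<and> i < ?N \<and> j < ?N \<and> C $$ (i, j) \<noteq> 0 \<and>
    degree (C $$ (i, j)) = m)" for m
  have "\<exists>i<?N. \<exists>j<?N. A $$ (i, j) \<noteq> 0"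
  proof (rule ccontr)
    assume "\<not> ?thesis"
    then have "A = 0\<^sub>m ?N ?N" using Suc.prems by (intro eq_matI) auto
    then show False using Suc.prems by simp
  qed
  then have "\<exists>m. P m" unfolding P_def using mp_equiv_refl[OF Suc.prems(1)] by blast
  then have "P (LEAST m. P m)" by (metis LeastI)
  then obtain C i0 j0 where C: "mp_equiv ?N A C" "i0 < ?N" "j0 < ?N" "C $$ (i0, j0) \<noteq> 0"
    "degree (C $$ (i0, j0)) = (LEAST m. P m)" unfolding P_def by blast
  have min: "degree (C $$ (i0, j0)) \<le> degree (E $$ (i, j))"
    if "mp_equiv ?N A E" "i < ?N" "j < ?N" "E $$ (i, j) \<noteq> 0" for E i j
    unfolding C(5) by (rule Least_le) (use that in \<open>auto simp: P_def\<close>)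
  have Cc: "C \<in> carrier_mat ?N ?N" using mp_equiv_carrier[OF C(1)] by simp
  define C1 where "C1 = swaprows 0 i0 C"
  define B where "B = transpose_mat (swaprows 0 j0 (transpose_mat C1))"
  have C1: "mp_equiv ?N A C1" "C1 \<in> carrier_mat ?N ?N" "C1 $$ (0, j0) = C $$ (i0, j0)"
    unfolding C1_def using mp_equiv_trans[OF C(1) mp_equiv_swaprows[OF Cc]] C Cc by auto
  have "mp_equiv ?N C1 B"
    unfolding B_def
    by (intro mp_equiv_via_transpose C1 mp_equiv_swaprows) (use C1 C in auto)
  then have B: "mp_equiv ?N A B" using mp_equiv_trans[OF C1(1)] by simp
  then have Bc: "B \<in> carrier_mat ?N ?N" using mp_equiv_carrier by blast
  define a where "a = B $$ (0, 0)"
  have a: "a = C $$ (i0, j0)" unfolding a_def B_def using C1 C by auto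
  have a0: "a \<noteq> 0" using a C by simp
  have min': "degree (E $$ (0, 0)) \<le> degree (F $$ (i, j))"
    if "E $$ (0, 0) = a" "mp_equiv ?N A F" "i < ?N" "j < ?N" "F $$ (i, j) \<noteq> 0" for E F i j
    using min[OF that(2-5)] that(1) a by simp
  obtain D where D: "D \<in> carrier_mat n n"
    "mp_equiv ?N B (four_block_mat (mat 1 1 (\<lambda>_. B $$ (0, 0))) (0\<^sub>m 1 n) (0\<^sub>m n 1) D)"
  proof (rule mp_equiv_clear_corner[OF Bc])
    show "B $$ (0, 0) dvd B $$ (i, 0)" if "i < ?N" for i
      by (rule mp_equiv_minimal_entry_dvd_column[OF min' B]) (use that a0 in \<open>auto simp: a_def\<close>)
    show "B $$ (0, 0) dvd B $$ (0, j)" if "j < ?N" for j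
      by (rule mp_equiv_minimal_entry_dvd_row[OF min' B]) (use that a0 in \<open>auto simp: a_def\<close>)
  qed
  let ?a = "mat 1 1 (\<lambda>_::nat \<times> nat. a)"
  have AD: "mp_equiv ?N A (four_block_mat ?a (0\<^sub>m 1 n) (0\<^sub>m n 1) D)"
    using mp_equiv_trans[OF B D(2)] unfolding a_def .
  then have "det D \<noteq> 0"
    using mp_equiv_det_nonzero[OF AD] Suc.prems(2) det_four_block_mat_lower_left_zero[of ?a 1 "0\<^sub>m 1 n" n "0\<^sub>m n 1" D] D(1)
    by auto
  from Suc.IH[OF D(1) this] obtain ss where ss: "length ss = n" "\<forall>s\<in>set ss. lead_coeff s = 1"
    "\<forall>i. Suc i < n \<longrightarrow> ss ! i dvd ss ! Suc i" "mp_equiv n D (mat_diag n ((!) ss))" by blast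
  let ?S = "mat_diag n ((!) ss)"
  define E where "E = four_block_mat ?a (0\<^sub>m 1 n) (0\<^sub>m n 1) ?S"
  have "mp_equiv (1 + n) (four_block_mat ?a (0\<^sub>m 1 n) (0\<^sub>m n 1) D) E"
    using mp_equiv_four_block[OF mp_equiv_refl[of ?a 1] ss(4), of "0\<^sub>m 1 n"]
    unfolding E_def by (metis mat_carrier zero_carrier_mat)
  then have E: "mp_equiv ?N A E" using mp_equiv_trans[OF AD] by simp
  have Ec: "E \<in> carrier_mat ?N ?N" using E mp_equiv_carrier by blast
  \<comment> \<open>Adding the second row to the first puts the next diagonal entry beside the least one.\<close>
  have dvd: "a dvd ss ! 0" if n: "n > 0"
  proof -
    define F where "F = addrow 1 0 1 E"
    have F: "mp_equiv ?N A F"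
      unfolding F_def using n by (intro mp_equiv_trans[OF E] mp_equiv_addrow Ec) auto
    have F00: "F $$ (0, 0) = a" and F01: "F $$ (0, 1) = ss ! 0"
      unfolding F_def E_def using n by (auto simp: mat_diag_def)
    have "F $$ (0, 0) dvd F $$ (0, 1)"
      by (rule mp_equiv_minimal_entry_dvd_row[OF min' F]) (use n F00 a0 in auto)
    then show ?thesis using F00 F01 by simp
  qed
  define c where "c = inverse (lead_coeff a)"
  have c: "c \<noteq> 0" using a0 unfolding c_def by simp
  have G: "mp_equiv ?N E (multrow 0 [:c:] E)" by (rule mp_equiv_multrow[OF Ec _ c]) simp
  have e: "multrow 0 [:c:] E = mat_diag ?N ((!) (smult c a # ss))"
    unfolding E_def mat_diag_Cons[of ss "smult c a", unfolded ss(1)]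
    by (rule eq_matI) (auto simp: mat_diag_def)
  have "lead_coeff (smult c a) = 1" using a0 unfolding c_def by simp
  moreover have "(smult c a # ss) ! i dvd (smult c a # ss) ! Suc i" if "Suc i < ?N" for i
    using that dvd ss(3) c by (cases i) (auto simp: smult_dvd_iff)
  ultimately show ?case
    using mp_equiv_trans[OF E G] ss(1,2) unfolding e by (intro exI[of _ "smult c a # ss"]) auto
qed

section \<open>Uniqueness of the Smith form and transfer of divisibility\<close>

definition smith_form :: "nat \<Rightarrow> 'a::field poly mat \<Rightarrow> 'a poly list \<Rightarrow> bool" where
  "smith_form n P ss \<longleftrightarrow> length ss = n \<and> (\<forall>s\<in>set ss. lead_coeff s = 1) \<and>
     (\<forall>i. Suc i < n \<longrightarrow> ss ! i dvd ss ! Suc i) \<and> mp_equiv n P (mat_diag n (\<lambda>i. ss ! i))"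

lemma smith_diagonal_iff_smith_form:
  assumes "P \<in> carrier_mat n n"
  shows "smith_diagonal P ss \<longleftrightarrow> smith_form n P ss"
  using assms unfolding smith_diagonal_def smith_form_def mp_equiv_def by auto

lemma smith_form_dvd_mono:
  assumes "smith_form n P ss" "i \<le> j" "j < n"
  shows "ss ! i dvd ss ! j"
  using assms(2,3)
proof (induction j rule: dec_induct)
  case (step m)
  then show ?case using assms(1) unfolding smith_form_def
    by (metis Suc_lessD dvd_trans)
qed simp

text \<open>In the Leibniz formula every permutation maps some index of \<open>{0..r}\<close> into \<open>{r..<n}\<close>, since
\<open>{0..r}\<close> does not fit into \<open>{0..<r}\<close>. So each summand contains an entry of the block with rows up to
\<open>r\<close> and columns from \<open>r\<close> on.\<close>

lemma dvd_mult_det_if_dvd_block: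
  fixes W :: "'a::comm_ring_1 mat"
  assumes W: "W \<in> carrier_mat n n" and r: "r < n"
    and block: "\<And>i j. i \<le> r \<Longrightarrow> r \<le> j \<Longrightarrow> j < n \<Longrightarrow> s dvd t * W $$ (i, j)"
  shows "s dvd t * det W"
proof -
  have "s dvd t * (signof p * (\<Prod>i = 0..<n. W $$ (i, p i)))" if p: "p permutes {0..<n}" for p
  proof -
    have "\<exists>i\<le>r. r \<le> p i"
    proof (rule ccontr)
      assume "\<not> ?thesis"
      then have "p ` {..r} \<subseteq> {..<r}" by force
      moreover have "inj_on p {..r}" using p by (meson inj_on_subset permutes_inj subset_UNIV)
      ultimately have "card {..r} \<le> card {..<r}" by (metis card_inj_on_le finite_lessThan)
      then show False by simp
    qed
    then obtain i where i: "i \<le> r" "r \<le> p i" by blast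
    then have "p i < n" using p r by (metis atLeastLessThan_iff le_less_trans permutes_in_image zero_le)
    then have "s dvd t * W $$ (i, p i)" using block i by blast
    moreover have "W $$ (i, p i) dvd (\<Prod>i = 0..<n. W $$ (i, p i))"
      using i r by (intro dvd_prodI) auto
    ultimately show ?thesis by (meson dvd_trans dvd_mult dvd_refl mult_dvd_mono)
  qed
  then show ?thesis
    unfolding det_def'[OF W] sum_distrib_left by (intro dvd_sum) auto
qed

text \<open>Multiplication by the adjugate \<open>V\<^sup>*\<close> of \<open>V\<close> turns the equation into
\<open>(det V) A D = E W\<close> with \<open>W = c V\<^sup>*\<close>, where \<open>D\<close> and \<open>E\<close> are the two diagonal matrices. Comparing
entries, \<open>s\<^sub>r\<close> divides \<open>t\<^sub>i W\<^sub>i\<^sub>j\<close>, hence \<open>t\<^sub>r W\<^sub>i\<^sub>j\<close>, whenever \<open>i \<le> r \<le> j\<close>. By the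
preceding lemma \<open>s\<^sub>r\<close> divides \<open>t\<^sub>r det W\<close>, and \<open>det W\<close> divides \<open>(c det V)\<^sup>n\<close>.\<close>

lemma diag_chain_dvd_transfer:
  fixes A V :: "'a::field poly mat"
  assumes A: "A \<in> carrier_mat n n" and V: "V \<in> carrier_mat n n"
    and eq: "A * mat_diag n s * V = c \<cdot>\<^sub>m mat_diag n t"
    and s: "\<And>i j. i \<le> j \<Longrightarrow> j < n \<Longrightarrow> s i dvd s j"
    and t: "\<And>i j. i \<le> j \<Longrightarrow> j < n \<Longrightarrow> t i dvd t j" and r: "r < n"
  shows "s r dvd t r * (c * det V) ^ n"
proof -
  let ?D = "mat_diag n s" and ?E = "mat_diag n t"
  define W where "W = c \<cdot>\<^sub>m adj_mat V"
  have D: "?D \<in> carrier_mat n n" and E: "?E \<in> carrier_mat n n" by auto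
  have adj: "adj_mat V \<in> carrier_mat n n" using adj_mat[OF V] by simp
  then have W: "W \<in> carrier_mat n n" unfolding W_def by simp
  have "c \<cdot>\<^sub>m ?E * adj_mat V = A * ?D * (V * adj_mat V)"
  proof -
    have "A * D * V * X = A * D * (V * X)" if "D \<in> carrier_mat n n" "X \<in> carrier_mat n n" for D X
      using that A V by (simp add: assoc_mult_mat[of _ n n _ n _ n])
    from this[OF D adj] show ?thesis unfolding eq .
  qed
  also have "\<dots> = det V \<cdot>\<^sub>m (A * ?D)"
    unfolding adj_mat(2)[OF V] using A D mult_smult_distrib[of "A * ?D" n n "1\<^sub>m n" n "det V"]
      right_mult_one_mat[of "A * ?D" n n] by simp
  finally have "c \<cdot>\<^sub>m ?E * adj_mat V = det V \<cdot>\<^sub>m (A * ?D)" .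
  then have key: "t i * W $$ (i, j) = det V * A $$ (i, j) * s j" if "i < n" "j < n" for i j
  proof -
    assume e: "c \<cdot>\<^sub>m ?E * adj_mat V = det V \<cdot>\<^sub>m (A * ?D)"
    have l: "(c \<cdot>\<^sub>m ?E * adj_mat V) $$ (i, j) = t i * W $$ (i, j)"
      unfolding mult_smult_assoc_mat[OF E adj] using that adj
      by (simp add: mat_diag_mult_left[OF adj] W_def)
    have "(det V \<cdot>\<^sub>m (A * ?D)) $$ (i, j) = det V * A $$ (i, j) * s j"
      using that A by (simp add: mat_diag_mult_right[OF A])
    with l e show ?thesis by simp
  qed
  have "s r dvd t r * W $$ (i, j)" if "i \<le> r" "r \<le> j" "j < n" for i j
  proof -
    have "s r dvd t i * W $$ (i, j)" using key[of i j] that s[of r j] by simp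
    moreover have "t i * W $$ (i, j) dvd t r * W $$ (i, j)"
      using t[of i r] that r by (simp add: mult_dvd_mono)
    ultimately show ?thesis by (rule dvd_trans)
  qed
  from dvd_mult_det_if_dvd_block[OF W r this] have "s r dvd t r * det W" .
  moreover have "det W dvd (c * det V) ^ n"
  proof -
    have "det V * det (adj_mat V) = det (det V \<cdot>\<^sub>m 1\<^sub>m n)"
      using det_mult[OF V adj] adj_mat(2)[OF V] by simp
    also have "\<dots> = det V ^ n" by simp
    finally have "det (adj_mat V) dvd det V ^ n" by (metis dvd_triv_right)
    moreover have "det W = c ^ n * det (adj_mat V)" unfolding W_def using adj by simp
    ultimately show ?thesis by (simp add: power_mult_distrib mult_dvd_mono)
  qed
  ultimately show ?thesis by (meson dvd_trans mult_dvd_mono dvd_refl)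
qed

text \<open>For unimodular \<open>V\<close> and \<open>c = 1\<close> this is the uniqueness of the Smith form. The general case
compares matrices that are equivalent only up to factors \<open>c\<close> and \<open>det V\<close>.\<close>

theorem smith_form_dvd_transfer:
  fixes P Q A V :: "'a::field poly mat"
  assumes P: "smith_form n P ss" and Q: "smith_form n Q ts"
    and A: "A \<in> carrier_mat n n" and V: "V \<in> carrier_mat n n"
    and eq: "A * P * V = c \<cdot>\<^sub>m Q" and r: "r < n"
  shows "ss ! r dvd ts ! r * (c * det V) ^ n"
proof -
  let ?D = "mat_diag n (\<lambda>i. ss ! i)" and ?E = "mat_diag n (\<lambda>i. ts ! i)"
  have "mp_equiv n ?D P" using P mp_equiv_sym unfolding smith_form_def by blast
  then obtain U1 V1 where 1: "?D \<in> carrier_mat n n" "U1 \<in> carrier_mat n n"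
    "V1 \<in> carrier_mat n n" "unimodular_mp V1" "U1 * ?D * V1 = P" unfolding mp_equiv_def by blast
  have "mp_equiv n Q ?E" using Q unfolding smith_form_def by blast
  then obtain U2 V2 where 2: "Q \<in> carrier_mat n n" "U2 \<in> carrier_mat n n"
    "V2 \<in> carrier_mat n n" "unimodular_mp V2" "U2 * Q * V2 = ?E" unfolding mp_equiv_def by blast
  have "(U2 * A * U1) * ?D * (V1 * V * V2) = U2 * (A * P * V) * V2"
  proof -
    have "(U2 * A * U1) * D * (V1 * V * V2) = U2 * (A * (U1 * D * V1) * V) * V2"
      if "D \<in> carrier_mat n n" for D
      using that 1(2,3) 2(1-3) A V by (simp add: assoc_mult_mat[of _ n n _ n _ n])
    from this[OF 1(1)] show ?thesis unfolding 1(5) .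
  qed
  also have "\<dots> = c \<cdot>\<^sub>m ?E"
    unfolding eq mult_smult_distrib[OF 2(2,1)]
    using mult_smult_assoc_mat[of "U2 * Q" n n V2 n c] 2 by simp
  finally have e: "(U2 * A * U1) * ?D * (V1 * V * V2) = c \<cdot>\<^sub>m ?E" .
  have "ss ! r dvd ts ! r * (c * det (V1 * V * V2)) ^ n"
    by (rule diag_chain_dvd_transfer[OF _ _ e])
      (use 1 2 A V r smith_form_dvd_mono[OF P] smith_form_dvd_mono[OF Q] in auto)
  also have "det (V1 * V * V2) = det V1 * det V * det V2"
    using 1(3) 2(3) V by (simp add: det_mult[of _ n])
  also obtain a b where "det V1 = [:a:]" "det V2 = [:b:]" "a \<noteq> 0" "b \<noteq> 0"
    using 1(4) 2(4) unfolding unimodular_mp_def by blast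
  then have "c * (det V1 * det V * det V2) = smult (a * b) (c * det V)"
    by (simp add: mult.commute mult.left_commute)
  also have "ts ! r * (smult (a * b) (c * det V)) ^ n = smult ((a * b) ^ n) (ts ! r * (c * det V) ^ n)"
    by (simp add: smult_power)
  finally show ?thesis using \<open>a \<noteq> 0\<close> \<open>b \<noteq> 0\<close> by (simp add: dvd_smult_iff)
qed

lemma monic_dvd_antisym:
  fixes s t :: "'a::field poly"
  assumes "lead_coeff s = 1" "lead_coeff t = 1" "s dvd t" "t dvd s"
  shows "s = t"
proof -
  from assms(3) obtain u where u: "t = s * u" by blast
  from assms(4) have "degree t \<le> degree s" "degree s \<le> degree t"
    using assms(1-3) by (auto intro!: dvd_imp_degree_le)
  moreover have "s \<noteq> 0" "u \<noteq> 0" using assms u by auto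
  ultimately have "degree u = 0" using u degree_mult_eq[of s u] by simp
  moreover have "lead_coeff u = 1" using assms(1,2) u by (simp add: lead_coeff_mult)
  ultimately have "u = 1" by (metis degree_eq_zeroE lead_coeff_pCons(2) one_pCons pCons_0_0 coeff_pCons_0)
  then show ?thesis using u by simp
qed

lemma smith_form_eqI:
  assumes "smith_form n P ss" "smith_form n Q ts"
    "\<And>r. r < n \<Longrightarrow> ss ! r dvd ts ! r" "\<And>r. r < n \<Longrightarrow> ts ! r dvd ss ! r"
  shows "ss = ts"
proof (rule nth_equalityI)
  fix r assume "r < length ss"
  then show "ss ! r = ts ! r"
    using assms unfolding smith_form_def by (intro monic_dvd_antisym) auto
qed (use assms in \<open>auto simp: smith_form_def\<close>)

lemma smith_form_unique:
  assumes "smith_form n P ss" "smith_form n P ts"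
  shows "ss = ts"
proof -
  have P: "P \<in> carrier_mat n n" using assms(1) mp_equiv_carrier unfolding smith_form_def by blast
  then have "1\<^sub>m n * P * 1\<^sub>m n = 1 \<cdot>\<^sub>m P" by auto
  from smith_form_dvd_transfer[OF assms _ _ this] smith_form_dvd_transfer[OF assms(2,1) _ _ this]
  show ?thesis by (intro smith_form_eqI[OF assms]) auto
qed

theorem invariant_polys_smith_form:
  assumes "P \<in> carrier_mat n n" "det P \<noteq> 0"
  shows "smith_form n P (invariant_polys P)"
proof -
  from smith_form_exists[OF assms] obtain ss where ss: "smith_form n P ss"
    unfolding smith_form_def by blast
  then have "invariant_polys P = ss"
    unfolding invariant_polys_def smith_diagonal_iff_smith_form[OF assms(1)]
    using smith_form_unique by blast
  with ss show ?thesis by simp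
qed

lemma invariant_polys_eqI:
  assumes "smith_form n P ss"
  shows "invariant_polys P = ss"
proof -
  have "P \<in> carrier_mat n n" using assms mp_equiv_carrier unfolding smith_form_def by blast
  then show ?thesis
    unfolding invariant_polys_def smith_diagonal_iff_smith_form[OF \<open>P \<in> carrier_mat n n\<close>]
    using smith_form_unique assms by blast
qed

lemma invariant_polys_equiv:
  assumes "mp_equiv n P Q" "det P \<noteq> 0"
  shows "invariant_polys Q = invariant_polys P"
  using invariant_polys_smith_form[OF mp_equiv_carrier(1)[OF assms(1)] assms(2)]
    mp_equiv_trans[OF mp_equiv_sym[OF assms(1)]]
  by (intro invariant_polys_eqI[of n]) (auto simp: smith_form_def)

lemma det_smith_form:
  assumes "smith_form n P ss"
  obtains c where "c \<noteq> 0" "det P = smult c (prod_list ss)"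
proof -
  have "mp_equiv n (mat_diag n (\<lambda>i. ss ! i)) P" "length ss = n"
    using assms mp_equiv_sym unfolding smith_form_def by blast+
  then obtain c where "c \<noteq> 0" "det P = smult c (det (mat_diag n (\<lambda>i. ss ! i)))"
    using mp_equiv_det by blast
  moreover have "det (mat_diag n (\<lambda>i. ss ! i)) = prod_list ss"
    unfolding det_mat_diag using \<open>length ss = n\<close>
    by (simp add: prod.list_conv_set_nth atLeast0LessThan)
  ultimately show ?thesis using that by simp
qed

section \<open>Block triangular matrices\<close>

text \<open>\<open>Ds\<close> lists the diagonal blocks of the block upper triangular matrix \<open>M\<close>, and all entries above
these blocks satisfy \<open>\<phi>\<close>. The recursion splits off the first block row, which lets one block
equivalence or one block division be treated at a time.\<close>

fun block_tri :: "('a::zero \<Rightarrow> bool) \<Rightarrow> 'a mat list \<Rightarrow> 'a mat \<Rightarrow> bool" where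
  "block_tri \<phi> [] M \<longleftrightarrow> M \<in> carrier_mat 0 0"
| "block_tri \<phi> (D # Ds) M \<longleftrightarrow> (\<exists>X A. D \<in> carrier_mat (dim_row D) (dim_row D) \<and>
     A \<in> carrier_mat (dim_row A) (dim_row A) \<and> X \<in> carrier_mat (dim_row D) (dim_row A) \<and>
     (\<forall>i<dim_row D. \<forall>j<dim_row A. \<phi> (X $$ (i, j))) \<and> block_tri \<phi> Ds A \<and>
     M = four_block_mat D X (0\<^sub>m (dim_row A) (dim_row D)) A)"

declare block_tri.simps(2) [simp del]

abbreviation btri :: "'a::zero mat list \<Rightarrow> 'a mat \<Rightarrow> bool" where
  "btri \<equiv> block_tri (\<lambda>_. True)"

abbreviation total_dim :: "'a mat list \<Rightarrow> nat" where
  "total_dim Ds \<equiv> sum_list (map dim_row Ds)"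

abbreviation single :: "'a \<Rightarrow> 'a mat" where
  "single x \<equiv> mat 1 1 (\<lambda>_. x)"

lemma block_tri_carrier:
  "block_tri \<phi> Ds M \<Longrightarrow> M \<in> carrier_mat (total_dim Ds) (total_dim Ds)"
proof (induction Ds arbitrary: M)
  case (Cons D Ds)
  from Cons.prems obtain X A where DA: "D \<in> carrier_mat (dim_row D) (dim_row D)" "block_tri \<phi> Ds A"
     "M = four_block_mat D X (0\<^sub>m (dim_row A) (dim_row D)) A"
    unfolding block_tri.simps(2) by (elim exE conjE) (rule that)
  show ?case
    unfolding DA(3) using four_block_carrier_mat[OF DA(1) Cons.IH[OF DA(2)]] by simp
qed simp

lemma block_tri_dim_row: "block_tri \<phi> Ds M \<Longrightarrow> dim_row M = total_dim Ds"
  by (rule carrier_matD(1)[OF block_tri_carrier])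

lemma block_tri_ConsI:
  assumes "D \<in> carrier_mat m m" "block_tri \<phi> Ds A" "X \<in> carrier_mat m (total_dim Ds)"
    "\<And>i j. i < m \<Longrightarrow> j < total_dim Ds \<Longrightarrow> \<phi> (X $$ (i, j))"
  shows "block_tri \<phi> (D # Ds) (four_block_mat D X (0\<^sub>m (total_dim Ds) m) A)"
  unfolding block_tri.simps(2) using assms block_tri_carrier[OF assms(2)]
  by (intro exI[of _ X] exI[of _ A]) auto

lemma block_tri_ConsE:
  assumes "block_tri \<phi> (D # Ds) M"
  obtains X A m where "D \<in> carrier_mat m m" "block_tri \<phi> Ds A"
    "A \<in> carrier_mat (total_dim Ds) (total_dim Ds)"
    "X \<in> carrier_mat m (total_dim Ds)"
    "\<forall>i<m. \<forall>j<total_dim Ds. \<phi> (X $$ (i, j))"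
    "M = four_block_mat D X (0\<^sub>m (total_dim Ds) m) A"
proof -
  from assms obtain X A where XA: "D \<in> carrier_mat (dim_row D) (dim_row D)" "block_tri \<phi> Ds A"
    "X \<in> carrier_mat (dim_row D) (dim_row A)"
    "\<forall>i<dim_row D. \<forall>j<dim_row A. \<phi> (X $$ (i, j))"
    "M = four_block_mat D X (0\<^sub>m (dim_row A) (dim_row D)) A"
    unfolding block_tri.simps(2) by (elim exE conjE) (rule that)
  note A = block_tri_carrier[OF XA(2)]
  show ?thesis
    by (rule that[OF XA(1,2) A XA(3-5)[unfolded carrier_matD(1)[OF A]]])
qed

lemma btri_ConsI:
  assumes "D \<in> carrier_mat m m" "btri Ds A" "X \<in> carrier_mat m (dim_row A)"
  shows "btri (D # Ds) (four_block_mat D X (0\<^sub>m (dim_row A) m) A)"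
  using block_tri_ConsI[OF assms(1,2), of X] assms(3) block_tri_dim_row[OF assms(2)] by simp

lemma btri_ConsE:
  assumes "btri (D # Ds) M"
  obtains X A m where "D \<in> carrier_mat m m" "btri Ds A"
    "A \<in> carrier_mat (total_dim Ds) (total_dim Ds)"
    "X \<in> carrier_mat m (total_dim Ds)"
    "M = four_block_mat D X (0\<^sub>m (total_dim Ds) m) A"
  by (rule block_tri_ConsE[OF assms]) (rule that; assumption)

lemma four_block_mat_assoc_upper:
  assumes "D \<in> carrier_mat m m" "A \<in> carrier_mat p p" "B \<in> carrier_mat q q"
    "X \<in> carrier_mat m p" "Y \<in> carrier_mat m q" "Z \<in> carrier_mat p q"
  shows "four_block_mat (four_block_mat D X (0\<^sub>m p m) A)
      (mat (m + p) q (\<lambda>(i, j). if i < m then Y $$ (i, j) else Z $$ (i - m, j))) (0\<^sub>m q (m + p)) B =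
    four_block_mat D (mat m (p + q) (\<lambda>(i, j). if j < p then X $$ (i, j) else Y $$ (i, j - p)))
      (0\<^sub>m (p + q) m) (four_block_mat A Z (0\<^sub>m q p) B)"
  by (rule eq_matI) (use assms in auto)

lemma btri_append:
  "btri (Ds @ Es) M \<longleftrightarrow> (\<exists>A X B. btri Ds A \<and> btri Es B \<and>
     X \<in> carrier_mat (total_dim Ds) (total_dim Es) \<and>
     M = four_block_mat A X (0\<^sub>m (total_dim Es) (total_dim Ds)) B)"
proof (induction Ds arbitrary: M)
  case Nil
  have "four_block_mat A X (0\<^sub>m (total_dim Es) 0) B = B"
    if "A \<in> carrier_mat 0 0" "btri Es B" "X \<in> carrier_mat 0 (total_dim Es)" for A X B
    by (rule eq_matI) (use that block_tri_carrier[OF that(2)] in auto)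
  then have "btri Es M \<longleftrightarrow> (\<exists>A X B. A \<in> carrier_mat 0 0 \<and> btri Es B \<and>
      X \<in> carrier_mat 0 (total_dim Es) \<and> M = four_block_mat A X (0\<^sub>m (total_dim Es) 0) B)"
    by (metis zero_carrier_mat)
  then show ?case by simp
next
  case (Cons D Ds)
  let ?p = "total_dim Ds" and ?q = "total_dim Es"
  show ?case
  proof
    assume "btri ((D # Ds) @ Es) M"
    then have "btri (D # (Ds @ Es)) M" by simp
    then obtain W A' m where "D \<in> carrier_mat m m" "btri (Ds @ Es) A'"
      "A' \<in> carrier_mat (total_dim (Ds @ Es)) (total_dim (Ds @ Es))"
      "W \<in> carrier_mat m (total_dim (Ds @ Es))"
      "M = four_block_mat D W (0\<^sub>m (total_dim (Ds @ Es)) m) A'" by (rule btri_ConsE)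
    moreover have "total_dim (Ds @ Es) = ?p + ?q" by simp
    ultimately have 1: "D \<in> carrier_mat m m" "btri (Ds @ Es) A'"
      "W \<in> carrier_mat m (?p + ?q)" "M = four_block_mat D W (0\<^sub>m (?p + ?q) m) A'"
      by simp_all
    from 1(2) obtain A Z B where 2: "btri Ds A" "btri Es B" "Z \<in> carrier_mat ?p ?q"
      "A' = four_block_mat A Z (0\<^sub>m ?q ?p) B" unfolding Cons.IH by blast
    note Ac = block_tri_carrier[OF 2(1)] and Bc = block_tri_carrier[OF 2(2)]
    define X where "X = mat m ?p (\<lambda>(i, j). W $$ (i, j))"
    define Y where "Y = mat m ?q (\<lambda>(i, j). W $$ (i, j + ?p))"
    have X: "X \<in> carrier_mat m ?p" and Y: "Y \<in> carrier_mat m ?q" unfolding X_def Y_def by auto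
    have "W = mat m (?p + ?q) (\<lambda>(i, j). if j < ?p then X $$ (i, j) else Y $$ (i, j - ?p))"
      using 1(3) by (intro eq_matI) (auto simp: X_def Y_def)
    then have "M = four_block_mat (four_block_mat D X (0\<^sub>m ?p m) A)
      (mat (m + ?p) ?q (\<lambda>(i, j). if i < m then Y $$ (i, j) else Z $$ (i - m, j))) (0\<^sub>m ?q (m + ?p)) B"
      unfolding 1(4) 2(4) four_block_mat_assoc_upper[OF 1(1) Ac Bc X Y 2(3)] by simp
    moreover have "btri (D # Ds) (four_block_mat D X (0\<^sub>m ?p m) A)"
      using btri_ConsI[OF 1(1) 2(1)] X Ac by auto
    ultimately show "\<exists>A X B. btri (D # Ds) A \<and> btri Es B \<and>
     X \<in> carrier_mat (total_dim (D # Ds)) ?q \<and>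
     M = four_block_mat A X (0\<^sub>m ?q (total_dim (D # Ds))) B"
      using 2(2) 1(1) by (intro exI[of _ "four_block_mat D X (0\<^sub>m ?p m) A"] exI[of _ B] exI
          [of _ "mat (m + ?p) ?q (\<lambda>(i, j). if i < m then Y $$ (i, j) else Z $$ (i - m, j))"]) simp
  next
    assume "\<exists>A X B. btri (D # Ds) A \<and> btri Es B \<and>
     X \<in> carrier_mat (total_dim (D # Ds)) ?q \<and>
     M = four_block_mat A X (0\<^sub>m ?q (total_dim (D # Ds))) B"
    then obtain A' W B where 0: "btri (D # Ds) A'" "btri Es B" "W \<in> carrier_mat (total_dim (D # Ds)) ?q"
      "M = four_block_mat A' W (0\<^sub>m ?q (total_dim (D # Ds))) B" by blast
    from 0(1) obtain X A m where 2: "D \<in> carrier_mat m m" "btri Ds A" "A \<in> carrier_mat ?p ?p"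
      "X \<in> carrier_mat m ?p" "A' = four_block_mat D X (0\<^sub>m ?p m) A" by (rule btri_ConsE)
    have "total_dim (D # Ds) = m + ?p" using 2(1) by simp
    with 0 have 1: "W \<in> carrier_mat (m + ?p) ?q" "M = four_block_mat A' W (0\<^sub>m ?q (m + ?p)) B" by simp_all
    note Bc = block_tri_carrier[OF 0(2)]
    define Y where "Y = mat m ?q (\<lambda>(i, j). W $$ (i, j))"
    define Z where "Z = mat ?p ?q (\<lambda>(i, j). W $$ (i + m, j))"
    have Y: "Y \<in> carrier_mat m ?q" and Z: "Z \<in> carrier_mat ?p ?q" unfolding Y_def Z_def by auto
    have "W = mat (m + ?p) ?q (\<lambda>(i, j). if i < m then Y $$ (i, j) else Z $$ (i - m, j))"
      using 1(1) by (intro eq_matI) (auto simp: Y_def Z_def)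
    then have M: "M = four_block_mat D
        (mat m (?p + ?q) (\<lambda>(i, j). if j < ?p then X $$ (i, j) else Y $$ (i, j - ?p)))
        (0\<^sub>m (?p + ?q) m) (four_block_mat A Z (0\<^sub>m ?q ?p) B)"
      unfolding 1(2) 2(5) four_block_mat_assoc_upper[OF 2(1,3) Bc 2(4) Y Z, symmetric] by simp
    have "btri (Ds @ Es) (four_block_mat A Z (0\<^sub>m ?q ?p) B)"
      unfolding Cons.IH using 2(2) 0(2) Z by blast
    from btri_ConsI[OF 2(1) this] show "btri ((D # Ds) @ Es) M"
      unfolding M using 2(3) Bc by auto
  qed
qed

text \<open>Consecutive diagonal blocks can be merged into one block, and a block that is itself block
triangular can be split.\<close>

lemma btri_group:
  "btri (xs @ Ds @ ys) M \<longleftrightarrow> (\<exists>F. btri Ds F \<and> btri (xs @ F # ys) M)"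
proof -
  have *: "btri (Ds @ ys) B \<longleftrightarrow> (\<exists>F. btri Ds F \<and> btri (F # ys) B)" for B
  proof
    assume "btri (Ds @ ys) B"
    then obtain F X C where F: "btri Ds F" "btri ys C" "X \<in> carrier_mat (total_dim Ds) (total_dim ys)"
      "B = four_block_mat F X (0\<^sub>m (total_dim ys) (total_dim Ds)) C" unfolding btri_append by blast
    have "btri (F # ys) B"
      using btri_ConsI[OF block_tri_carrier[OF F(1)] F(2)] F(3,4) block_tri_carrier[OF F(2)] by simp
    with F(1) show "\<exists>F. btri Ds F \<and> btri (F # ys) B" by blast
  next
    assume "\<exists>F. btri Ds F \<and> btri (F # ys) B"
    then obtain F where F: "btri Ds F" "btri (F # ys) B" by blast
    from F(2) obtain X A m where 1: "F \<in> carrier_mat m m" "btri ys A"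
      "A \<in> carrier_mat (total_dim ys) (total_dim ys)" "X \<in> carrier_mat m (total_dim ys)"
      "B = four_block_mat F X (0\<^sub>m (total_dim ys) m) A" by (rule btri_ConsE)
    have "m = total_dim Ds" using block_tri_dim_row[OF F(1)] 1(1) by simp
    with 1 F(1) show "btri (Ds @ ys) B" unfolding btri_append by blast
  qed
  have d: "total_dim (Ds @ ys) = total_dim (F # ys)" if "btri Ds F" for F
    using block_tri_dim_row[OF that] by simp
  show ?thesis
  proof
    assume "btri (xs @ Ds @ ys) M"
    then obtain A X B where 1: "btri xs A" "btri (Ds @ ys) B"
      "X \<in> carrier_mat (total_dim xs) (total_dim (Ds @ ys))"
      "M = four_block_mat A X (0\<^sub>m (total_dim (Ds @ ys)) (total_dim xs)) B"
      unfolding btri_append[of xs] by blast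
    from 1(2) obtain F where F: "btri Ds F" "btri (F # ys) B" unfolding * by blast
    have "btri (xs @ F # ys) M" unfolding btri_append[of xs] using 1 F d[OF F(1)] by metis
    with F show "\<exists>F. btri Ds F \<and> btri (xs @ F # ys) M" by blast
  next
    assume "\<exists>F. btri Ds F \<and> btri (xs @ F # ys) M"
    then obtain F where F: "btri Ds F" "btri (xs @ F # ys) M" by blast
    then obtain A X B where 1: "btri xs A" "btri (F # ys) B"
      "X \<in> carrier_mat (total_dim xs) (total_dim (F # ys))"
      "M = four_block_mat A X (0\<^sub>m (total_dim (F # ys)) (total_dim xs)) B"
      unfolding btri_append[of xs] by blast
    then have "btri (Ds @ ys) B" using * F by blast
    then show "btri (xs @ Ds @ ys) M" unfolding btri_append[of xs] using 1 F d[OF F(1)] by metis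
  qed
qed

lemma btri_concat:
  "btri (concat Dss) M \<Longrightarrow> \<exists>Fs. list_all2 btri Dss Fs \<and> btri Fs M"
proof (induction Dss arbitrary: M)
  case (Cons Ds Dss)
  then obtain F where F: "btri Ds F" "btri (F # concat Dss) M"
    using btri_group[of "[]" Ds "concat Dss" M] by auto
  from F(2) obtain X A m where 1: "F \<in> carrier_mat m m" "btri (concat Dss) A"
    "A \<in> carrier_mat (total_dim (concat Dss)) (total_dim (concat Dss))"
    "X \<in> carrier_mat m (total_dim (concat Dss))"
    "M = four_block_mat F X (0\<^sub>m (total_dim (concat Dss)) m) A" by (rule btri_ConsE)
  from Cons.IH[OF 1(2)] obtain Fs where Fs: "list_all2 btri Dss Fs" "btri Fs A" by blast
  have "btri (F # Fs) M" using btri_ConsI[OF 1(1) Fs(2)] 1(3-5) by auto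
  with Fs F show ?case by (intro exI[of _ "F # Fs"]) simp
qed simp

lemma btri_equiv:
  assumes "list_all2 (\<lambda>D E. mp_equiv (dim_row D) D E) Ds Es" "btri Ds M"
  shows "\<exists>N. btri Es N \<and> mp_equiv (total_dim Ds) M N"
  using assms
proof (induction arbitrary: M rule: list_all2_induct)
  case Nil
  then show ?case using mp_equiv_refl[of M 0] by auto
next
  case (Cons D Ds E Es)
  from Cons.prems obtain X A m where 1: "D \<in> carrier_mat m m" "btri Ds A"
    "A \<in> carrier_mat (total_dim Ds) (total_dim Ds)" "X \<in> carrier_mat m (total_dim Ds)"
    "M = four_block_mat D X (0\<^sub>m (total_dim Ds) m) A" by (rule btri_ConsE)
  from Cons.IH[OF 1(2)] obtain B where B: "btri Es B" "mp_equiv (total_dim Ds) A B" by blast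
  have DE: "mp_equiv m D E" using Cons.hyps(1) 1(1) by simp
  obtain Y where Y: "Y \<in> carrier_mat m (total_dim Ds)"
    "mp_equiv (m + total_dim Ds) M (four_block_mat E Y (0\<^sub>m (total_dim Ds) m) B)"
    using mp_equiv_four_block[OF DE B(2) 1(4)] unfolding 1(5) by blast
  have "btri (E # Es) (four_block_mat E Y (0\<^sub>m (total_dim Ds) m) B)"
    using btri_ConsI[OF mp_equiv_carrier(2)[OF DE] B(1)] Y(1) mp_equiv_carrier(2)[OF B(2)]
    by simp
  with Y(2) show ?case using 1(1) by auto
qed

lemma det_btri: "btri Ds M \<Longrightarrow> det (M :: 'a::idom mat) = prod_list (map det Ds)"
proof (induction Ds arbitrary: M)
  case (Cons D Ds)
  from Cons.prems obtain X A m where 1: "D \<in> carrier_mat m m" "btri Ds A"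
    "A \<in> carrier_mat (total_dim Ds) (total_dim Ds)" "X \<in> carrier_mat m (total_dim Ds)"
    "M = four_block_mat D X (0\<^sub>m (total_dim Ds) m) A" by (rule btri_ConsE)
  show ?case
    unfolding 1(5) det_four_block_mat_lower_left_zero[OF 1(1,4) refl 1(3)] Cons.IH[OF 1(2)]
    by simp
qed simp

lemma det_btri_single: "btri (map single ts) M \<Longrightarrow> det (M :: 'a::idom mat) = prod_list ts"
proof -
  have "map (det \<circ> single) ts = ts"
    by (rule map_idI) (simp add: det_single)
  then show "btri (map single ts) M \<Longrightarrow> det M = prod_list ts"
    using det_btri[of "map single ts" M] by simp
qed

lemma btri_mat_diag: "btri (map single ss) (mat_diag (length ss) (\<lambda>i. ss ! i))"
proof (induction ss)
  case (Cons s ss)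
  have "btri (single s # map single ss)
     (four_block_mat (single s) (0\<^sub>m 1 (length ss)) (0\<^sub>m (dim_row (mat_diag (length ss) (\<lambda>i. ss ! i))) 1)
        (mat_diag (length ss) (\<lambda>i. ss ! i)))"
    by (rule btri_ConsI[OF _ Cons.IH]) (auto simp: mat_diag_def)
  moreover have "dim_row (mat_diag (length ss) (\<lambda>i. ss ! i)) = length ss" by (simp add: mat_diag_def)
  ultimately show ?case
    unfolding length_Cons mat_diag_Cons by simp
qed (simp add: mat_diag_def)

section \<open>Triangular forms with balanced diagonal degrees\<close>

lemma dvd_entries_mult_mat:
  fixes A B :: "'a::comm_ring_1 mat"
  assumes "A \<in> carrier_mat n n" "B \<in> carrier_mat n n" "i < n" "j < n"
    "\<And>k. k < n \<Longrightarrow> x dvd A $$ (i, k) \<or> x dvd B $$ (k, j)"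
  shows "x dvd (A * B) $$ (i, j)"
proof -
  have "x dvd A $$ (i, k) * B $$ (k, j)" if "k < n" for k
    using assms(5)[OF that] by (auto intro: dvd_mult dvd_mult2)
  then show ?thesis using assms(1-4) by (auto simp: scalar_prod_def intro!: dvd_sum)
qed

lemma mp_equiv_dvd_entries:
  assumes "mp_equiv n P Q" "\<And>i j. i < n \<Longrightarrow> j < n \<Longrightarrow> x dvd P $$ (i, j)" "i < n" "j < n"
  shows "x dvd Q $$ (i, j)"
proof -
  from assms(1) obtain U V where 1: "P \<in> carrier_mat n n" "U \<in> carrier_mat n n"
    "V \<in> carrier_mat n n" "U * P * V = Q" unfolding mp_equiv_def by blast
  have UP: "x dvd (U * P) $$ (i, j)" if "i < n" "j < n" for i j
    using that assms(2) by (intro dvd_entries_mult_mat[OF 1(2,1)]) auto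
  have "x dvd (U * P * V) $$ (i, j)"
    by (rule dvd_entries_mult_mat[of _ n]) (use 1 assms(3,4) UP in auto)
  then show ?thesis using 1(4) by simp
qed

text \<open>Here \<open>g\<close> is the first invariant polynomial of \<open>P\<close>. The matrix with diagonal \<open>a'\<close>, \<open>b'\<close> and
upper right entry \<open>g\<close> has the first invariant polynomial \<open>g\<close> as well, because \<open>g\<close> divides all its
entries and is one of them. The second invariant polynomials agree because the determinants do.\<close>

lemma two_by_two_smith:
  fixes P Q :: "'a::field poly mat"
  assumes P: "btri [single a, single b] P" and ab: "a * b \<noteq> 0"
  shows "\<exists>g. g dvd a \<and> g dvd b \<and> (\<forall>a' b'. a' * b' = a * b \<longrightarrow> g dvd a' \<longrightarrow> g dvd b' \<longrightarrow>
    (\<exists>Q. btri [single a', single b'] Q \<and> mp_equiv 2 P Q))"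
proof -
  have P2: "P \<in> carrier_mat 2 2" using block_tri_carrier[OF P] by (simp add: numeral_2_eq_2)
  have det_of: "det Q = x * y" if "btri [single x, single y] Q" for x y :: "'a poly" and Q
    using det_btri_single[of "[x, y]" Q] that by simp
  have smith2: "\<exists>g h. lead_coeff g = 1 \<and> lead_coeff h = 1 \<and> g dvd h \<and>
      mp_equiv 2 Q (mat_diag 2 (\<lambda>i. [g, h] ! i)) \<and> (\<exists>c. c \<noteq> 0 \<and> x * y = smult c (g * h)) \<and>
      (\<forall>i<2. \<forall>j<2. g dvd Q $$ (i, j)) \<and> (\<forall>u. (\<forall>i<2. \<forall>j<2. u dvd Q $$ (i, j)) \<longrightarrow> u dvd g)"
    if Q: "btri [single x, single y] Q" "x * y \<noteq> 0" for x y :: "'a poly" and Q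
  proof -
    have Q2: "Q \<in> carrier_mat 2 2" using block_tri_carrier[OF Q(1)] by (simp add: numeral_2_eq_2)
    from smith_form_exists[OF Q2] det_of[OF Q(1)] Q(2)
    obtain ss where ss: "smith_form 2 Q ss" unfolding smith_form_def by metis
    then have "length ss = 2" by (simp add: smith_form_def)
    then obtain g h where gh: "ss = [g, h]"
      by (auto simp: numeral_2_eq_2 length_Suc_conv)
    have *: "lead_coeff g = 1" "lead_coeff h = 1" "g dvd h" "mp_equiv 2 Q (mat_diag 2 (\<lambda>i. [g, h] ! i))"
      using ss unfolding smith_form_def gh by auto
    obtain c where c: "c \<noteq> 0" "x * y = smult c (g * h)"
      using det_smith_form[OF ss] det_of[OF Q(1)] unfolding gh by auto
    have "g dvd Q $$ (i, j)" if "i < 2" "j < 2" for i j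
      by (rule mp_equiv_dvd_entries[OF mp_equiv_sym[OF *(4)] _ that])
        (use *(3) in \<open>auto simp: mat_diag_def less_2_cases_iff\<close>)
    moreover have "u dvd g" if "\<forall>i<2. \<forall>j<2. u dvd Q $$ (i, j)" for u
      using mp_equiv_dvd_entries[OF *(4), of u 0 0] that by (simp add: mat_diag_def)
    ultimately show ?thesis using * c by blast
  qed
  from smith2[OF P ab] obtain g h c where P: "lead_coeff g = 1" "lead_coeff h = 1" "g dvd h"
    "mp_equiv 2 P (mat_diag 2 (\<lambda>i. [g, h] ! i))" "c \<noteq> 0" "a * b = smult c (g * h)"
    "\<forall>i<2. \<forall>j<2. g dvd P $$ (i, j)" by blast
  have entries: "btri [single x, single y]
      (four_block_mat (single x) (single z) (0\<^sub>m 1 1) (single y))" for x y z :: "'a poly"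
  proof -
    have y: "btri [single y] (four_block_mat (single y) (0\<^sub>m 1 0) (0\<^sub>m (dim_row (0\<^sub>m 0 0 :: 'a poly mat)) 1) (0\<^sub>m 0 0))"
      by (rule btri_ConsI) auto
    also have "four_block_mat (single y) (0\<^sub>m 1 0) (0\<^sub>m (dim_row (0\<^sub>m 0 0 :: 'a poly mat)) 1) (0\<^sub>m 0 0) = single y"
      by (rule eq_matI) auto
    finally have "btri [single y] (single y)" .
    from btri_ConsI[OF _ this, of "single x" 1 "single z"] show ?thesis by auto
  qed
  have "g dvd a" "g dvd b"
  proof -
    from assms(1) obtain X A m where 1: "single a \<in> carrier_mat m m" "btri [single b] A"
      "A \<in> carrier_mat (total_dim [single b]) (total_dim [single b])" 
      "X \<in> carrier_mat m (total_dim [single b])"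
      "P = four_block_mat (single a) X (0\<^sub>m (total_dim [single b]) m) A" by (rule btri_ConsE)
    from 1(2) obtain Y B l where 2: "single b \<in> carrier_mat l l" "btri [] B"
      "B \<in> carrier_mat (total_dim ([] :: 'a poly mat list)) (total_dim ([] :: 'a poly mat list))" 
      "Y \<in> carrier_mat l (total_dim ([] :: 'a poly mat list))"
      "A = four_block_mat (single b) Y (0\<^sub>m (total_dim ([] :: 'a poly mat list)) l) B" by (rule btri_ConsE)
    have "P $$ (0, 0) = a" unfolding 1(5) using 1(3) by simp
    moreover have "P $$ (1, 1) = b" unfolding 1(5) 2(5) using 1(1) 2(3) by simp
    ultimately show "g dvd a" "g dvd b" using P(7)[rule_format, of 0 0] P(7)[rule_format, of 1 1] by simp_all
  qed
  moreover have "\<exists>Q. btri [single a', single b'] Q \<and> mp_equiv 2 P Q"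
    if ab': "a' * b' = a * b" "g dvd a'" "g dvd b'" for a' b'
  proof -
    define Q where "Q = four_block_mat (single a') (single g) (0\<^sub>m 1 1) (single b')"
    have Q: "btri [single a', single b'] Q" unfolding Q_def by (rule entries)
    have ne: "a' * b' \<noteq> 0" using ab' ab by simp
    from smith2[OF Q ne] obtain g' h' c' where Q': "lead_coeff g' = 1" "lead_coeff h' = 1" "g' dvd h'"
      "mp_equiv 2 Q (mat_diag 2 (\<lambda>i. [g', h'] ! i))" "c' \<noteq> 0" "a' * b' = smult c' (g' * h')"
      "\<forall>i<2. \<forall>j<2. g' dvd Q $$ (i, j)" "\<forall>u. (\<forall>i<2. \<forall>j<2. u dvd Q $$ (i, j)) \<longrightarrow> u dvd g'" by blast
    have "Q $$ (0, 1) = g" unfolding Q_def by simp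
    then have "g' dvd g" using Q'(7)[rule_format, of 0 1] by simp
    moreover have "g dvd g'" using Q'(8) ab'(2,3)
      by (auto simp: Q_def less_2_cases_iff)
    ultimately have g: "g' = g" using Q'(1) P(1) monic_dvd_antisym by blast
    have "smult c' (g * h') = smult c (g * h)" using Q'(6) P(6) ab' g by simp
    then have "g * smult c' h' = g * smult c h" by simp
    moreover have "g \<noteq> 0" using P(1) by auto
    ultimately have e: "smult c' h' = smult c h" using mult_left_cancel by blast
    then have "c' = c" using Q'(2) P(2) by (metis lead_coeff_smult mult.right_neutral)
    with e Q'(5) have "h' = h" by (metis smult_cancel)
    with Q'(4) g have "mp_equiv 2 Q (mat_diag 2 (\<lambda>i. [g, h] ! i))" by simp
    then have "mp_equiv 2 P Q" using mp_equiv_trans[OF P(4)] mp_equiv_sym by blast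
    with Q show ?thesis by blast
  qed
  ultimately show ?thesis by blast
qed

definition triangularizable_to :: "nat \<Rightarrow> 'a::field poly mat \<Rightarrow> 'a poly list \<Rightarrow> bool" where
  "triangularizable_to n P ts \<longleftrightarrow> (\<exists>M. btri (map single ts) M \<and> mp_equiv n P M)"

lemma triangularizable_to_smith:
  assumes "smith_form n P ss"
  shows "triangularizable_to n P ss"
  using assms btri_mat_diag[of ss] unfolding triangularizable_to_def smith_form_def by blast

lemma list_all2_mp_equiv_refl:
  "list_all2 (\<lambda>D E. mp_equiv (dim_row D) D E) (map single xs) (map single xs)"
  by (auto simp: list_all2_conv_all_nth intro!: mp_equiv_refl)

lemma total_dim_single: "total_dim (map single ts) = length ts"
  by (induction ts) auto

lemma triangularizable_to_length:
  assumes "triangularizable_to n P ts" shows "length ts = n"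
proof -
  from assms obtain M where M: "btri (map single ts) M" "mp_equiv n P M"
    unfolding triangularizable_to_def by blast
  show ?thesis
    using block_tri_dim_row[OF M(1)] mp_equiv_carrier(2)[OF M(2)] total_dim_single[of ts] by simp
qed

lemma triangularizable_to_det:
  assumes "triangularizable_to n P ts"
  obtains c where "c \<noteq> 0" "prod_list ts = smult c (det P)"
proof -
  from assms obtain M where M: "btri (map single ts) M" "mp_equiv n P M"
    unfolding triangularizable_to_def by blast
  then show ?thesis using mp_equiv_det[OF M(2)] det_btri_single[OF M(1)] that by metis
qed

lemma triangularizable_to_exchange:
  assumes T: "triangularizable_to n P (xs @ [a, b] @ ys)" and ne: "det P \<noteq> 0"
  shows "\<exists>g. g dvd a \<and> g dvd b \<and> (\<forall>a' b'. a' * b' = a * b \<longrightarrow> g dvd a' \<longrightarrow> g dvd b' \<longrightarrow>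
    triangularizable_to n P (xs @ [a', b'] @ ys))"
proof -
  let ?x = "map single xs" and ?y = "map single ys"
  from T obtain M where M: "btri (?x @ [single a, single b] @ ?y) M" "mp_equiv n P M"
    unfolding triangularizable_to_def by auto
  from M(1) obtain F where F: "btri [single a, single b] F" "btri (?x @ F # ?y) M"
    unfolding btri_group[of ?x "[single a, single b]"] by blast
  have "prod_list (xs @ [a, b] @ ys) \<noteq> 0"
    by (rule triangularizable_to_det[OF T]) (use ne in auto)
  then have ab: "a * b \<noteq> 0" by auto
  have dF: "dim_row F = 2" using block_tri_dim_row[OF F(1)] by simp
  from two_by_two_smith[OF F(1) ab] obtain g where g: "g dvd a" "g dvd b"
    "\<And>a' b'. a' * b' = a * b \<Longrightarrow> g dvd a' \<Longrightarrow> g dvd b' \<Longrightarrow>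
      \<exists>Q. btri [single a', single b'] Q \<and> mp_equiv 2 F Q" by blast
  have "triangularizable_to n P (xs @ [a', b'] @ ys)"
    if "a' * b' = a * b" "g dvd a'" "g dvd b'" for a' b'
  proof -
    from g(3)[OF that] obtain Q where Q: "btri [single a', single b'] Q" "mp_equiv 2 F Q" by blast
    have "list_all2 (\<lambda>D E. mp_equiv (dim_row D) D E) (?x @ F # ?y) (?x @ Q # ?y)"
      using Q(2) dF list_all2_mp_equiv_refl by (intro list_all2_appendI list_all2_Cons[THEN iffD2]) auto
    from btri_equiv[OF this F(2)] obtain N where N: "btri (?x @ Q # ?y) N"
      "mp_equiv (total_dim (?x @ F # ?y)) M N" by blast
    have "total_dim (?x @ F # ?y) = n"
      using block_tri_dim_row[OF F(2)] mp_equiv_carrier(2)[OF M(2)] by simp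
    then have "mp_equiv n P N" using mp_equiv_trans[OF M(2)] N(2) by simp
    moreover have "btri (?x @ [single a', single b'] @ ?y) N"
      unfolding btri_group[of ?x "[single a', single b']"] using N(1) Q(1) by blast
    ultimately show ?thesis unfolding triangularizable_to_def by auto
  qed
  with g(1,2) show ?thesis by blast
qed

lemma triangularizable_to_swap:
  assumes "triangularizable_to n P (xs @ [a, b] @ ys)" "det P \<noteq> 0"
  shows "triangularizable_to n P (xs @ [b, a] @ ys)"
  using triangularizable_to_exchange[OF assms] by (metis mult.commute)

lemma permuted_if_closed_under_adjacent_swaps:
  assumes swap: "\<And>xs a b ys. R (xs @ [a, b] @ ys) \<Longrightarrow> R (xs @ [b, a] @ ys)"
    and "mset ts = mset us" "R (pre @ ts)"
  shows "R (pre @ us)"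
  using assms(2,3)
proof (induction us arbitrary: ts pre)
  case (Cons u us)
  then have "u \<in> set ts" by (metis list.set_intros(1) set_mset_mset)
  then obtain vs ws where vw: "ts = vs @ u # ws" by (meson split_list)
  have "R (pre @ u # vs @ ws)"
    using Cons.prems(2) unfolding vw
  proof (induction vs arbitrary: ws rule: rev_induct)
    case (snoc v vs)
    from swap[of "pre @ vs" v u ws] snoc.prems have "R (pre @ vs @ u # v # ws)" by simp
    from snoc.IH[OF this] show ?case by simp
  qed simp
  then show ?case using Cons.IH[of "vs @ ws" "pre @ [u]"] Cons.prems(1) vw by simp
qed simp

lemma triangularizable_to_permute:
  assumes "triangularizable_to n P ts" "det P \<noteq> 0" "mset ts = mset us"
  shows "triangularizable_to n P us"
proof -
  have "triangularizable_to n P ([] @ us)"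
    by (rule permuted_if_closed_under_adjacent_swaps[where R = "triangularizable_to n P" and ts = ts])
      (use triangularizable_to_swap assms in simp_all)
  then show ?thesis by simp
qed

text \<open>If \<open>deg x > deg y + k\<close>, let \<open>g\<close> be the common divisor supplied by the exchange lemma for the
neighbours \<open>y\<close>, \<open>x\<close>. Then \<open>x / g\<close> is not constant, and a factor of it of degree at most \<open>k\<close> moves
from \<open>x\<close> to \<open>y\<close>. Both new degrees lie strictly between the old ones, so the sum of the squared
degrees drops.\<close>

lemma triangularizable_to_balanced:
  fixes P :: "'a::field poly mat"
  assumes "triangularizable_to n P ts" and ne: "det P \<noteq> 0"
    and small: "\<And>b. b dvd det P \<Longrightarrow> 0 < degree b \<Longrightarrow> \<exists>p. p dvd b \<and> 0 < degree p \<and> degree p \<le> k"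
  shows "\<exists>us. triangularizable_to n P us \<and> (\<forall>x\<in>set us. \<forall>y\<in>set us. degree x \<le> degree y + k)"
  using assms(1)
proof (induction "\<Sum>t\<leftarrow>ts. (degree t)\<^sup>2" arbitrary: ts rule: less_induct)
  case less
  show ?case
  proof (cases "\<forall>x\<in>set ts. \<forall>y\<in>set ts. degree x \<le> degree y + k")
    case False
    then obtain x y where xy: "x \<in> set ts" "y \<in> set ts" "degree x > degree y + k" by force
    then have "x \<noteq> y" by auto
    then obtain rest where rest: "mset ts = mset (y # x # rest)"
    proof -
      have "mset ts = add_mset y (mset ts - {#y#})" using xy(2) by simp
      moreover have "x \<in># mset ts - {#y#}" using xy(1) \<open>x \<noteq> y\<close> by (simp add: in_diff_count)
      then have "mset ts - {#y#} = add_mset x (mset ts - {#y#} - {#x#})" by (rule insert_DiffM[symmetric])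
      moreover obtain rest where "mset rest = mset ts - {#y#} - {#x#}" using ex_mset by blast
      ultimately have "mset ts = mset (y # x # rest)" by simp
      then show ?thesis by (rule that)
    qed
    have T: "triangularizable_to n P ([] @ [y, x] @ rest)"
      using triangularizable_to_permute[OF less.prems ne rest] by simp
    from triangularizable_to_exchange[OF T ne] obtain g where g: "g dvd y" "g dvd x"
      "\<And>a' b'. a' * b' = y * x \<Longrightarrow> g dvd a' \<Longrightarrow> g dvd b' \<Longrightarrow>
         triangularizable_to n P (a' # b' # rest)" by auto
    obtain c where c: "c \<noteq> 0" "y * (x * prod_list rest) = smult c (det P)"
      using triangularizable_to_det[OF T] by auto
    then have nz: "x \<noteq> 0" "y \<noteq> 0" using ne by auto
    from g(2) obtain u where u: "x = g * u" by blast
    have "degree g \<le> degree y" using g(1) nz by (simp add: dvd_imp_degree_le)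
    moreover have "degree x = degree g + degree u" using u nz by (simp add: degree_mult_eq)
    ultimately have "0 < degree u" using xy(3) by simp
    moreover have "u dvd det P"
    proof -
      have "u dvd y * (x * prod_list rest)" unfolding u by simp
      then show ?thesis unfolding c(2) using c(1) by (simp add: dvd_smult_iff)
    qed
    ultimately obtain p where p: "p dvd u" "0 < degree p" "degree p \<le> k" using small by blast
    from p(1) obtain v where v: "u = p * v" by blast
    let ?new = "(y * p) # (g * v) # rest"
    have "triangularizable_to n P ?new"
      by (rule g(3)) (use g(1) in \<open>auto simp: u v\<close>)
    moreover have "(\<Sum>t\<leftarrow>?new. (degree t)\<^sup>2) < (\<Sum>t\<leftarrow>ts. (degree t)\<^sup>2)"
    proof -
      have "(\<Sum>t\<leftarrow>ts. (degree t)\<^sup>2) = (\<Sum>t\<leftarrow>y # x # rest. (degree t)\<^sup>2)"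
        using rest by (simp only: sum_mset_sum_list[symmetric] mset_map)
      moreover have "degree (y * p) = degree y + degree p"
        using nz u v by (intro degree_mult_eq) auto
      moreover have dx: "degree x = degree (g * v) + degree p"
      proof -
        have "x = (g * v) * p" using u v by (simp only: ac_simps)
        then show ?thesis using nz(1) degree_mult_eq[of "g * v" p] by (metis mult_eq_0_iff)
      qed
      moreover have "(degree y + degree p)\<^sup>2 + (degree (g * v))\<^sup>2 < (degree y)\<^sup>2 + (degree (g * v) + degree p)\<^sup>2"
      proof -
        have "degree y < degree (g * v)" using xy(3) p(3) dx by simp
        then have "degree p * degree y < degree p * degree (g * v)" using p(2) by simp
        then have "degree p * degree y + degree p * degree y < degree p * degree (g * v) + degree p * degree (g * v)"
          by (rule add_strict_mono[OF _ \<open>degree p * degree y < degree p * degree (g * v)\<close>])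
        then show ?thesis by (simp only: power2_eq_square algebra_simps)
      qed
      ultimately show ?thesis by simp
    qed
    ultimately show ?thesis using less.hyps by blast
  qed (use less.prems in blast)
qed

section \<open>Partitions into short zero-sum parts\<close>

lemma sum_list_map_neg:
  fixes f :: "'b \<Rightarrow> int"
  assumes "xs \<noteq> []" "\<forall>x\<in>set xs. f x < 0"
  shows "(\<Sum>x\<leftarrow>xs. f x) < 0"
  using assms
proof (induction xs)
  case (Cons x xs)
  then show ?case by (cases "xs = []") auto
qed simp

text \<open>Greedy ordering: after a prefix sum that is not positive choose a nonnegative term, otherwise a
negative one. A suitable term is left because all remaining terms together bring the sum to zero.\<close>

lemma bounded_prefix_sums_ordering:
  fixes f :: "'b \<Rightarrow> int"
  assumes "S + (\<Sum>x\<leftarrow>xs. f x) = 0" "- a < S" "S \<le> b" "0 < a"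
    "\<forall>x\<in>set xs. - a \<le> f x \<and> f x \<le> b"
  shows "\<exists>ys. mset ys = mset xs \<and>
    (\<forall>i\<le>length ys. - a < S + (\<Sum>x\<leftarrow>take i ys. f x) \<and> S + (\<Sum>x\<leftarrow>take i ys. f x) \<le> b)"
  using assms
proof (induction "length xs" arbitrary: xs S)
  case (Suc l)
  have ne: "xs \<noteq> []" using Suc.hyps(2) by auto
  have "\<exists>x\<in>set xs. if S \<le> 0 then 0 \<le> f x else f x < 0"
  proof (rule ccontr)
    assume neg: "\<not> ?thesis"
    show False
    proof (cases "S \<le> 0")
      case True
      then have "\<forall>x\<in>set xs. f x < 0" using neg by auto
      then have "(\<Sum>x\<leftarrow>xs. f x) < 0" using ne by (intro sum_list_map_neg)
      then show False using Suc.prems(1) True by simp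
    next
      case False
      then have "\<forall>x\<in>set xs. f x \<ge> 0" using neg by auto
      then have "(\<Sum>x\<leftarrow>xs. f x) \<ge> 0" by (intro sum_list_nonneg) auto
      then show False using Suc.prems(1) False by simp
    qed
  qed
  then obtain x where x: "x \<in> set xs" "if S \<le> 0 then 0 \<le> f x else f x < 0" by blast
  let ?xs = "remove1 x xs"
  have m: "mset xs = add_mset x (mset ?xs)" using x(1) by simp
  have s: "(\<Sum>x\<leftarrow>xs. f x) = f x + (\<Sum>x\<leftarrow>?xs. f x)" using x(1) by (rule sum_list_map_remove1)
  have "- a \<le> f x \<and> f x \<le> b" using Suc.prems(5) x(1) by blast
  then have S': "- a < S + f x" "S + f x \<le> b" using x(2) Suc.prems(2-4) by (auto split: if_splits)
  have "\<exists>ys. mset ys = mset ?xs \<and> (\<forall>i\<le>length ys. - a < (S + f x) + (\<Sum>x\<leftarrow>take i ys. f x) \<and>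
      (S + f x) + (\<Sum>x\<leftarrow>take i ys. f x) \<le> b)"
  proof (rule Suc.hyps(1))
    show "l = length ?xs" using Suc.hyps(2) x(1) by (simp add: length_remove1)
    show "S + f x + (\<Sum>x\<leftarrow>?xs. f x) = 0" using Suc.prems(1) s by simp
    show "\<forall>x\<in>set ?xs. - a \<le> f x \<and> f x \<le> b" using Suc.prems(5) set_remove1_subset[of x xs] by blast
  qed (use S' Suc.prems in auto)
  then obtain ys where ys: "mset ys = mset ?xs" "\<forall>i\<le>length ys. - a < (S + f x) + (\<Sum>x\<leftarrow>take i ys. f x) \<and>
      (S + f x) + (\<Sum>x\<leftarrow>take i ys. f x) \<le> b" by blast
  have "- a < S + (\<Sum>x\<leftarrow>take i (x # ys). f x) \<and> S + (\<Sum>x\<leftarrow>take i (x # ys). f x) \<le> b"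
    if "i \<le> length (x # ys)" for i
    using that ys(2) Suc.prems(2,3) by (cases i) (auto simp: add.assoc)
  then show ?case using m ys(1) by (intro exI[of _ "x # ys"]) simp
qed simp

text \<open>In the greedy order the prefix sums lie in an interval with at most \<open>k\<close> integers. So two of
the first \<open>k + 1\<close> prefix sums agree, and the terms between them sum to zero.\<close>

lemma short_zero_sum_part:
  fixes f :: "'b \<Rightarrow> int"
  assumes sum: "(\<Sum>x\<leftarrow>xs. f x) = 0" and ne: "xs \<noteq> []" and k: "1 \<le> k"
    and spread: "\<forall>x\<in>set xs. \<forall>y\<in>set xs. f x \<le> f y + int k"
  shows "\<exists>ys zs. mset xs = mset (ys @ zs) \<and> ys \<noteq> [] \<and> length ys \<le> k \<and> (\<Sum>x\<leftarrow>ys. f x) = 0"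
proof (cases "length xs \<le> k")
  case True
  then show ?thesis using sum ne by (intro exI[of _ xs] exI[of _ "[]"]) simp
next
  case False
  define lo where "lo = Min (f ` set xs)"
  define hi where "hi = Max (f ` set xs)"
  have fin: "finite (f ` set xs)" "f ` set xs \<noteq> {}" using ne by auto
  have bounds: "\<forall>x\<in>set xs. lo \<le> f x \<and> f x \<le> hi" using fin unfolding lo_def hi_def by auto
  have "lo \<in> f ` set xs" "hi \<in> f ` set xs" using fin unfolding lo_def hi_def by auto
  then have width: "hi \<le> lo + int k" using spread by auto
  show ?thesis
  proof (cases "lo < 0")
    case nonneg: False
    then have pos: "\<forall>x\<in>set xs. f x \<ge> 0" using bounds by fastforce
    then have z: "\<forall>x\<in>set xs. f x = 0"
      using sum_list_nonneg_eq_0_iff[of "map f xs"] sum by auto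
    obtain x where "x \<in> set xs" using ne by (meson list.set_sel(1))
    then show ?thesis using z k
      by (intro exI[of _ "[x]"] exI[of _ "remove1 x xs"]) auto
  next
    case True
    have "hi \<ge> 0"
    proof (rule ccontr)
      assume "\<not> ?thesis"
      then have "\<forall>x\<in>set xs. f x < 0" using bounds by fastforce
      then have "(\<Sum>x\<leftarrow>xs. f x) < 0" using ne by (intro sum_list_map_neg)
      then show False using sum by simp
    qed
    with bounded_prefix_sums_ordering[of 0 f xs "- lo" hi] sum True bounds
    obtain ys where ys: "mset ys = mset xs"
      "\<forall>i\<le>length ys. lo < (\<Sum>x\<leftarrow>take i ys. f x) \<and> (\<Sum>x\<leftarrow>take i ys. f x) \<le> hi" by auto
    have len: "length ys > k" using False ys(1) by (metis not_le size_mset)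
    define g where "g i = (\<Sum>x\<leftarrow>take i ys. f x)" for i
    have "g ` {0..k} \<subseteq> {lo<..hi}" using ys(2) len unfolding g_def by auto
    then have "card (g ` {0..k}) \<le> card {lo<..hi}" by (intro card_mono) auto
    also have "\<dots> \<le> k" using width by simp
    finally have "\<not> inj_on g {0..k}" using card_image[of g "{0..k}"] by auto
    then obtain i j where ij: "i < j" "j \<le> k" "g i = g j"
      unfolding inj_on_def by (metis atLeastAtMost_iff linorder_neqE_nat)
    define seg where "seg = drop i (take j ys)"
    have t: "take j ys = take i ys @ seg"
    proof -
      have "take i (take j ys) = take i ys" using ij(1) by simp
      then show ?thesis unfolding seg_def by (metis append_take_drop_id)
    qed
    have "(\<Sum>x\<leftarrow>seg. f x) = 0" using ij(3) unfolding g_def t by simp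
    moreover have "length seg = j - i" unfolding seg_def using len ij by simp
    moreover have "mset xs = mset (seg @ take i ys @ drop j ys)"
    proof -
      have "mset xs = mset (take j ys @ drop j ys)" using ys(1) by simp
      then show ?thesis unfolding t by simp
    qed
    ultimately show ?thesis using ij by (intro exI[of _ seg] exI[of _ "take i ys @ drop j ys"]) auto
  qed
qed

theorem short_zero_sum_partition:
  fixes f :: "'b \<Rightarrow> int"
  assumes "(\<Sum>x\<leftarrow>xs. f x) = 0" "1 \<le> k"
    and "\<forall>x\<in>set xs. \<forall>y\<in>set xs. f x \<le> f y + int k"
  shows "\<exists>yss. mset (concat yss) = mset xs \<and>
    (\<forall>ys\<in>set yss. ys \<noteq> [] \<and> length ys \<le> k \<and> (\<Sum>x\<leftarrow>ys. f x) = 0)"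
  using assms
proof (induction "length xs" arbitrary: xs rule: less_induct)
  case less
  show ?case
  proof (cases "xs = []")
    case False
    from short_zero_sum_part[OF less.prems(1) False less.prems(2,3)] obtain ys zs where
      yz: "mset xs = mset (ys @ zs)" "ys \<noteq> []" "length ys \<le> k" "(\<Sum>x\<leftarrow>ys. f x) = 0" by blast
    have "length xs = length ys + length zs" by (metis yz(1) length_append size_mset)
    then have l: "length zs < length xs" using yz(2) by simp
    have "(\<Sum>x\<leftarrow>xs. f x) = (\<Sum>x\<leftarrow>ys @ zs. f x)"
      using yz(1) by (simp only: sum_mset_sum_list[symmetric] mset_map)
    then have s: "(\<Sum>x\<leftarrow>zs. f x) = 0" using less.prems(1) yz(4) by simp
    have "set zs \<subseteq> set xs" by (metis yz(1) set_mset_mset set_append Un_upper2)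
    then have "\<forall>x\<in>set zs. \<forall>y\<in>set zs. f x \<le> f y + int k" using less.prems(3) by blast
    from less.hyps[OF l s less.prems(2) this] obtain yss where
      "mset (concat yss) = mset zs" "\<forall>ys\<in>set yss. ys \<noteq> [] \<and> length ys \<le> k \<and> (\<Sum>x\<leftarrow>ys. f x) = 0" by blast
    then show ?thesis using yz by (intro exI[of _ "ys # yss"]) auto
  qed (auto intro: exI[of _ "[]"])
qed

section \<open>Monic matrices in an equivalence class\<close>

text \<open>Column \<open>j\<close> has degree \<open>c j\<close>, and the coefficients of \<open>\<lambda>\<^sup>c\<^sup>j\<close> in the columns form the
identity matrix. A Smith form is of this kind, and for constant \<open>c\<close> it is a monic matrix polynomial.\<close>

definition column_monic :: "(nat \<Rightarrow> nat) \<Rightarrow> nat \<Rightarrow> 'a::field poly mat \<Rightarrow> bool" where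
  "column_monic c m A \<longleftrightarrow> A \<in> carrier_mat m m \<and> (\<forall>i<m. \<forall>j<m. \<forall>e\<ge>c j.
     coeff (A $$ (i, j)) e = (if i = j \<and> e = c j then 1 else 0))"

text \<open>A nonsingular matrix of leading column coefficients is made the identity by its constant inverse.\<close>

lemma column_monic_normalize:
  fixes A :: "'a::field poly mat"
  assumes A: "A \<in> carrier_mat m m"
    and deg: "\<And>i j e. i < m \<Longrightarrow> j < m \<Longrightarrow> c j < e \<Longrightarrow> coeff (A $$ (i, j)) e = 0"
    and lead: "det (mat m m (\<lambda>(i, j). coeff (A $$ (i, j)) (c j))) \<noteq> 0"
  shows "\<exists>B. mp_equiv m A B \<and> column_monic c m B"
proof -
  define M where "M = mat m m (\<lambda>(i, j). coeff (A $$ (i, j)) (c j))"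
  have M: "M \<in> carrier_mat m m" unfolding M_def by simp
  define N where "N = inverse (det M) \<cdot>\<^sub>m adj_mat M"
  have adj: "adj_mat M \<in> carrier_mat m m" using adj_mat[OF M] by simp
  then have N: "N \<in> carrier_mat m m" unfolding N_def by simp
  have "N * M = inverse (det M) \<cdot>\<^sub>m (det M \<cdot>\<^sub>m 1\<^sub>m m)"
    unfolding N_def mult_smult_assoc_mat[OF adj M] adj_mat(3)[OF M] ..
  also have "\<dots> = 1\<^sub>m m" using lead unfolding M_def[symmetric] by (intro eq_matI) auto
  finally have NM: "N * M = 1\<^sub>m m" .
  define U where "U = map_mat (\<lambda>x. [:x:]) N"
  have U: "U \<in> carrier_mat m m" using N unfolding U_def by simp
  have "det U = [:det N:]"
  proof -
    interpret comm_ring_hom "\<lambda>x::'a. [:x:]" by unfold_locales (auto simp: one_pCons)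
    show ?thesis unfolding U_def by simp
  qed
  moreover have "det N \<noteq> 0" using NM det_mult[OF N M] by auto
  ultimately have uU: "unimodular_mp U" by (intro unimodular_mp_if_det[OF U])
  have c: "coeff ((U * A) $$ (i, j)) e = (\<Sum>k<m. N $$ (i, k) * coeff (A $$ (k, j)) e)"
    if "i < m" "j < m" for i j e
    using that U A N by (auto simp: scalar_prod_def U_def coeff_sum atLeast0LessThan)
  have "column_monic c m (U * A)"
    unfolding column_monic_def
  proof (intro conjI allI impI)
    show "U * A \<in> carrier_mat m m" using U A by simp
    fix i j e assume ij: "i < m" "j < m" "c j \<le> e"
    show "coeff ((U * A) $$ (i, j)) e = (if i = j \<and> e = c j then 1 else 0)"
    proof (cases "e = c j")
      case True
      have "(N * M) $$ (i, j) = (\<Sum>k<m. N $$ (i, k) * coeff (A $$ (k, j)) (c j))"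
        using ij N by (auto simp: scalar_prod_def M_def atLeast0LessThan)
      then show ?thesis unfolding c[OF ij(1,2)] NM using True ij by simp
    next
      case False
      then show ?thesis unfolding c[OF ij(1,2)] using ij deg by (auto intro!: sum.neutral)
    qed
  qed
  then show ?thesis using mp_equiv_left[OF A U uU] by blast
qed

lemma mp_equiv_addcol:
  assumes "A \<in> carrier_mat n n" "k < n" "l < n" "k \<noteq> l"
  shows "mp_equiv n A (addcol a k l A)"
proof -
  have "addcol a k l A = transpose_mat (addrow a k l (transpose_mat A))"
    using assms by (intro eq_matI) auto
  then show ?thesis
    using mp_equiv_via_transpose[OF assms(1) mp_equiv_addrow[of "transpose_mat A" n k l a]] assms by simp
qed

text \<open>One degree is moved from column \<open>j\<close> to column \<open>i\<close>. Adding \<open>\<lambda>\<close> times row \<open>i\<close> to row \<open>j\<close>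
raises column \<open>i\<close> to degree \<open>c i + 1\<close>, with its leading coefficient in row \<open>j\<close>. The entry of
degree \<open>c j\<close> in column \<open>j\<close> can then be cancelled with a multiple of column \<open>i\<close>, and the cancellation
leaves the coefficient \<open>- 1\<close> of degree \<open>c j - 1\<close> in row \<open>i\<close>. So the new leading coefficients
again form a nonsingular matrix.\<close>

lemma column_monic_transfer_degree:
  fixes A :: "'a::field poly mat"
  assumes A: "column_monic c m A" and ij: "i < m" "j < m" and cij: "c i + 2 \<le> c j"
  shows "\<exists>B. mp_equiv m A B \<and> column_monic (c(i := c i + 1, j := c j - 1)) m B"
proof -
  have ne: "i \<noteq> j" using cij by auto
  have Ac: "A \<in> carrier_mat m m" using A unfolding column_monic_def by simp
  have cA: "coeff (A $$ (r, l)) e = (if r = l \<and> e = c l then 1 else 0)"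
    if "r < m" "l < m" "c l \<le> e" for r l e
    using A that unfolding column_monic_def by blast
  \<comment> \<open>The row operation changes the leading coefficient of the entry (j, j) from 1 to 1 + \<alpha>.\<close>
  define \<alpha> where "\<alpha> = coeff (A $$ (i, j)) (c j - 1)"
  define n where "n = c j - c i - 1"
  define \<beta> where "\<beta> = monom (1 + \<alpha>) n"
  define A1 where "A1 = addrow [:0, 1:] j i A"
  define A2 where "A2 = addcol (- \<beta>) j i A1"
  have A1c: "A1 \<in> carrier_mat m m" using Ac unfolding A1_def by simp
  have A2c: "A2 \<in> carrier_mat m m" using A1c unfolding A2_def by (auto simp: mat_addcol_def)
  have eq: "mp_equiv m A A2"
    unfolding A1_def A2_def
    by (rule mp_equiv_trans[OF mp_equiv_addrow mp_equiv_addcol]) (use Ac ij ne in auto)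
  have A1: "A1 $$ (r, l) = (if r = j then pCons 0 (A $$ (i, l)) + A $$ (j, l) else A $$ (r, l))"
    if "r < m" "l < m" for r l
    using that Ac ij by (auto simp: A1_def)
  have A2: "A2 $$ (r, l) = (if l = j then A1 $$ (r, j) - \<beta> * A1 $$ (r, i) else A1 $$ (r, l))"
    if "r < m" "l < m" for r l
    using that A1c ij by (auto simp: A2_def)
  let ?c = "c(i := c i + 1, j := c j - 1)"
  have cb: "coeff (\<beta> * p) e = (1 + \<alpha>) * (if n \<le> e then coeff p (e - n) else 0)" for p e
    unfolding \<beta>_def by (simp add: coeff_monom_mult)
  have cp: "coeff (pCons 0 p) e = (if e = 0 then 0 else coeff p (e - 1))" for p :: "'a poly" and e
    by (cases e) auto
  have deg: "coeff (A2 $$ (r, l)) e = 0" if r: "r < m" "l < m" "?c l < e" for r l e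
  proof (cases "l = j")
    case True
    then have e: "c j \<le> e" using r(3) by simp
    show ?thesis
    proof (cases "r = j")
      case rj: True
      have n: "n \<le> e" "c i + 1 \<le> e - n" "c i \<le> e - n - 1" "e - n - 1 = c i \<longleftrightarrow> e = c j" "e - n \<noteq> 0"
        using e cij unfolding n_def by auto
      have "coeff (A $$ (i, j)) (e - 1) = (if e = c j then \<alpha> else 0)"
        using cA[of i j "e - 1"] ij ne e by (cases "e = c j") (auto simp: \<alpha>_def)
      then show ?thesis
        using r True rj ij ne n e cij cA[of j j e] cA[of i i "e - n - 1"] cA[of j i "e - n"]
        by (auto simp: A2 A1 cb cp)
    next
      case rj: False
      have n: "n \<le> e" "c i < e - n" using e cij unfolding n_def by auto
      show ?thesis
        using r True rj ij n e cA[of r j e] cA[of r i "e - n"] by (auto simp: A2 A1 cb)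
    qed
  next
    case lj: False
    show ?thesis
      using r lj ij ne cA[of r l e] cA[of i l "e - 1"] cA[of j l e]
      by (cases "l = i") (auto simp: A2 A1 cp)
  qed
  define M where "M = mat m m (\<lambda>(i, j). coeff (A2 $$ (i, j)) (?c j))"
  have M: "M \<in> carrier_mat m m" unfolding M_def by simp
  have M_col: "M $$ (r, l) = (if r = l then 1 else 0)" if "r < m" "l < m" "r \<noteq> j" "l \<noteq> i" "l \<noteq> j" for r l
    using that cA[of r l "c l"] by (auto simp: M_def A2 A1)
  have M_coli: "M $$ (r, i) = (if r = j then 1 else 0)" if "r < m" for r
    using that ij ne cA[of r i "c i + 1"] cA[of i i "c i"] by (auto simp: M_def A2 A1 cp)
  have M_ij: "M $$ (i, j) = - 1"
  proof -
    have "n \<le> c j - 1" "c j - 1 - n = c i" using cij unfolding n_def by auto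
    then show ?thesis using ij ne cA[of i i "c i"] by (simp add: M_def A2 A1 cb \<alpha>_def)
  qed
  have "det M \<noteq> 0"
  proof
    assume "det M = 0"
    then obtain v where v: "v \<in> carrier_vec m" "v \<noteq> 0\<^sub>v m" "M *\<^sub>v v = 0\<^sub>v m"
      using det_0_iff_vec_prod_zero[OF M] by blast
    have row: "M $$ (r, l0) * v $ l0 = 0"
      if "r < m" "l0 < m" "\<And>l. l < m \<Longrightarrow> l \<noteq> l0 \<Longrightarrow> M $$ (r, l) * v $ l = 0" for r l0
    proof -
      have "(\<Sum>l<m. M $$ (r, l) * v $ l) = (M *\<^sub>v v) $ r"
        using that(1) M v(1) by (auto simp: scalar_prod_def atLeast0LessThan)
      also have "\<dots> = 0" using v(3) that(1) by simp
      finally have "(\<Sum>l<m. M $$ (r, l) * v $ l) = 0" .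
      moreover have "(\<Sum>l<m. M $$ (r, l) * v $ l) = M $$ (r, l0) * v $ l0"
      proof -
        have "(\<Sum>l\<in>{..<m} - {l0}. M $$ (r, l) * v $ l) = 0"
          by (rule sum.neutral) (use that(3) in auto)
        then show ?thesis using that(2) sum.remove[of "{..<m}" l0 "\<lambda>l. M $$ (r, l) * v $ l"] by simp
      qed
      ultimately show ?thesis by simp
    qed
    have vj: "v $ j = 0"
    proof -
      have "M $$ (i, j) * v $ j = 0"
      proof (rule row[OF ij])
        fix l assume "l < m" "l \<noteq> j"
        then show "M $$ (i, l) * v $ l = 0"
          using M_col[of i l] M_coli[of i] ij ne by (cases "l = i") auto
      qed
      then show ?thesis unfolding M_ij by simp
    qed
    have vr: "v $ r = 0" if r: "r < m" "r \<noteq> i" for r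
    proof (cases "r = j")
      case False
      have "M $$ (r, r) * v $ r = 0"
      proof (rule row[OF r(1) r(1)])
        fix l assume "l < m" "l \<noteq> r"
        then show "M $$ (r, l) * v $ l = 0"
          using M_col[of r l] M_coli[of r] vj r False by (cases "l = i"; cases "l = j") auto
      qed
      then show ?thesis using M_col[of r r] r False by simp
    qed (use vj in simp)
    have "M $$ (j, i) * v $ i = 0" by (rule row[OF ij(2,1)]) (use vr in simp)
    then have "v $ i = 0" using M_coli[OF ij(2)] by simp
    with vr have "v = 0\<^sub>v m" using v(1) by (intro eq_vecI) auto
    with v(2) show False by simp
  qed
  from column_monic_normalize[OF A2c deg this[unfolded M_def]] show ?thesis
    using mp_equiv_trans[OF eq] by blast
qed

text \<open>Each transfer from a column of degree above \<open>d\<close> to one of degree below \<open>d\<close> lowers the sum of the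
squared column degrees.\<close>

lemma column_monic_equalize:
  fixes A :: "'a::field poly mat"
  assumes "column_monic c m A" "(\<Sum>j<m. c j) = m * d"
  shows "\<exists>B. mp_equiv m A B \<and> column_monic (\<lambda>_. d) m B"
  using assms
proof (induction "\<Sum>j<m. (c j)\<^sup>2" arbitrary: c A rule: less_induct)
  case less
  show ?case
  proof (cases "\<forall>j<m. c j = d")
    case True
    then have "column_monic (\<lambda>_. d) m A" using less.prems(1) unfolding column_monic_def by auto
    moreover have "mp_equiv m A A" using less.prems(1) by (intro mp_equiv_refl) (simp add: column_monic_def)
    ultimately show ?thesis by blast
  next
    case False
    then obtain l where l: "l < m" "c l \<noteq> d" by blast
    have "\<exists>i<m. c i < d"
    proof (rule ccontr)
      assume "\<not> ?thesis"
      then have *: "\<And>i. i < m \<Longrightarrow> d \<le> c i" by force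
      then have "(\<Sum>j<m. d) < (\<Sum>j<m. c j)"
        using l by (intro sum_strict_mono_ex1) (auto intro!: bexI[of _ l] simp: le_neq_implies_less)
      then show False using less.prems(2) by simp
    qed
    moreover have "\<exists>j<m. d < c j"
    proof (rule ccontr)
      assume "\<not> ?thesis"
      then have *: "\<And>i. i < m \<Longrightarrow> c i \<le> d" by force
      then have "(\<Sum>j<m. c j) < (\<Sum>j<m. d)"
        using l by (intro sum_strict_mono_ex1) (auto intro!: bexI[of _ l] simp: le_neq_implies_less)
      then show False using less.prems(2) by simp
    qed
    ultimately obtain i j where ij: "i < m" "c i < d" "j < m" "d < c j" by blast
    let ?c = "c(i := c i + 1, j := c j - 1)"
    have ne: "i \<noteq> j" using ij by auto
    from column_monic_transfer_degree[OF less.prems(1) ij(1,3)] ij obtain B where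
      B: "mp_equiv m A B" "column_monic ?c m B" by auto
    have split: "(\<Sum>l<m. f l) = f i + (f j + (\<Sum>l\<in>{..<m} - {i} - {j}. f l))" for f :: "nat \<Rightarrow> nat"
      using ij ne by (simp add: sum.remove[of _ i] sum.remove[of _ j])
    have same: "(\<Sum>l\<in>{..<m} - {i} - {j}. f (?c l)) = (\<Sum>l\<in>{..<m} - {i} - {j}. f (c l))" for f :: "nat \<Rightarrow> nat"
      by (rule sum.cong) auto
    have "(\<Sum>l<m. ?c l) = (\<Sum>l<m. c l)"
      unfolding split[of ?c] split[of c] same[of "\<lambda>x. x"] using ij ne by simp
    moreover have "(\<Sum>l<m. (?c l)\<^sup>2) < (\<Sum>l<m. (c l)\<^sup>2)"
    proof -
      obtain x y where xy: "c i = x" "c j = Suc y" "x < y" using ij by (cases "c j") auto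
      then show ?thesis
        unfolding split[of "\<lambda>l. (?c l)\<^sup>2"] split[of "\<lambda>l. (c l)\<^sup>2"] same[of "\<lambda>x. x\<^sup>2"]
        using ne by (simp add: power2_eq_square)
    qed
    ultimately obtain C where "mp_equiv m B C" "column_monic (\<lambda>_. d) m C"
      using less.hyps[OF _ B(2)] less.prems(2) by metis
    then show ?thesis using mp_equiv_trans[OF B(1)] by blast
  qed
qed

theorem monic_block_exists:
  fixes A :: "'a::field poly mat"
  assumes A: "A \<in> carrier_mat m m" "det A \<noteq> 0" and deg: "degree (det A) = m * d"
  shows "\<exists>B. mp_equiv m A B \<and> column_monic (\<lambda>_. d) m B"
proof -
  from smith_form_exists[OF A] obtain ss where ss: "length ss = m" "\<forall>s\<in>set ss. lead_coeff s = 1"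
    "mp_equiv m A (mat_diag m (\<lambda>i. ss ! i))" by blast
  let ?S = "mat_diag m (\<lambda>i. ss ! i)"
  have "column_monic (\<lambda>i. degree (ss ! i)) m ?S"
    using ss(1,2) by (auto simp: column_monic_def mat_diag_def coeff_eq_0)
  moreover have "(\<Sum>j<m. degree (ss ! j)) = m * d"
  proof -
    have "degree (det ?S) = m * d" using mp_equiv_degree_det[OF ss(3)] deg by simp
    moreover have "degree (\<Prod>i<m. ss ! i) = (\<Sum>j<m. degree (ss ! j))"
      using ss(1,2) by (intro degree_prod_eq_sum_degree) (force simp: in_set_conv_nth)
    ultimately show ?thesis unfolding det_mat_diag by simp
  qed
  ultimately show ?thesis using column_monic_equalize mp_equiv_trans[OF ss(3)] by blast
qed

section \<open>Block triangular forms with monic diagonal blocks\<close>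

text \<open>Division with remainder by a monic matrix polynomial: \<open>- Y\<close> is the quotient, and its
coefficients are found from the top as in the division of polynomials.\<close>

lemma monic_block_division:
  fixes D X :: "'a::field poly mat"
  assumes D: "column_monic (\<lambda>_. d) m D" and X: "X \<in> carrier_mat m q"
  shows "\<exists>Y\<in>carrier_mat m q. \<forall>i<m. \<forall>j<q. \<forall>e\<ge>d. coeff ((X + D * Y) $$ (i, j)) e = 0"
proof -
  have Dc: "D \<in> carrier_mat m m" using D unfolding column_monic_def by simp
  have cD: "coeff (D $$ (i, k)) e = (if i = k \<and> e = d then 1 else 0)" if "i < m" "k < m" "d \<le> e" for i k e
    using D that unfolding column_monic_def by blast
  have "\<exists>Y\<in>carrier_mat m q. \<forall>i<m. \<forall>j<q. \<forall>e\<ge>d. coeff ((X + D * Y) $$ (i, j)) e = 0"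
    if "X \<in> carrier_mat m q" "\<And>i j e. i < m \<Longrightarrow> j < q \<Longrightarrow> d + N \<le> e \<Longrightarrow> coeff (X $$ (i, j)) e = 0" for N X
    using that
  proof (induction N arbitrary: X)
    case 0
    have "X + D * 0\<^sub>m m q = X" using 0(1) Dc by (intro eq_matI) auto
    then show ?case using 0 by (intro bexI[of _ "0\<^sub>m m q"]) auto
  next
    case (Suc N)
    define Z where "Z = mat m q (\<lambda>(i, j). monom (- coeff (X $$ (i, j)) (d + N)) N)"
    have Z: "Z \<in> carrier_mat m q" unfolding Z_def by simp
    have ent: "(X + D * Z) $$ (i, j) = X $$ (i, j) + (\<Sum>k<m. D $$ (i, k) * Z $$ (k, j))"
      if "i < m" "j < q" for i j
      using that Suc.prems(1) Dc Z by (auto simp: scalar_prod_def atLeast0LessThan)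
    have cf: "coeff ((X + D * Z) $$ (i, j)) e = 0" if ij: "i < m" "j < q" "d + N \<le> e" for i j e
    proof -
      have "coeff (\<Sum>k<m. D $$ (i, k) * Z $$ (k, j)) e =
          (\<Sum>k<m. - coeff (X $$ (k, j)) (d + N) * coeff (D $$ (i, k)) (e - N))"
        unfolding coeff_sum using ij
        by (intro sum.cong) (auto simp: Z_def mult.commute[of _ "monom _ _"] coeff_monom_mult)
      also have "\<dots> = (\<Sum>k<m. if i = k then (if e = d + N then - coeff (X $$ (k, j)) (d + N) else 0) else 0)"
        using ij cD by (intro sum.cong) auto
      also have "\<dots> = (if e = d + N then - coeff (X $$ (i, j)) (d + N) else 0)"
        using ij by simp
      finally show ?thesis using ij Suc.prems(2)[OF ij(1,2), of e] by (auto simp: ent)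
    qed
    have XZ: "X + D * Z \<in> carrier_mat m q" using Suc.prems(1) Dc Z by simp
    from Suc.IH[OF XZ cf] obtain Y where Y: "Y \<in> carrier_mat m q"
      "\<forall>i<m. \<forall>j<q. \<forall>e\<ge>d. coeff ((X + D * Z + D * Y) $$ (i, j)) e = 0" by blast
    have "X + D * Z + D * Y = X + D * (Z + Y)"
      using Suc.prems(1) Dc Z Y(1) by (simp add: mult_add_distrib_mat[OF Dc Z Y(1)] assoc_add_mat[of _ m q])
    with Y Z show ?case by (intro bexI[of _ "Z + Y"]) auto
  qed
  note division = this
  let ?S = "insert 0 ((\<lambda>p. Suc (degree (X $$ p))) ` ({..<m} \<times> {..<q}))"
  have "coeff (X $$ (i, j)) e = 0" if ij: "i < m" "j < q" "d + Max ?S \<le> e" for i j e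
  proof -
    have "Suc (degree (X $$ (i, j))) \<le> Max ?S" by (rule Max_ge) (use ij in force)+
    then have "degree (X $$ (i, j)) < e" using ij(3) by linarith
    then show ?thesis by (rule coeff_eq_0)
  qed
  then show ?thesis by (rule division[OF X])
qed

abbreviation coeffs_below :: "nat \<Rightarrow> 'a::zero poly \<Rightarrow> bool" where
  "coeffs_below d p \<equiv> \<forall>e\<ge>d. coeff p e = 0"

text \<open>Adding multiples of the first block column to the others adds \<open>D Y\<close> to the blocks to the right of
\<open>D\<close>. The remaining rows are reduced first, because their reduction changes these blocks as well.\<close>

lemma btri_reduce_off_diagonal:
  fixes M :: "'a::field poly mat"
  assumes "btri Ds M" "\<forall>D\<in>set Ds. column_monic (\<lambda>_. d) (dim_row D) D"
  shows "\<exists>N. mp_equiv (total_dim Ds) M N \<and> block_tri (coeffs_below d) Ds N"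
  using assms
proof (induction Ds arbitrary: M)
  case Nil
  then show ?case using mp_equiv_refl[of M 0] by auto
next
  case (Cons D Ds)
  let ?p = "total_dim Ds"
  from Cons.prems(1) obtain X A m where 1: "D \<in> carrier_mat m m" "btri Ds A"
    "A \<in> carrier_mat ?p ?p" "X \<in> carrier_mat m ?p" "M = four_block_mat D X (0\<^sub>m ?p m) A"
    by (rule btri_ConsE)
  have D: "column_monic (\<lambda>_. d) m D" using Cons.prems(2) 1(1) by auto
  from Cons.IH[OF 1(2)] Cons.prems(2) obtain B where B: "mp_equiv ?p A B"
    "block_tri (coeffs_below d) Ds B" by auto
  note Bc = block_tri_carrier[OF B(2)]
  obtain X' where X': "X' \<in> carrier_mat m ?p"
    "mp_equiv (m + ?p) M (four_block_mat D X' (0\<^sub>m ?p m) B)"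
    using mp_equiv_four_block[OF mp_equiv_refl[OF 1(1)] B(1) 1(4)] unfolding 1(5) by blast
  let ?M' = "four_block_mat D X' (0\<^sub>m ?p m) B"
  from monic_block_division[OF D X'(1)] obtain Y where Y: "Y \<in> carrier_mat m ?p"
    "\<forall>i<m. \<forall>j<?p. coeffs_below d ((X' + D * Y) $$ (i, j))" by blast
  define V where "V = four_block_mat (1\<^sub>m m) Y (0\<^sub>m ?p m) (1\<^sub>m ?p)"
  have V: "V \<in> carrier_mat (m + ?p) (m + ?p)" unfolding V_def by simp
  have uV: "unimodular_mp V"
    unfolding V_def by (intro unimodular_mp_four_block_upper) (use Y in auto)
  have "?M' * V = four_block_mat (D * 1\<^sub>m m + X' * 0\<^sub>m ?p m) (D * Y + X' * 1\<^sub>m ?p)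
      (0\<^sub>m ?p m * 1\<^sub>m m + B * 0\<^sub>m ?p m) (0\<^sub>m ?p m * Y + B * 1\<^sub>m ?p)"
    unfolding V_def
    by (rule mult_four_block_mat) (rule 1 X' Bc Y one_carrier_mat zero_carrier_mat)+
  also have "D * 1\<^sub>m m + X' * 0\<^sub>m ?p m = D" using 1(1) X'(1) by simp
  also have "D * Y + X' * 1\<^sub>m ?p = X' + D * Y"
    using 1(1) X'(1) Y(1) comm_add_mat[of "D * Y" m ?p X'] by simp
  also have "0\<^sub>m ?p m * 1\<^sub>m m + B * 0\<^sub>m ?p m = 0\<^sub>m ?p m" using Bc by simp
  also have "0\<^sub>m ?p m * Y + B * 1\<^sub>m ?p = B" using Bc Y(1) by simp
  finally have MV: "?M' * V = four_block_mat D (X' + D * Y) (0\<^sub>m ?p m) B" .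
  have "?M' \<in> carrier_mat (m + ?p) (m + ?p)" using 1(1) Bc by simp
  from mp_equiv_trans[OF X'(2) mp_equiv_right[OF this V uV]]
  have "mp_equiv (m + ?p) M (four_block_mat D (X' + D * Y) (0\<^sub>m ?p m) B)" unfolding MV .
  moreover have "block_tri (coeffs_below d) (D # Ds) (four_block_mat D (X' + D * Y) (0\<^sub>m ?p m) B)"
    by (rule block_tri_ConsI[OF 1(1) B(2)]) (use X'(1) 1(1) Y in auto)
  ultimately show ?case using 1(1) by auto
qed

text \<open>The diagonal entries of a triangular form have mean degree \<open>d\<close>. For a group of \<open>m\<close> entries whose
deviations from \<open>d\<close> cancel, the diagonal block has a determinant of degree \<open>m d\<close>, as a monic block
of degree \<open>d\<close> must have.\<close>

theorem strictly_regular_block_form: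
  fixes P :: "'a::field poly mat"
  assumes P: "P \<in> carrier_mat n n" and ne: "det P \<noteq> 0" and deg: "degree (det P) = n * d"
    and k: "1 \<le> k"
    and small: "\<And>b. b dvd det P \<Longrightarrow> 0 < degree b \<Longrightarrow> \<exists>p. p dvd b \<and> 0 < degree p \<and> degree p \<le> k"
  shows "\<exists>Ds Q. mp_equiv n P Q \<and> block_tri (coeffs_below d) Ds Q \<and>
    (\<forall>D\<in>set Ds. 1 \<le> dim_row D \<and> dim_row D \<le> k \<and> column_monic (\<lambda>_. d) (dim_row D) D)"
proof -
  from smith_form_exists[OF P ne] obtain ss where "smith_form n P ss"
    unfolding smith_form_def by blast
  from triangularizable_to_balanced[OF triangularizable_to_smith[OF this] ne small]
  obtain us where us: "triangularizable_to n P us"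
    "\<forall>x\<in>set us. \<forall>y\<in>set us. degree x \<le> degree y + k" by blast
  define f where "f t = int (degree t) - int d" for t :: "'a poly"
  obtain c where c: "c \<noteq> 0" "prod_list us = smult c (det P)"
    using triangularizable_to_det[OF us(1)] .
  have deg_prod: "degree (prod_list ts) = (\<Sum>t\<leftarrow>ts. degree t)" if "prod_list ts \<noteq> 0" for ts :: "'a poly list"
    using that by (induction ts) (auto simp: degree_mult_eq)
  have sumf: "(\<Sum>t\<leftarrow>ts. f t) = int (\<Sum>t\<leftarrow>ts. degree t) - int (length ts * d)" for ts
    unfolding f_def by (induction ts) (auto simp: algebra_simps)
  have "(\<Sum>t\<leftarrow>us. f t) = 0"
    unfolding sumf using deg_prod[of us] c ne deg triangularizable_to_length[OF us(1)] by simp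
  moreover have "\<forall>x\<in>set us. \<forall>y\<in>set us. f x \<le> f y + int k"
    using us(2) unfolding f_def by force
  ultimately obtain yss where yss: "mset (concat yss) = mset us"
    "\<forall>ys\<in>set yss. ys \<noteq> [] \<and> length ys \<le> k \<and> (\<Sum>y\<leftarrow>ys. f y) = 0"
    using short_zero_sum_partition[of f us k] k by blast
  have "triangularizable_to n P (concat yss)"
    using triangularizable_to_permute[OF us(1) ne yss(1)[symmetric]] .
  then obtain M where M: "btri (map single (concat yss)) M" "mp_equiv n P M"
    unfolding triangularizable_to_def by blast
  from M(1) have "btri (concat (map (map single) yss)) M" by (simp add: map_concat)
  from btri_concat[OF this] obtain Fs where Fs: "list_all2 btri (map (map single) yss) Fs" "btri Fs M"
    by blast
  have nz: "prod_list ys \<noteq> 0" if "ys \<in> set yss" for ys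
  proof -
    have "prod_list us \<noteq> 0" using c ne by simp
    then have "0 \<notin> set (concat yss)" unfolding prod_list_zero_iff using yss(1)
      by (metis set_mset_mset)
    then show ?thesis unfolding prod_list_zero_iff using that by auto
  qed
  have "\<exists>E. mp_equiv (dim_row F) F E \<and> column_monic (\<lambda>_. d) (dim_row F) E \<and>
      1 \<le> dim_row F \<and> dim_row F \<le> k" if "F \<in> set Fs" for F
  proof -
    from that Fs(1) obtain ys where ys: "ys \<in> set yss" "btri (map single ys) F"
      by (force simp: list_all2_conv_all_nth in_set_conv_nth)
    have Fc: "F \<in> carrier_mat (length ys) (length ys)"
      using block_tri_carrier[OF ys(2)] total_dim_single[of ys] by simp
    have z: "(\<Sum>y\<leftarrow>ys. f y) = 0" "ys \<noteq> []" "length ys \<le> k" using yss(2) ys(1) by auto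
    have "degree (det F) = length ys * d"
      unfolding det_btri_single[OF ys(2)] deg_prod[OF nz[OF ys(1)]] using z(1) unfolding sumf by linarith
    moreover have "det F \<noteq> 0" unfolding det_btri_single[OF ys(2)] using nz[OF ys(1)] .
    ultimately obtain E where "mp_equiv (length ys) F E" "column_monic (\<lambda>_. d) (length ys) E"
      using monic_block_exists[OF Fc] by blast
    moreover have "1 \<le> length ys" using z(2) by (simp add: Suc_leI)
    ultimately show ?thesis using Fc z(3) by auto
  qed
  then obtain E where E: "\<And>F. F \<in> set Fs \<Longrightarrow> mp_equiv (dim_row F) F (E F) \<and>
      column_monic (\<lambda>_. d) (dim_row F) (E F) \<and> 1 \<le> dim_row F \<and> dim_row F \<le> k"
    by metis
  have dimE: "dim_row (E F) = dim_row F" if "F \<in> set Fs" for F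
    using E[OF that] mp_equiv_carrier(2) by blast
  have "list_all2 (\<lambda>D E. mp_equiv (dim_row D) D E) Fs (map E Fs)"
    using E by (auto simp: list_all2_conv_all_nth)
  from btri_equiv[OF this Fs(2)] obtain N where N: "btri (map E Fs) N" "mp_equiv (total_dim Fs) M N"
    by blast
  have n: "total_dim Fs = n" using block_tri_dim_row[OF Fs(2)] mp_equiv_carrier(2)[OF M(2)] by simp
  have mon: "\<forall>D\<in>set (map E Fs). 1 \<le> dim_row D \<and> dim_row D \<le> k \<and> column_monic (\<lambda>_. d) (dim_row D) D"
    using E dimE by auto
  then obtain Q where Q: "mp_equiv (total_dim (map E Fs)) N Q" "block_tri (coeffs_below d) (map E Fs) Q"
    using btri_reduce_off_diagonal[OF N(1)] by blast
  have "total_dim (map E Fs) = n" using block_tri_dim_row[OF N(1)] N(2) n mp_equiv_carrier(2)[OF N(2)] by simp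
  then have "mp_equiv n P Q" using Q(1) N(2) n mp_equiv_trans M(2) by metis
  with Q(2) mon show ?thesis by blast
qed

lemma block_tri_monic_coeff:
  assumes "block_tri (coeffs_below d) Ds Q" "\<forall>D\<in>set Ds. column_monic (\<lambda>_. d) (dim_row D) D"
    and "i < total_dim Ds" "j < total_dim Ds" "d \<le> e"
  shows "coeff (Q $$ (i, j)) e = (if i = j \<and> e = d then 1 else 0)"
  using assms(1-4)
proof (induction Ds arbitrary: Q i j)
  case (Cons D Ds)
  from Cons.prems(1) obtain X A m where 1: "D \<in> carrier_mat m m" "block_tri (coeffs_below d) Ds A"
    "A \<in> carrier_mat (total_dim Ds) (total_dim Ds)" "X \<in> carrier_mat m (total_dim Ds)"
    "\<forall>i<m. \<forall>j<total_dim Ds. coeffs_below d (X $$ (i, j))"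
    "Q = four_block_mat D X (0\<^sub>m (total_dim Ds) m) A" by (rule block_tri_ConsE)
  have D: "column_monic (\<lambda>_. d) m D" using Cons.prems(2) 1(1) by auto
  have "i < m + total_dim Ds" "j < m + total_dim Ds" using Cons.prems(3,4) 1(1) by auto
  then show ?case
    unfolding 1(6) using 1(1,3,4,5) D Cons.IH[OF 1(2), of "i - m" "j - m"] Cons.prems(2) assms(5)
    unfolding column_monic_def by auto
qed simp

lemma sum_list_take_Suc_le:
  assumes "b < length bs" shows "sum_list (take b bs) + bs ! b \<le> sum_list (bs :: nat list)"
proof -
  have "sum_list (take b bs) + bs ! b = sum_list (take (Suc b) bs)"
    using assms by (simp add: take_Suc_conv_app_nth)
  also have "\<dots> \<le> sum_list (take (Suc b) bs) + sum_list (drop (Suc b) bs)" by simp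
  also have "\<dots> = sum_list bs" by (metis append_take_drop_id sum_list_append)
  finally show ?thesis .
qed

lemma block_tri_block_entries:
  assumes "block_tri \<phi> Ds Q" "a < length Ds" "b < length Ds" "a \<noteq> b"
    "i < dim_row (Ds ! a)" "j < dim_row (Ds ! b)"
  shows "if a < b then \<phi> (Q $$ (total_dim (take a Ds) + i, total_dim (take b Ds) + j))
    else Q $$ (total_dim (take a Ds) + i, total_dim (take b Ds) + j) = 0"
  using assms
proof (induction Ds arbitrary: Q a b)
  case (Cons D Ds)
  from Cons.prems(1) obtain X A m where 1: "D \<in> carrier_mat m m" "block_tri \<phi> Ds A"
    "A \<in> carrier_mat (total_dim Ds) (total_dim Ds)" "X \<in> carrier_mat m (total_dim Ds)"
    "\<forall>i<m. \<forall>j<total_dim Ds. \<phi> (X $$ (i, j))"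
    "Q = four_block_mat D X (0\<^sub>m (total_dim Ds) m) A" by (rule block_tri_ConsE)
  have bound: "total_dim (take c Ds) + l < total_dim Ds" if "c < length Ds" "l < dim_row (Ds ! c)" for c l
    using sum_list_take_Suc_le[of c "map dim_row Ds"] that by (simp add: take_map)
  show ?case
  proof (cases a)
    case a: 0
    then obtain b' where b: "b = Suc b'" using Cons.prems(4) by (cases b) auto
    have "\<phi> (X $$ (i, total_dim (take b' Ds) + j))"
      using 1(1,5) Cons.prems bound[of b' j] unfolding a b by simp
    then show ?thesis unfolding 1(6) using 1(1,3,4) Cons.prems bound[of b' j] unfolding a b by simp
  next
    case a: (Suc a')
    show ?thesis
    proof (cases b)
      case b: 0
      show ?thesis unfolding 1(6) using 1(1,3,4) Cons.prems bound[of a' i] unfolding a b by simp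
    next
      case b: (Suc b')
      show ?thesis unfolding 1(6) using 1(1,3,4) Cons.prems bound[of a' i] bound[of b' j]
        Cons.IH[OF 1(2), of a' b'] unfolding a b by auto
    qed
  qed
qed simp

section \<open>Homogeneous substitution\<close>

text \<open>With \<open>a\<close> regarded as a polynomial of grade \<open>m\<close>, this is \<open>y\<^sup>m a(x / y)\<close>. Reversal, shift of
the variable and every Moebius transformation are instances with linear \<open>x\<close> and \<open>y\<close>.\<close>

definition hom_subst :: "'a::field poly \<Rightarrow> 'a poly \<Rightarrow> nat \<Rightarrow> 'a poly \<Rightarrow> 'a poly" where
  "hom_subst x y m a = (\<Sum>i\<le>m. smult (coeff a i) (x ^ i * y ^ (m - i)))"

lemma hom_subst_0 [simp]: "hom_subst x y m 0 = 0"
  by (simp add: hom_subst_def)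

lemma hom_subst_add: "hom_subst x y m (a + b) = hom_subst x y m a + hom_subst x y m b"
  by (simp add: hom_subst_def smult_add_left sum.distrib)

lemma hom_subst_smult: "hom_subst x y m (smult c a) = smult c (hom_subst x y m a)"
proof -
  have "smult c (\<Sum>i\<in>I. f i) = (\<Sum>i\<in>I. smult c (f i))" for I :: "nat set" and f :: "nat \<Rightarrow> 'a poly"
    using sum_distrib_left[of "[:c:]" f I] by simp
  then show ?thesis by (simp add: hom_subst_def)
qed

lemma hom_subst_uminus: "hom_subst x y m (- a) = - hom_subst x y m a"
  using hom_subst_smult[of x y m "- 1" a] by simp

lemma hom_subst_sum: "hom_subst x y m (\<Sum>i\<in>I. f i) = (\<Sum>i\<in>I. hom_subst x y m (f i))"
  by (induction I rule: infinite_finite_induct) (auto simp: hom_subst_add)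

lemma hom_subst_monom:
  assumes "i \<le> m" shows "hom_subst x y m (monom c i) = smult c (x ^ i * y ^ (m - i))"
proof -
  have "hom_subst x y m (monom c i) = (\<Sum>j\<le>m. if i = j then smult c (x ^ j * y ^ (m - j)) else 0)"
    unfolding hom_subst_def by (rule sum.cong) auto
  then show ?thesis using assms by simp
qed

lemma hom_subst_const: "hom_subst x y m [:c:] = smult c (y ^ m)"
  using hom_subst_monom[of 0 m x y c] by (simp add: monom_0)

lemma hom_subst_1: "hom_subst x y m 1 = y ^ m"
  using hom_subst_const[of x y m 1] by (simp add: one_pCons)

lemma hom_subst_linear: "hom_subst x y 1 [:c, d:] = smult c y + smult d x"
  by (simp add: hom_subst_def)

lemma hom_subst_mult:
  assumes "degree a \<le> m" "degree b \<le> l"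
  shows "hom_subst x y (m + l) (a * b) = hom_subst x y m a * hom_subst x y l b"
proof -
  have mon: "hom_subst x y (m + l) (monom c i * monom e j) =
      hom_subst x y m (monom c i) * hom_subst x y l (monom e j)" if "i \<le> m" "j \<le> l" for c e i j
  proof -
    have e: "m + l - (i + j) = (m - i) + (l - j)" using that by simp
    have "hom_subst x y (m + l) (monom c i * monom e j) =
        smult (c * e) (x ^ (i + j) * y ^ ((m - i) + (l - j)))"
      unfolding mult_monom using that e by (simp add: hom_subst_monom)
    also have "\<dots> = smult c (x ^ i * y ^ (m - i)) * smult e (x ^ j * y ^ (l - j))"
      by (simp only: power_add mult_smult_left mult_smult_right smult_smult ac_simps)
    finally show ?thesis using that by (simp only: hom_subst_monom)
  qed
  have a: "a = (\<Sum>i\<le>m. monom (coeff a i) i)" and b: "b = (\<Sum>j\<le>l. monom (coeff b j) j)"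
    using poly_as_sum_of_monoms'[OF assms(1)] poly_as_sum_of_monoms'[OF assms(2)] by simp_all
  have "a * b = (\<Sum>i\<le>m. \<Sum>j\<le>l. monom (coeff a i) i * monom (coeff b j) j)"
    using arg_cong2[OF a b, of "(*)"] by (simp only: sum_product)
  then have "hom_subst x y (m + l) (a * b) =
      (\<Sum>i\<le>m. \<Sum>j\<le>l. hom_subst x y m (monom (coeff a i) i) * hom_subst x y l (monom (coeff b j) j))"
    by (simp add: hom_subst_sum mon)
  also have "\<dots> = hom_subst x y m (\<Sum>i\<le>m. monom (coeff a i) i) * hom_subst x y l (\<Sum>j\<le>l. monom (coeff b j) j)"
    by (simp only: hom_subst_sum sum_product)
  finally show ?thesis unfolding a[symmetric] b[symmetric] .
qed

lemma hom_subst_pad: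
  assumes "degree a \<le> m"
  shows "hom_subst x y (m + l) a = hom_subst x y m a * y ^ l"
  using hom_subst_mult[OF assms, of 1 l x y] by (simp add: hom_subst_1)

lemma hom_subst_prod:
  assumes "finite I" "\<And>i. i \<in> I \<Longrightarrow> degree (f i) \<le> m"
  shows "hom_subst x y (card I * m) (\<Prod>i\<in>I. f i) = (\<Prod>i\<in>I. hom_subst x y m (f i))"
  using assms
proof (induction I rule: finite_induct)
  case (insert j I)
  have "degree (\<Prod>i\<in>I. f i) \<le> (\<Sum>i\<in>I. degree (f i))"
    using degree_prod_sum_le[OF insert.hyps(1), of f] by (simp add: o_def)
  also have "\<dots> \<le> card I * m" using insert.prems sum_bounded_above[of I "\<lambda>i. degree (f i)" m] by simp
  finally have "degree (\<Prod>i\<in>I. f i) \<le> card I * m" .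
  from hom_subst_mult[OF _ this, of "f j" m x y] show ?case
    using insert by simp
qed (simp add: hom_subst_1)

lemma hom_subst_power:
  assumes "degree z \<le> 1"
  shows "hom_subst x y i (z ^ i) = (hom_subst x y 1 z) ^ i"
  using hom_subst_prod[of "{..<i}" "\<lambda>_. z" 1 x y] assms by simp

lemma degree_power_le_linear:
  assumes "degree (z :: 'a::field poly) \<le> 1" shows "degree (z ^ i) \<le> i"
  using degree_power_le[of z i] assms by (metis le_trans mult_le_mono1 mult_1)

lemma degree_hom_subst_le:
  assumes "degree x \<le> 1" "degree y \<le> 1"
  shows "degree (hom_subst x y m a) \<le> m"
proof -
  have "degree (smult (coeff a i) (x ^ i * y ^ (m - i))) \<le> m" if "i \<le> m" for i
  proof -
    have "degree (x ^ i * y ^ (m - i)) \<le> i + (m - i)"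
      using degree_mult_le[of "x ^ i" "y ^ (m - i)"] degree_power_le_linear[OF assms(1), of i]
        degree_power_le_linear[OF assms(2), of "m - i"] by linarith
    then show ?thesis using degree_smult_le[of "coeff a i" "x ^ i * y ^ (m - i)"] that by linarith
  qed
  then show ?thesis unfolding hom_subst_def by (intro degree_sum_le) auto
qed

text \<open>For linear \<open>z\<close> and \<open>w\<close> this is the composition of Moebius transformations.\<close>

lemma hom_subst_comp:
  assumes "degree z \<le> 1" "degree w \<le> 1"
  shows "hom_subst x y m (hom_subst z w m a) = hom_subst (hom_subst x y 1 z) (hom_subst x y 1 w) m a"
proof -
  have "hom_subst x y m (z ^ i * w ^ (m - i)) = (hom_subst x y 1 z) ^ i * (hom_subst x y 1 w) ^ (m - i)"
    if "i \<le> m" for i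
    using hom_subst_mult[OF degree_power_le_linear[OF assms(1), of i]
        degree_power_le_linear[OF assms(2), of "m - i"], of x y] that
    unfolding hom_subst_power[OF assms(1)] hom_subst_power[OF assms(2)] by simp
  then show ?thesis
    unfolding hom_subst_def[of z w] hom_subst_def[of "hom_subst x y 1 z"]
    by (simp add: hom_subst_sum hom_subst_smult)
qed

lemma hom_subst_id:
  assumes "degree a \<le> m" shows "hom_subst [:0, 1:] 1 m a = a"
proof -
  have "hom_subst [:0, 1:] 1 m a = (\<Sum>i\<le>m. monom (coeff a i) i)"
    unfolding hom_subst_def by (simp add: monom_altdef)
  then show ?thesis using poly_as_sum_of_monoms'[OF assms] by simp
qed

lemma poly_hom_subst: "poly (hom_subst x y m a) t = (\<Sum>i\<le>m. coeff a i * (poly x t ^ i * poly y t ^ (m - i)))"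
  by (simp add: hom_subst_def poly_sum)

lemma poly_hom_subst_zero:
  assumes "poly y t = 0" shows "poly (hom_subst x y m a) t = coeff a m * poly x t ^ m"
proof -
  have "(\<Sum>i\<le>m. coeff a i * (poly x t ^ i * poly y t ^ (m - i))) =
      (\<Sum>i\<le>m. if i = m then coeff a i * poly x t ^ i else 0)"
    using assms by (intro sum.cong) auto
  then show ?thesis unfolding poly_hom_subst by simp
qed

abbreviation hom_subst_mat :: "'a::field poly \<Rightarrow> 'a poly \<Rightarrow> nat \<Rightarrow> 'a poly mat \<Rightarrow> 'a poly mat" where
  "hom_subst_mat x y g \<equiv> map_mat (hom_subst x y g)"

definition entry_degrees_le :: "nat \<Rightarrow> 'a::zero poly mat \<Rightarrow> bool" where
  "entry_degrees_le g A \<longleftrightarrow> (\<forall>i<dim_row A. \<forall>j<dim_col A. degree (A $$ (i, j)) \<le> g)"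

lemma entry_degrees_leD:
  "entry_degrees_le g A \<Longrightarrow> A \<in> carrier_mat n m \<Longrightarrow> i < n \<Longrightarrow> j < m \<Longrightarrow> degree (A $$ (i, j)) \<le> g"
  unfolding entry_degrees_le_def by auto

lemma entry_degrees_le_exists: "\<exists>u. entry_degrees_le u A"
proof -
  have "finite ({..<dim_row A} \<times> {..<dim_col A})" by simp
  then obtain u where "\<forall>p\<in>{..<dim_row A} \<times> {..<dim_col A}. degree (A $$ p) \<le> u"
    by (meson finite_imageI finite_nat_set_iff_bounded_le imageI)
  then show ?thesis unfolding entry_degrees_le_def by auto
qed

lemma entry_degrees_le_hom_subst:
  "degree x \<le> 1 \<Longrightarrow> degree y \<le> 1 \<Longrightarrow> entry_degrees_le g (hom_subst_mat x y g A)"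
  unfolding entry_degrees_le_def by (auto simp: degree_hom_subst_le)

lemma hom_subst_mat_mult:
  assumes A: "A \<in> carrier_mat n m" and B: "B \<in> carrier_mat m l"
    and dA: "entry_degrees_le g A" and dB: "entry_degrees_le h B"
  shows "hom_subst_mat x y (g + h) (A * B) = hom_subst_mat x y g A * hom_subst_mat x y h B"
proof (rule eq_matI)
  fix i j assume "i < dim_row (hom_subst_mat x y g A * hom_subst_mat x y h B)"
    "j < dim_col (hom_subst_mat x y g A * hom_subst_mat x y h B)"
  then have ij: "i < n" "j < l" using A B by auto
  have "hom_subst x y (g + h) (\<Sum>k = 0..<m. A $$ (i, k) * B $$ (k, j)) =
      (\<Sum>k = 0..<m. hom_subst x y g (A $$ (i, k)) * hom_subst x y h (B $$ (k, j)))"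
    unfolding hom_subst_sum
    using ij entry_degrees_leD[OF dA A] entry_degrees_leD[OF dB B]
    by (intro sum.cong hom_subst_mult) auto
  then show "hom_subst_mat x y (g + h) (A * B) $$ (i, j) =
      (hom_subst_mat x y g A * hom_subst_mat x y h B) $$ (i, j)"
    using ij A B by (auto simp: scalar_prod_def)
qed (use A B in auto)

lemma entry_degrees_le_mult:
  assumes A: "A \<in> carrier_mat n m" and B: "B \<in> carrier_mat m l"
    and dA: "entry_degrees_le g A" and dB: "entry_degrees_le h B"
  shows "entry_degrees_le (g + h) (A * B)"
proof -
  have "degree (\<Sum>k = 0..<m. A $$ (i, k) * B $$ (k, j)) \<le> g + h" if "i < n" "j < l" for i j
    using that entry_degrees_leD[OF dA A] entry_degrees_leD[OF dB B]
    by (intro degree_sum_le) (auto intro!: order.trans[OF degree_mult_le] add_mono)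
  then show ?thesis using A B unfolding entry_degrees_le_def by (auto simp: scalar_prod_def)
qed

lemma det_hom_subst_mat:
  assumes A: "A \<in> carrier_mat n n" and dA: "entry_degrees_le g A"
  shows "det (hom_subst_mat x y g A) = hom_subst x y (n * g) (det A)"
proof -
  have H: "hom_subst_mat x y g A \<in> carrier_mat n n" using A by simp
  have sgn: "hom_subst x y k (signof p * q) = signof p * hom_subst x y k q" for k p q
    by (simp add: sign_def hom_subst_uminus)
  have "hom_subst x y (n * g) (\<Prod>i = 0..<n. A $$ (i, p i)) =
      (\<Prod>i = 0..<n. hom_subst_mat x y g A $$ (i, p i))" if "p permutes {0..<n}" for p
  proof -
    have p: "p i < n" if "i < n" for i
      using \<open>p permutes {0..<n}\<close> that by (metis atLeastLessThan_iff permutes_in_image zero_le)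
    have "hom_subst x y (card {0..<n} * g) (\<Prod>i = 0..<n. A $$ (i, p i)) =
        (\<Prod>i = 0..<n. hom_subst x y g (A $$ (i, p i)))"
      using p entry_degrees_leD[OF dA A] by (intro hom_subst_prod) auto
    also have "\<dots> = (\<Prod>i = 0..<n. hom_subst_mat x y g A $$ (i, p i))"
      using p A by (intro prod.cong) auto
    finally show ?thesis by simp
  qed
  then show ?thesis
    unfolding det_def'[OF A] det_def'[OF H] hom_subst_sum sgn by (intro sum.cong) auto
qed

text \<open>The transforming matrices have no bound on their degrees in terms of \<open>g\<close>. They are substituted
with grades of their own, which leaves a power of \<open>y\<close> on the right and in the determinant.\<close>

lemma hom_subst_mat_equiv:
  fixes A B :: "'a::field poly mat"
  assumes eq: "mp_equiv n A B" and dA: "entry_degrees_le g A" and dB: "entry_degrees_le g B"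
  obtains U V N M c where "U \<in> carrier_mat n n" "V \<in> carrier_mat n n"
    "U * hom_subst_mat x y g A * V = y ^ N \<cdot>\<^sub>m hom_subst_mat x y g B" "det V = smult c (y ^ M)" "c \<noteq> 0"
proof -
  from eq obtain U V where UV: "A \<in> carrier_mat n n" "B \<in> carrier_mat n n" "U \<in> carrier_mat n n"
    "V \<in> carrier_mat n n" "unimodular_mp V" "U * A * V = B" unfolding mp_equiv_def by blast
  obtain u v where u: "entry_degrees_le u U" and v: "entry_degrees_le v V"
    using entry_degrees_le_exists by metis
  have UA: "U * A \<in> carrier_mat n n" using UV by simp
  let ?H = "hom_subst_mat x y"
  have "?H u U * ?H g A * ?H v V = ?H (u + g + v) (U * A * V)"
    using hom_subst_mat_mult[OF UV(3,1) u dA, of x y]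
      hom_subst_mat_mult[OF UA UV(4) entry_degrees_le_mult[OF UV(3,1) u dA] v, of x y] by simp
  also have "\<dots> = y ^ (u + v) \<cdot>\<^sub>m ?H g B"
  proof (rule eq_matI)
    fix i j assume ij: "i < dim_row (y ^ (u + v) \<cdot>\<^sub>m ?H g B)" "j < dim_col (y ^ (u + v) \<cdot>\<^sub>m ?H g B)"
    have e: "u + g + v = g + (u + v)" by simp
    show "?H (u + g + v) (U * A * V) $$ (i, j) = (y ^ (u + v) \<cdot>\<^sub>m ?H g B) $$ (i, j)"
      using ij dB hom_subst_pad[of "B $$ (i, j)" g x y "u + v"]
      unfolding UV(6) e entry_degrees_le_def by (simp add: mult.commute)
  qed (use UV(6) in auto)
  finally have e: "?H u U * ?H g A * ?H v V = y ^ (u + v) \<cdot>\<^sub>m ?H g B" .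
  obtain c where c: "c \<noteq> 0" "det V = [:c:]" using UV(5) unfolding unimodular_mp_def by blast
  have "det (?H v V) = smult c (y ^ (n * v))"
    unfolding det_hom_subst_mat[OF UV(4) v] c(2) hom_subst_const ..
  then show ?thesis using that[OF _ _ e _ c(1)] UV(3,4) by simp
qed

lemma smith_form_hom_subst_dvd:
  fixes A B :: "'a::field poly mat"
  assumes "mp_equiv n A B" "entry_degrees_le g A" "entry_degrees_le g B"
    and ss: "smith_form n (hom_subst_mat x y g A) ss" and ts: "smith_form n (hom_subst_mat x y g B) ts"
  shows "\<exists>M. \<forall>r<n. ss ! r dvd ts ! r * y ^ M"
proof -
  from hom_subst_mat_equiv[OF assms(1-3), of x y] obtain U V N M c where
    1: "U \<in> carrier_mat n n" "V \<in> carrier_mat n n"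
    "U * hom_subst_mat x y g A * V = y ^ N \<cdot>\<^sub>m hom_subst_mat x y g B" "det V = smult c (y ^ M)" "c \<noteq> 0" .
  have "ss ! r dvd ts ! r * y ^ ((N + M) * n)" if "r < n" for r
  proof -
    have "(y ^ N * det V) ^ n = smult (c ^ n) (y ^ ((N + M) * n))"
      unfolding 1(4) by (simp add: power_add[symmetric] smult_power power_mult)
    then have "ss ! r dvd smult (c ^ n) (ts ! r * y ^ ((N + M) * n))"
      using smith_form_dvd_transfer[OF ss ts 1(1-3) that] by simp
    then show ?thesis using 1(5) by (simp add: dvd_smult_iff)
  qed
  then show ?thesis by blast
qed

text \<open>Since \<open>y\<close> is prime to \<open>\<lambda>\<close>, equivalence up to powers of \<open>y\<close> keeps the power of \<open>\<lambda>\<close> that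
is common to all entries.\<close>

lemma entries_power_dvd_hom_subst:
  fixes A B :: "'a::field poly mat"
  assumes eq: "mp_equiv n A B" and d: "entry_degrees_le g A" "entry_degrees_le g B"
    and y: "poly y 0 \<noteq> 0"
    and dvd: "\<And>i j. i < n \<Longrightarrow> j < n \<Longrightarrow> [:0, 1:] ^ e dvd hom_subst_mat x y g A $$ (i, j)"
    and ij: "i < n" "j < n"
  shows "[:0, 1:] ^ e dvd hom_subst_mat x y g B $$ (i, j)"
proof -
  from hom_subst_mat_equiv[OF eq d, of x y] obtain U V N where
    1: "U \<in> carrier_mat n n" "V \<in> carrier_mat n n"
    "U * hom_subst_mat x y g A * V = y ^ N \<cdot>\<^sub>m hom_subst_mat x y g B" .
  have A: "hom_subst_mat x y g A \<in> carrier_mat n n" and B: "hom_subst_mat x y g B \<in> carrier_mat n n"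
    using mp_equiv_carrier[OF eq] by auto
  have "[:0, 1:] ^ e dvd (U * hom_subst_mat x y g A) $$ (i, j)" if "i < n" "j < n" for i j
    using that dvd by (intro dvd_entries_mult_mat[OF 1(1) A]) auto
  then have "[:0, 1:] ^ e dvd (U * hom_subst_mat x y g A * V) $$ (i, j)"
    using ij 1 A by (intro dvd_entries_mult_mat[of _ n]) auto
  then have dv: "[:0, 1:] ^ e dvd y ^ N * hom_subst_mat x y g B $$ (i, j)"
    unfolding 1(3) using ij B by simp
  let ?b = "hom_subst_mat x y g B $$ (i, j)"
  show ?thesis
  proof (cases "?b = 0")
    case False
    have y0: "y ^ N \<noteq> 0" "order 0 (y ^ N) = 0" using y by (auto simp: order_0I)
    have "e \<le> order 0 (y ^ N * ?b)"
    proof -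
      have "y ^ N * ?b \<noteq> 0" using False y0 by simp
      moreover have "[:- 0, 1:] ^ e dvd y ^ N * ?b" using dv by simp
      ultimately show ?thesis unfolding order_divides by blast
    qed
    also have "\<dots> = order 0 ?b" using order_mult[of "y ^ N" ?b 0] False y0 by simp
    finally show ?thesis using order_divides[of 0 e ?b] by simp
  qed simp
qed

section \<open>Degree, reversal and spectral data\<close>

lemma coeff_mp_eq_0_iff:
  "coeff_mp P e = 0\<^sub>m (dim_row P) (dim_col P) \<longleftrightarrow> (\<forall>i<dim_row P. \<forall>j<dim_col P. coeff (P $$ (i, j)) e = 0)"
  unfolding coeff_mp_def by (auto simp: mat_eq_iff)

lemma
  fixes P :: "'a::field poly mat"
  shows degree_mp_le_iff: "degree_mp P \<le> Fin g \<longleftrightarrow> entry_degrees_le g P"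
    and degree_mp_less_iff: "degree_mp P < Fin g \<longleftrightarrow>
      (\<forall>i<dim_row P. \<forall>j<dim_col P. coeffs_below g (P $$ (i, j)))"
proof -
  have deg: "degree p \<le> g \<longleftrightarrow> (\<forall>e>g. coeff p e = 0)" for p :: "'a poly" and g
    by (auto intro: degree_le coeff_eq_0)
  let ?J = "{e. coeff_mp P e \<noteq> 0\<^sub>m (dim_row P) (dim_col P)}"
  have J: "e \<in> ?J \<longleftrightarrow> (\<exists>i<dim_row P. \<exists>j<dim_col P. coeff (P $$ (i, j)) e \<noteq> 0)" for e
    by (simp add: coeff_mp_eq_0_iff)
  obtain u where u: "entry_degrees_le u P" using entry_degrees_le_exists by blast
  have "?J \<subseteq> {..u}"
  proof
    fix e assume "e \<in> ?J"
    then obtain i j where "i < dim_row P" "j < dim_col P" "coeff (P $$ (i, j)) e \<noteq> 0" unfolding J by blast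
    then show "e \<in> {..u}" using u le_degree[of "P $$ (i, j)" e] unfolding entry_degrees_le_def by force
  qed
  then have fin: "finite ?J" by (rule finite_subset) simp
  have ne: "?J \<noteq> {}" if "P \<noteq> 0\<^sub>m (dim_row P) (dim_col P)"
  proof -
    have "\<exists>i<dim_row P. \<exists>j<dim_col P. P $$ (i, j) \<noteq> 0"
    proof (rule ccontr)
      assume "\<not> ?thesis"
      then have "P = 0\<^sub>m (dim_row P) (dim_col P)" by (intro eq_matI) auto
      with that show False by simp
    qed
    then obtain i j where ij: "i < dim_row P" "j < dim_col P" "P $$ (i, j) \<noteq> 0" by blast
    then have "coeff (P $$ (i, j)) (degree (P $$ (i, j))) \<noteq> 0" by simp
    then have "degree (P $$ (i, j)) \<in> ?J" unfolding J using ij by blast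
    then show ?thesis by blast
  qed
  have z: "P $$ (i, j) = 0" if "P = 0\<^sub>m (dim_row P) (dim_col P)" "i < dim_row P" "j < dim_col P" for i j
    using that by (metis index_zero_mat(1))
  show "degree_mp P \<le> Fin g \<longleftrightarrow> entry_degrees_le g P"
  proof (cases "P = 0\<^sub>m (dim_row P) (dim_col P)")
    case True
    then have "entry_degrees_le g P" using z[OF True] by (simp add: entry_degrees_le_def)
    with True show ?thesis by (simp add: degree_mp_def)
  next
    case False
    then have "degree_mp P \<le> Fin g \<longleftrightarrow> (\<forall>e\<in>?J. e \<le> g)"
      using Max_le_iff[OF fin ne] by (simp add: degree_mp_def)
    also have "\<dots> \<longleftrightarrow> entry_degrees_le g P"
      unfolding entry_degrees_le_def deg Ball_def J by (meson not_le)
    finally show ?thesis .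
  qed
  show "degree_mp P < Fin g \<longleftrightarrow> (\<forall>i<dim_row P. \<forall>j<dim_col P. coeffs_below g (P $$ (i, j)))"
  proof (cases "P = 0\<^sub>m (dim_row P) (dim_col P)")
    case True
    then have "\<forall>i<dim_row P. \<forall>j<dim_col P. coeffs_below g (P $$ (i, j))" using z[OF True] by simp
    with True show ?thesis by (simp add: degree_mp_def)
  next
    case False
    then have "degree_mp P < Fin g \<longleftrightarrow> (\<forall>e\<in>?J. e < g)"
      using Max_less_iff[OF fin ne] by (simp add: degree_mp_def)
    also have "\<dots> \<longleftrightarrow> (\<forall>i<dim_row P. \<forall>j<dim_col P. coeffs_below g (P $$ (i, j)))"
      unfolding Ball_def J by (meson not_le)
    finally show ?thesis .
  qed
qed

lemma degree_mp_eq_iff: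
  "degree_mp P = Fin d \<longleftrightarrow> entry_degrees_le d P \<and>
     (\<exists>i<dim_row P. \<exists>j<dim_col P. coeff (P $$ (i, j)) d \<noteq> 0)"
proof -
  have "degree_mp P = Fin d \<longleftrightarrow> degree_mp P \<le> Fin d \<and> \<not> degree_mp P < Fin d" by auto
  also have "\<dots> \<longleftrightarrow> entry_degrees_le d P \<and> (\<exists>i<dim_row P. \<exists>j<dim_col P. coeff (P $$ (i, j)) d \<noteq> 0)"
    (is "?L \<longleftrightarrow> ?R")
  proof
    assume ?L
    then obtain i j e where e: "entry_degrees_le d P" "i < dim_row P" "j < dim_col P" "d \<le> e"
      "coeff (P $$ (i, j)) e \<noteq> 0" unfolding degree_mp_le_iff degree_mp_less_iff by blast
    then have "e \<le> d" using le_degree[of "P $$ (i, j)" e] unfolding entry_degrees_le_def by force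
    then show ?R using e by auto
  next
    assume ?R
    then show ?L unfolding degree_mp_le_iff degree_mp_less_iff by blast
  qed
  finally show ?thesis .
qed

lemma reversal_mp_hom_subst: "reversal_mp g P = hom_subst_mat 1 [:0, 1:] g P"
proof -
  have "(\<Sum>i\<le>g. monom (coeff p (g - i)) i) = hom_subst 1 [:0, 1:] g p" for p :: "'a poly"
  proof -
    have "hom_subst 1 [:0, 1:] g p = (\<Sum>i\<le>g. monom (coeff p i) (g - i))"
      unfolding hom_subst_def by (simp add: monom_altdef)
    also have "\<dots> = (\<Sum>i\<le>g. monom (coeff p (g - i)) i)"
      by (rule sum.reindex_bij_witness[of _ "\<lambda>i. g - i" "\<lambda>i. g - i"]) auto
    finally show ?thesis ..
  qed
  then show ?thesis unfolding reversal_mp_def by simp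
qed

lemma coeff_reversal:
  assumes "i \<le> g" shows "coeff (hom_subst 1 [:0, 1:] g p) i = coeff p (g - i)"
proof -
  have "coeff (hom_subst 1 [:0, 1:] g p) i = (\<Sum>j\<le>g. if j = g - i then coeff p j else 0)"
    unfolding hom_subst_def coeff_sum using assms
    by (intro sum.cong) (auto simp: monom_altdef[symmetric])
  then show ?thesis by simp
qed

text \<open>Read for all entries of a matrix of grade \<open>g\<close>: its degree is at most \<open>g - e\<close> exactly when
\<open>\<lambda>\<^sup>e\<close> divides all entries of the reversal.\<close>

lemma X_power_dvd_reversal_iff:
  assumes "e \<le> Suc g" "degree p \<le> g"
  shows "[:0, 1:] ^ e dvd hom_subst 1 [:0, 1:] g p \<longleftrightarrow> (\<forall>i. g < i + e \<longrightarrow> coeff p i = 0)"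
proof -
  have m: "[:0, 1:] ^ e = (monom 1 e :: 'a poly)" by (simp add: monom_altdef)
  have "[:0, 1:] ^ e dvd hom_subst 1 [:0, 1:] g p \<longleftrightarrow> (\<forall>i<e. coeff (hom_subst 1 [:0, 1:] g p) i = 0)"
    unfolding m monom_1_dvd_iff' ..
  also have "\<dots> \<longleftrightarrow> (\<forall>i<e. coeff p (g - i) = 0)"
    using assms(1) by (auto simp: coeff_reversal)
  also have "\<dots> \<longleftrightarrow> (\<forall>i. g < i + e \<longrightarrow> coeff p i = 0)"
  proof
    assume h: "\<forall>i<e. coeff p (g - i) = 0"
    show "\<forall>i. g < i + e \<longrightarrow> coeff p i = 0"
    proof (intro allI impI)
      fix i assume "g < i + e"
      then show "coeff p i = 0"
        using h[rule_format, of "g - i"] assms(2) by (cases "i \<le> g") (auto simp: coeff_eq_0)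
    qed
  next
    assume h: "\<forall>i. g < i + e \<longrightarrow> coeff p i = 0"
    show "\<forall>i<e. coeff p (g - i) = 0"
      using h assms(1) by auto
  qed
  finally show ?thesis .
qed

lemma degree_det_bound:
  assumes "P \<in> carrier_mat n n" "entry_degrees_le g P"
  shows "degree (det P) \<le> n * g"
  using degree_det_le[of n P g] assms entry_degrees_leD[OF assms(2,1)] by (simp add: mult.commute)

text \<open>Both sides are the determinant of the coefficient of \<open>\<lambda>\<^sup>g\<close>.\<close>

lemma det_reversal_eval_0:
  assumes "P \<in> carrier_mat n n" "entry_degrees_le g P"
  shows "poly (det (reversal_mp g P)) 0 = coeff (det P) (n * g)"
  unfolding reversal_mp_hom_subst det_hom_subst_mat[OF assms] by (simp add: poly_hom_subst_zero)

lemma det_reversal_nonzero: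
  fixes P :: "'a::field poly mat"
  assumes "P \<in> carrier_mat n n" "entry_degrees_le g P" "det P \<noteq> 0"
  shows "det (reversal_mp g P) \<noteq> 0"
proof
  let ?h = "hom_subst 1 [:0, 1:]"
  assume "det (reversal_mp g P) = 0"
  then have "?h (n * g) (?h (n * g) (det P)) = 0"
    unfolding reversal_mp_hom_subst det_hom_subst_mat[OF assms(1,2)] by simp
  moreover have "?h (n * g) (?h (n * g) (det P)) = hom_subst [:0, 1:] 1 (n * g) (det P)"
  proof -
    have "hom_subst 1 [:0, 1:] 1 1 = ([:0, 1:] :: 'a poly)" by (simp add: hom_subst_1)
    moreover have "hom_subst 1 [:0, 1:] 1 [:0, 1:] = (1 :: 'a poly)"
      using hom_subst_linear[of 1 "[:0, 1:] :: 'a poly" 0 1] by simp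
    ultimately show ?thesis using hom_subst_comp[of 1 "[:0, 1:]" 1 "[:0, 1:]" "n * g" "det P"] by simp
  qed
  ultimately show False
    using hom_subst_id[OF degree_det_bound[OF assms(1,2)]] assms(3) by simp
qed

lemma exact_exponent_X:
  assumes "s \<noteq> 0" shows "exact_exponent [:0, 1:] s = order 0 s"
proof -
  have "[:0, 1:] ^ m dvd s \<longleftrightarrow> m \<le> order 0 s" for m
    using order_divides[of 0 m s] assms by simp
  then show ?thesis unfolding exact_exponent_def by (intro Greatest_equality) auto
qed

lemma smith_form_nonzero: "smith_form n P ss \<Longrightarrow> s \<in> set ss \<Longrightarrow> s \<noteq> 0"
  unfolding smith_form_def by auto

lemma poly_det_smith_form_zero_iff:
  assumes "smith_form n P ss"
  shows "poly (det P) t = 0 \<longleftrightarrow> (\<exists>s\<in>set ss. poly s t = 0)"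
proof -
  obtain c where c: "c \<noteq> 0" "det P = smult c (prod_list ss)" using det_smith_form[OF assms] .
  have "poly (prod_list ss) t = 0 \<longleftrightarrow> (\<exists>s\<in>set ss. poly s t = 0)" by (induction ss) auto
  then show ?thesis using c by simp
qed

lemma infinite_spectral_structure_None_iff:
  assumes "P \<in> carrier_mat n n" "entry_degrees_le g P" "det P \<noteq> 0"
  shows "infinite_spectral_structure g P = None \<longleftrightarrow> coeff (det P) (n * g) \<noteq> 0"
proof -
  let ?R = "reversal_mp g P"
  have R: "?R \<in> carrier_mat n n" using assms(1) unfolding reversal_mp_def by simp
  note ss = invariant_polys_smith_form[OF R det_reversal_nonzero[OF assms]]
  have "infinite_spectral_structure g P = None \<longleftrightarrow>
      (\<forall>s\<in>set (invariant_polys ?R). exact_exponent [:0, 1:] s = 0)"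
    unfolding infinite_spectral_structure_def partial_mults_infinity_def partial_mults_def by simp
  also have "\<dots> \<longleftrightarrow> (\<forall>s\<in>set (invariant_polys ?R). poly s 0 \<noteq> 0)"
    using smith_form_nonzero[OF ss] by (intro ball_cong refl) (auto simp: exact_exponent_X order_root)
  also have "\<dots> \<longleftrightarrow> poly (det ?R) 0 \<noteq> 0"
    using poly_det_smith_form_zero_iff[OF ss] by blast
  finally show ?thesis unfolding det_reversal_eval_0[OF assms(1,2)] .
qed

lemma degree_det_eq_if_top_coeff:
  assumes "P \<in> carrier_mat n n" "entry_degrees_le g P" "coeff (det P) (n * g) \<noteq> 0"
  shows "degree (det P) = n * g"
  using degree_det_bound[OF assms(1,2)] le_degree[OF assms(3)] by simp

lemma exists_irreducible_divisor:
  fixes b :: "'a::field poly"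
  assumes "0 < degree b"
  shows "\<exists>p. irreducible p \<and> 0 < degree p \<and> p dvd b"
proof -
  define Q where "Q m \<longleftrightarrow> (\<exists>p. p dvd b \<and> 0 < degree p \<and> degree p = m)" for m
  have "Q (degree b)" unfolding Q_def by (intro exI[of _ b] conjI dvd_refl refl assms)
  then have "Q (LEAST m. Q m)" by (rule LeastI)
  then obtain p where p: "p dvd b" "0 < degree p" "degree p = (LEAST m. Q m)" unfolding Q_def by blast
  have min: "degree p \<le> degree q" if "q dvd b" "0 < degree q" for q
    unfolding p(3) by (rule Least_le) (use that in \<open>auto simp: Q_def\<close>)
  have p0: "p \<noteq> 0" using p(2) by auto
  have "irreducible p"
  proof (rule irreducibleI)
    show "\<not> p dvd 1" using p(2) by (metis is_unit_iff_degree less_irrefl p0)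
    fix u v assume uv: "p = u * v"
    then have nz: "u \<noteq> 0" "v \<noteq> 0" using p0 by auto
    have d: "degree p = degree u + degree v" unfolding uv using nz by (rule degree_mult_eq)
    have "u dvd b" "v dvd b" using p(1) unfolding uv by (auto dest: dvd_mult_left dvd_mult_right)
    then have "degree u = 0 \<or> degree v = 0" using min[of u] min[of v] d by linarith
    then show "u dvd 1 \<or> v dvd 1" using nz by (auto simp: is_unit_iff_degree)
  qed (use p0 in auto)
  with p show ?thesis by blast
qed

lemma finite_irreducible_divisor_degrees:
  fixes P :: "'a::field poly mat"
  assumes P: "P \<in> carrier_mat n n" "det P \<noteq> 0"
  shows "finite (degree ` irreducible_divisors P)"
proof -
  note ss = invariant_polys_smith_form[OF P]
  let ?m = "Max (insert 0 (degree ` set (invariant_polys P)))"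
  have "degree q \<le> ?m" if q: "q \<in> irreducible_divisors P" for q
  proof -
    from q obtain s where s: "s \<in> set (invariant_polys P)" "q dvd s" unfolding irreducible_divisors_def by blast
    have "degree q \<le> degree s" using s smith_form_nonzero[OF ss] by (intro dvd_imp_degree_le) auto
    also have "\<dots> \<le> ?m" using s by (intro Max_ge) auto
    finally show ?thesis .
  qed
  then show ?thesis by (auto intro: finite_subset[of _ "{..?m}"])
qed

lemma max_irreducible_degree_ge_1:
  fixes P :: "'a::field poly mat"
  assumes "P \<in> carrier_mat n n" "det P \<noteq> 0"
  shows "1 \<le> max_irreducible_degree P"
  unfolding max_irreducible_degree_def
  using finite_irreducible_divisor_degrees[OF assms] by (intro Max_ge) auto

text \<open>The form in which the maximal degree of the irreducible divisors enters the construction: as a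
condition on the divisors of the determinant, it is easily carried through a substitution.\<close>

lemma small_factor_of_det:
  fixes P :: "'a::field poly mat"
  assumes P: "P \<in> carrier_mat n n" "det P \<noteq> 0" and b: "b dvd det P" "0 < degree b"
  shows "\<exists>p. p dvd b \<and> 0 < degree p \<and> degree p \<le> max_irreducible_degree P"
proof -
  note ss = invariant_polys_smith_form[OF P]
  let ?ss = "invariant_polys P"
  obtain c where c: "c \<noteq> 0" "det P = smult c (prod_list ?ss)" using det_smith_form[OF ss] .
  obtain p where p: "irreducible p" "0 < degree p" "p dvd b" using exists_irreducible_divisor[OF b(2)] by blast
  have "p dvd prod_list ?ss" using dvd_trans[OF p(3) b(1)] c by (simp add: dvd_smult_iff)
  moreover have prime: "prime_elem p" using p(1) by (rule field_poly_irreducible_imp_prime)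
  have "\<exists>s\<in>set ts. p dvd s" if "p dvd prod_list ts" for ts
    using that
  proof (induction ts)
    case Nil
    then show ?case using prime by (simp add: prime_elem_not_unit)
  next
    case (Cons t ts)
    then show ?case using prime_elem_dvd_multD[OF prime, of t "prod_list ts"] by auto
  qed
  ultimately obtain s where "s \<in> set ?ss" "p dvd s" by blast
  then have "p \<in> irreducible_divisors P" unfolding irreducible_divisors_def using p by blast
  then have "degree p \<le> max_irreducible_degree P"
    unfolding max_irreducible_degree_def
    using finite_irreducible_divisor_degrees[OF P] by (intro Max_ge) auto
  with p show ?thesis by blast
qed

lemma quasi_triangular_wrt_block_tri:
  assumes Q: "block_tri \<phi> Ds Q" and sizes: "\<forall>D\<in>set Ds. 1 \<le> dim_row D \<and> dim_row D \<le> k"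
    and f: "f 0 = 0"
  shows "quasi_triangular_wrt k (map dim_row Ds) (map_mat f Q)"
proof -
  let ?bs = "map dim_row Ds"
  have c: "Q \<in> carrier_mat (total_dim Ds) (total_dim Ds)" using block_tri_carrier[OF Q] .
  have "block_mp ?bs (map_mat f Q) a b = 0\<^sub>m (?bs ! a) (?bs ! b)" if "a < length ?bs" "b < a" for a b
  proof (rule eq_matI)
    fix i j assume "i < dim_row (0\<^sub>m (?bs ! a) (?bs ! b))" "j < dim_col (0\<^sub>m (?bs ! a) (?bs ! b))"
    then have ij: "i < dim_row (Ds ! a)" "j < dim_row (Ds ! b)" using that by auto
    have "total_dim (take a Ds) + i < total_dim Ds" "total_dim (take b Ds) + j < total_dim Ds"
      using sum_list_take_Suc_le[of a ?bs] sum_list_take_Suc_le[of b ?bs] that ij by (auto simp: take_map)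
    then show "block_mp ?bs (map_mat f Q) a b $$ (i, j) = 0\<^sub>m (?bs ! a) (?bs ! b) $$ (i, j)"
      using block_tri_block_entries[OF Q, of a b i j] that ij c f
      by (auto simp: block_mp_def take_map)
  qed (auto simp: block_mp_def)
  then show ?thesis
    unfolding quasi_triangular_wrt_def block_triangular_def using c sizes by auto
qed

lemma off_diagonal_block_degree:
  assumes Q: "block_tri (coeffs_below d) Ds Q" and ab: "a < length Ds" "b < length Ds" "a \<noteq> b"
  shows "degree_mp (block_mp (map dim_row Ds) Q a b) < Fin d"
  unfolding degree_mp_less_iff
proof (intro allI impI)
  let ?B = "block_mp (map dim_row Ds) Q a b"
  fix i j e assume h: "i < dim_row ?B" "j < dim_col ?B" "d \<le> e"
  then have ij: "i < dim_row (Ds ! a)" "j < dim_row (Ds ! b)" using ab by (auto simp: block_mp_def)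
  then show "coeff (?B $$ (i, j)) e = 0"
    using block_tri_block_entries[OF Q ab ij] h(3) ab
    by (auto simp: block_mp_def take_map split: if_splits)
qed

lemma block_form_properties:
  assumes Q: "block_tri (coeffs_below d) Ds Q" and mon: "\<forall>D\<in>set Ds. column_monic (\<lambda>_. d) (dim_row D) D"
    and n: "Q \<in> carrier_mat n n"
  shows "entry_degrees_le d Q" "1 \<le> n \<Longrightarrow> degree_mp Q = Fin d"
proof -
  have N: "total_dim Ds = n" using block_tri_dim_row[OF Q] n by simp
  note c = block_tri_monic_coeff[OF Q mon, unfolded N]
  show e: "entry_degrees_le d Q"
    unfolding entry_degrees_le_def using c n by (auto intro!: degree_le)
  show "degree_mp Q = Fin d" if "1 \<le> n"
    unfolding degree_mp_eq_iff using e c[of 0 0 d] that n by (auto intro!: exI[of _ 0])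
qed

section \<open>The strictly regular case\<close>

lemma same_data_strictly_regular:
  assumes "strictly_regular_mp g P" "regular_mp Q" "same_size_grade_degree_data g P Q"
  shows "strictly_regular_mp g Q"
  using assms
  unfolding strictly_regular_mp_def same_size_grade_degree_data_def complete_spectral_data_def by simp

theorem strictly_regular_quasi_triangularization:
  fixes P :: "'a::field poly mat"
  assumes n: "1 \<le> n" and P: "P \<in> carrier_mat n n" and reg: "strictly_regular_mp g P"
    and le: "degree_mp P \<le> Fin g" and d: "degree_mp P = Fin d"
  shows "\<exists>Q bs. regular_mp Q \<and> quasi_triangular_wrt (max_irreducible_degree P) bs Q \<and>
    same_size_grade_degree_data g P Q \<and> strictly_regular_mp g Q \<and>
    (\<forall>a<length bs. \<forall>b<length bs. a \<noteq> b \<longrightarrow> degree_mp (block_mp bs Q a b) < Fin d)"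
proof -
  have ne: "det P \<noteq> 0" and inf: "infinite_spectral_structure g P = None"
    using reg unfolding strictly_regular_mp_def regular_mp_def by auto
  have eP: "entry_degrees_le g P" using le unfolding degree_mp_le_iff .
  have top: "coeff (det P) (n * g) \<noteq> 0"
    using inf unfolding infinite_spectral_structure_None_iff[OF P eP ne] .
  then have deg: "degree (det P) = n * g" using degree_det_eq_if_top_coeff[OF P eP] by blast
  have "n * g \<le> n * d"
    using degree_det_bound[OF P, of d] d deg degree_mp_le_iff[of P d] by simp
  then have g: "g = d" using n le d by simp
  from strictly_regular_block_form[OF P ne deg max_irreducible_degree_ge_1[OF P ne] small_factor_of_det[OF P ne]]
  obtain Ds Q where Q: "mp_equiv n P Q" "block_tri (coeffs_below g) Ds Q"
    "\<forall>D\<in>set Ds. 1 \<le> dim_row D \<and> dim_row D \<le> max_irreducible_degree P \<and> column_monic (\<lambda>_. g) (dim_row D) D"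
    by blast
  have mon: "\<forall>D\<in>set Ds. column_monic (\<lambda>_. g) (dim_row D) D" using Q(3) by blast
  have Qc: "Q \<in> carrier_mat n n" using mp_equiv_carrier[OF Q(1)] by simp
  have eQ: "entry_degrees_le g Q" and dQ: "degree_mp Q = Fin g"
    using block_form_properties[OF Q(2) mon Qc] n by auto
  have neQ: "det Q \<noteq> 0" using mp_equiv_det_nonzero[OF Q(1)] ne by blast
  have "degree (det Q) = n * g" using mp_equiv_degree_det[OF Q(1)] deg by simp
  then have "coeff (det Q) (n * g) \<noteq> 0" using neQ by (metis leading_coeff_0_iff)
  then have infQ: "infinite_spectral_structure g Q = None"
    unfolding infinite_spectral_structure_None_iff[OF Qc eQ neQ] .
  have regQ: "regular_mp Q" unfolding regular_mp_def using Qc neQ by auto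
  have same: "same_size_grade_degree_data g P Q"
    unfolding same_size_grade_degree_data_def complete_spectral_data_def
    using P Qc le d dQ g inf infQ invariant_polys_equiv[OF Q(1) ne] by simp
  have "map_mat (\<lambda>x. x) Q = Q" by (rule eq_matI) auto
  then have "quasi_triangular_wrt (max_irreducible_degree P) (map dim_row Ds) Q"
    using quasi_triangular_wrt_block_tri[OF Q(2), of "max_irreducible_degree P" "\<lambda>x. x"] Q(3) by auto
  moreover have "\<forall>a<length (map dim_row Ds). \<forall>b<length (map dim_row Ds). a \<noteq> b \<longrightarrow>
      degree_mp (block_mp (map dim_row Ds) Q a b) < Fin d"
    using off_diagonal_block_degree[OF Q(2)] g by simp
  ultimately show ?thesis
    using regQ same same_data_strictly_regular[OF reg regQ same] by blast
qed

section \<open>Moving a non-eigenvalue to infinity\<close>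

lemma linear_power_coprime_cancel:
  fixes s t :: "'a::field poly"
  assumes "poly s \<omega> \<noteq> 0" "s dvd t * [:- \<omega>, 1:] ^ M"
  shows "s dvd t"
  using assms(2)
proof (induction M)
  case (Suc M)
  then obtain u where u: "t * [:- \<omega>, 1:] ^ Suc M = s * u" by blast
  have "poly (t * [:- \<omega>, 1:] ^ Suc M) \<omega> = 0" by simp
  then have "poly u \<omega> = 0" unfolding u using assms(1) by simp
  then obtain v where v: "u = [:- \<omega>, 1:] * v" by (auto simp: poly_eq_0_iff_dvd)
  have "[:- \<omega>, 1:] * (t * [:- \<omega>, 1:] ^ M) = [:- \<omega>, 1:] * (s * v)"
    using u unfolding v by (simp only: power_Suc ac_simps)
  then have "t * [:- \<omega>, 1:] ^ M = s * v" by (metis mult_left_cancel pCons_eq_0_iff zero_neq_one)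
  then show ?case using Suc.IH by simp
qed simp

text \<open>The two mutually inverse substitutions are \<open>\<lambda> \<mapsto> \<omega> + 1 / \<lambda>\<close> and
\<open>\<lambda> \<mapsto> 1 / (\<lambda> - \<omega>)\<close>. The first one sends the value at \<open>\<omega>\<close> to the leading coefficient.\<close>

context
  fixes \<omega> :: "'a::field"
begin

abbreviation "to_infinity \<equiv> hom_subst [:1, \<omega>:] [:0, 1:]"
abbreviation "from_infinity \<equiv> hom_subst 1 [:- \<omega>, 1:]"

lemma degree_shift_le: "degree [:1, \<omega>:] \<le> 1" "degree [:0, 1 :: 'a:] \<le> 1" "degree (1 :: 'a poly) \<le> 1"
  "degree [:- \<omega>, 1:] \<le> 1"
  by auto

lemma from_to_infinity: "degree a \<le> m \<Longrightarrow> from_infinity m (to_infinity m a) = a"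
proof -
  assume a: "degree a \<le> m"
  have "from_infinity 1 [:1, \<omega>:] = [:0, 1:]" "from_infinity 1 [:0, 1:] = 1"
    unfolding hom_subst_linear by (auto simp: one_pCons)
  then show ?thesis
    using hom_subst_comp[OF degree_shift_le(1,2), of 1 "[:- \<omega>, 1:]" m a] hom_subst_id[OF a] by simp
qed

lemma to_from_infinity: "degree a \<le> m \<Longrightarrow> to_infinity m (from_infinity m a) = a"
proof -
  assume a: "degree a \<le> m"
  have "to_infinity 1 1 = [:0, 1:]" by (simp add: hom_subst_1)
  moreover have "to_infinity 1 [:- \<omega>, 1:] = 1"
    unfolding hom_subst_linear by (simp add: one_pCons)
  ultimately show ?thesis
    using hom_subst_comp[OF degree_shift_le(3,4), of "[:1, \<omega>:]" "[:0, 1:]" m a] hom_subst_id[OF a] by simp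
qed

lemma reversal_from_infinity:
  "hom_subst 1 [:0, 1:] m (from_infinity m a) = hom_subst [:0, 1:] [:1, - \<omega>:] m a"
proof -
  have "hom_subst 1 [:0, 1:] 1 1 = ([:0, 1:] :: 'a poly)" by (simp add: hom_subst_1)
  moreover have "hom_subst 1 [:0, 1:] 1 [:- \<omega>, 1:] = [:1, - \<omega>:]"
    unfolding hom_subst_linear by (simp add: one_pCons)
  ultimately show ?thesis
    using hom_subst_comp[OF degree_shift_le(3,4), of 1 "[:0, 1:]" m a] by simp
qed

text \<open>The inverse substitution takes a divisor \<open>b\<close> to a divisor of \<open>f\<close>. If this is not constant, it has
a factor of degree at most \<open>k\<close>, whose image divides \<open>b\<close>; the image is not constant, because the
factor does not vanish at \<open>\<omega>\<close>. If it is constant, then \<open>b\<close> is a multiple of a power of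
\<open>\<lambda>\<close>, and \<open>\<lambda>\<close> is the small factor.\<close>

lemma small_factors_to_infinity:
  fixes f :: "'a poly"
  assumes k: "1 \<le> k" and f: "degree f \<le> N" and deg: "degree (to_infinity N f) = N"
    and ne: "f \<noteq> 0"
    and small: "\<And>b. b dvd f \<Longrightarrow> 0 < degree b \<Longrightarrow> \<exists>p. p dvd b \<and> 0 < degree p \<and> degree p \<le> k"
    and b: "b dvd to_infinity N f" "0 < degree b"
  shows "\<exists>p. p dvd b \<and> 0 < degree p \<and> degree p \<le> k"
proof -
  from b(1) obtain q where q: "to_infinity N f = b * q" by blast
  have "to_infinity N f \<noteq> 0" using from_to_infinity[OF f] ne by (metis hom_subst_0)
  then have nz: "b \<noteq> 0" "q \<noteq> 0" using q by auto
  have N: "N = degree b + degree q" using deg q degree_mult_eq[OF nz] by simp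
  define b' where "b' = from_infinity (degree b) b"
  have "f = from_infinity N (b * q)" using from_to_infinity[OF f] q by simp
  then have "f = b' * from_infinity (degree q) q"
    unfolding N b'_def by (simp add: hom_subst_mult)
  then have b'f: "b' dvd f" by simp
  have eval: "poly b' \<omega> \<noteq> 0"
    unfolding b'_def using nz by (simp add: poly_hom_subst_zero)
  have b'deg: "degree b' \<le> degree b"
    unfolding b'_def by (rule degree_hom_subst_le[OF degree_shift_le(3,4)])
  have b_eq: "b = to_infinity (degree b) b'" unfolding b'_def by (simp add: to_from_infinity)
  show ?thesis
  proof (cases "degree b' = 0")
    case True
    then obtain c where "b' = [:c:]" by (rule degree_eq_zeroE)
    then have "b = smult c ([:0, 1:] ^ degree b)" using b_eq by (simp add: hom_subst_const)
    then have "[:0, 1:] dvd b" using b(2) by (metis dvd_power dvd_smult)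
    then show ?thesis using k by (intro exI[of _ "[:0, 1:]"]) simp
  next
    case False
    then obtain p where p: "p dvd b'" "0 < degree p" "degree p \<le> k" using small[OF b'f] by blast
    then obtain r where r: "b' = p * r" by blast
    have "p \<noteq> 0" "r \<noteq> 0" using eval r by auto
    then have dpr: "degree b' = degree p + degree r" unfolding r by (rule degree_mult_eq)
    define e where "e = degree b - degree b'"
    have "b = to_infinity ((degree p + degree r) + e) (p * r)"
      using b_eq b'deg dpr r unfolding e_def by simp
    also have "\<dots> = to_infinity (degree p) p * to_infinity (degree r) r * [:0, 1:] ^ e"
      using degree_mult_le[of p r] by (simp add: hom_subst_pad hom_subst_mult)
    finally have "to_infinity (degree p) p dvd b" by (metis dvd_mult2 dvd_triv_left)
    moreover have "degree (to_infinity (degree p) p) \<le> degree p"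
      by (rule degree_hom_subst_le[OF degree_shift_le(1,2)])
    moreover have "0 < degree (to_infinity (degree p) p)"
    proof (rule ccontr)
      assume "\<not> ?thesis"
      then obtain c where c: "to_infinity (degree p) p = [:c:]" using degree_eq_zeroE by blast
      have "p = from_infinity (degree p) [:c:]" using from_to_infinity[of p "degree p"] c by simp
      then have "p = smult c ([:- \<omega>, 1:] ^ degree p)" by (simp add: hom_subst_const)
      then have "poly p \<omega> = poly (smult c ([:- \<omega>, 1:] ^ degree p)) \<omega>" by (rule arg_cong)
      also have "\<dots> = 0" using p(2) by simp
      finally show False using eval unfolding r by simp
    qed
    ultimately show ?thesis using p(3) by (meson le_trans)
  qed
qed

end

text \<open>The factor by which the invariant polynomials may differ is prime to \<open>\<lambda>\<close>.\<close>

lemma order_0_smith_form_hom_subst_le: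
  fixes A B :: "'a::field poly mat"
  assumes eq: "mp_equiv n A B" and d: "entry_degrees_le g A" "entry_degrees_le g B"
    and ss: "smith_form n (hom_subst_mat x y g A) ss"
    and ts: "smith_form n (hom_subst_mat x y g B) ts" and r: "r < n" and y0: "poly y 0 \<noteq> 0"
  shows "order 0 (ss ! r) \<le> order 0 (ts ! r)"
proof -
  obtain M where M: "ss ! r dvd ts ! r * y ^ M"
    using smith_form_hom_subst_dvd[OF eq d ss ts] r by blast
  have "ts ! r \<in> set ts" using ts r unfolding smith_form_def by simp
  then have nz: "ts ! r \<noteq> 0" by (rule smith_form_nonzero[OF ts])
  have y: "y ^ M \<noteq> 0" using y0 by auto
  have oy: "order 0 (y ^ M) = 0" using y0 by (intro order_0I) simp
  have prod: "ts ! r * y ^ M \<noteq> 0" using nz y by simp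
  from dvd_imp_order_le[OF prod M] have "order 0 (ss ! r) \<le> order 0 (ts ! r * y ^ M)" .
  also have "\<dots> = order 0 (ts ! r)" using order_mult[OF prod] oy by simp
  finally show ?thesis .
qed

text \<open>Equivalence holds only between \<open>P'\<close> and \<open>Q'\<close>, the matrices with \<open>\<omega>\<close> moved to infinity.
Both \<open>P\<close>, \<open>Q\<close> and their reversals are homogeneous substitutions into \<open>P'\<close>, \<open>Q'\<close>, so all four
comparisons go through the pair \<open>P'\<close>, \<open>Q'\<close>.\<close>

theorem quasi_triangularization_non_eigenvalue:
  fixes P :: "'a::field poly mat"
  assumes n: "1 \<le> n" and P: "P \<in> carrier_mat n n" and ne: "det P \<noteq> 0"
    and le: "degree_mp P \<le> Fin g" and d: "degree_mp P = Fin d"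
    and \<omega>: "poly (det P) \<omega> \<noteq> 0"
  shows "\<exists>Q. regular_mp Q \<and> quasi_triangular (max_irreducible_degree P) Q \<and> same_size_grade_degree_data g P Q"
proof -
  let ?to = "hom_subst [:1, \<omega>:] [:0, 1:]" and ?from = "hom_subst 1 [:- \<omega>, 1:]"
  let ?inf = "hom_subst_mat [:0, 1:] [:1, - \<omega>:] g"
  let ?k = "max_irreducible_degree P"
  define P' where "P' = map_mat (?to g) P"
  have eP: "entry_degrees_le g P" using le unfolding degree_mp_le_iff .
  have P': "P' \<in> carrier_mat n n" using P unfolding P'_def by simp
  have eP': "entry_degrees_le g P'"
    unfolding P'_def by (rule entry_degrees_le_hom_subst[OF degree_shift_le(1,2)])
  have P_eq: "P = map_mat (?from g) P'"
    unfolding P'_def using eP unfolding entry_degrees_le_def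
    by (intro eq_matI) (auto simp: from_to_infinity)
  have detP': "det P' = ?to (n * g) (det P)"
    unfolding P'_def by (rule det_hom_subst_mat[OF P eP])
  have detP: "det P = ?from (n * g) (det P')"
    unfolding detP' using from_to_infinity[OF degree_det_bound[OF P eP]] by simp
  have top: "coeff (det P') (n * g) \<noteq> 0"
    using \<omega> unfolding detP by (simp add: poly_hom_subst_zero)
  then have ne': "det P' \<noteq> 0" by auto
  have deg': "degree (det P') = n * g" by (rule degree_det_eq_if_top_coeff[OF P' eP' top])
  have small: "\<exists>p. p dvd b \<and> 0 < degree p \<and> degree p \<le> ?k" if "b dvd det P'" "0 < degree b" for b
    by (rule small_factors_to_infinity[OF max_irreducible_degree_ge_1[OF P ne] degree_det_bound[OF P eP]
          _ ne small_factor_of_det[OF P ne]]) (use that deg' detP' in auto)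
  from strictly_regular_block_form[OF P' ne' deg' max_irreducible_degree_ge_1[OF P ne] small]
  obtain Ds Q' where Q': "mp_equiv n P' Q'" "block_tri (coeffs_below g) Ds Q'"
    "\<forall>D\<in>set Ds. 1 \<le> dim_row D \<and> dim_row D \<le> ?k \<and> column_monic (\<lambda>_. g) (dim_row D) D"
    by blast
  have mon: "\<forall>D\<in>set Ds. column_monic (\<lambda>_. g) (dim_row D) D" using Q'(3) by blast
  have Q'c: "Q' \<in> carrier_mat n n" using mp_equiv_carrier[OF Q'(1)] by simp
  have eQ': "entry_degrees_le g Q'" using block_form_properties[OF Q'(2) mon Q'c] by blast
  have topQ': "coeff (det Q') (n * g) \<noteq> 0"
    using mp_equiv_degree_det[OF Q'(1)] deg' mp_equiv_det_nonzero[OF Q'(1)] ne'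
    by (metis leading_coeff_0_iff)
  define Q where "Q = map_mat (?from g) Q'"
  have Q: "Q \<in> carrier_mat n n" using Q'c unfolding Q_def by simp
  have eQ: "entry_degrees_le g Q"
    unfolding Q_def by (rule entry_degrees_le_hom_subst[OF degree_shift_le(3,4)])
  have "det Q = ?from (n * g) (det Q')" unfolding Q_def by (rule det_hom_subst_mat[OF Q'c eQ'])
  then have \<omega>Q: "poly (det Q) \<omega> \<noteq> 0" using topQ' by (simp add: poly_hom_subst_zero)
  then have neQ: "det Q \<noteq> 0" by auto
  have regQ: "regular_mp Q" unfolding regular_mp_def using Q neQ by auto
  note sP = invariant_polys_smith_form[OF P ne] and sQ = invariant_polys_smith_form[OF Q neQ]
  have inv: "invariant_polys Q = invariant_polys P"
  proof (rule smith_form_eqI[OF sQ sP])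
    fix r assume r: "r < n"
    have mem: "invariant_polys P ! r \<in> set (invariant_polys P)" "invariant_polys Q ! r \<in> set (invariant_polys Q)"
      using sP sQ r unfolding smith_form_def by auto
    have "\<exists>M. invariant_polys P ! r dvd invariant_polys Q ! r * [:- \<omega>, 1:] ^ M"
      using smith_form_hom_subst_dvd[OF Q'(1) eP' eQ', of 1 "[:- \<omega>, 1:]"] sP sQ r
      unfolding P_eq[symmetric] Q_def[symmetric] by blast
    moreover have "poly (invariant_polys P ! r) \<omega> \<noteq> 0"
      using poly_det_smith_form_zero_iff[OF sP] \<omega> mem by blast
    ultimately show "invariant_polys P ! r dvd invariant_polys Q ! r"
      using linear_power_coprime_cancel by blast
    have "\<exists>M. invariant_polys Q ! r dvd invariant_polys P ! r * [:- \<omega>, 1:] ^ M"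
      using smith_form_hom_subst_dvd[OF mp_equiv_sym[OF Q'(1)] eQ' eP', of 1 "[:- \<omega>, 1:]"] sP sQ r
      unfolding P_eq[symmetric] Q_def[symmetric] by blast
    moreover have "poly (invariant_polys Q ! r) \<omega> \<noteq> 0"
      using poly_det_smith_form_zero_iff[OF sQ] \<omega>Q mem by blast
    ultimately show "invariant_polys Q ! r dvd invariant_polys P ! r"
      using linear_power_coprime_cancel by blast
  qed
  have rev: "reversal_mp g (map_mat (?from g) A) = ?inf A" for A
    unfolding reversal_mp_hom_subst by (rule eq_matI) (auto simp: reversal_from_infinity)
  have revP: "reversal_mp g P = ?inf P'" and revQ: "reversal_mp g Q = ?inf Q'"
    using rev[of P'] rev[of Q'] unfolding P_eq[symmetric] Q_def[symmetric] by auto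
  have sR: "smith_form n (?inf P') (invariant_polys (?inf P'))" "smith_form n (?inf Q') (invariant_polys (?inf Q'))"
    using det_reversal_nonzero[OF P eP ne] det_reversal_nonzero[OF Q eQ neQ] P' Q'c
    unfolding revP revQ by (auto intro!: invariant_polys_smith_form)
  have pm: "partial_mults_infinity g Q = partial_mults_infinity g P"
    unfolding partial_mults_infinity_def partial_mults_def revP revQ
  proof (rule nth_equalityI)
    have len: "length (invariant_polys (?inf P')) = n" "length (invariant_polys (?inf Q')) = n"
      using sR unfolding smith_form_def by auto
    then show "length (map (exact_exponent [:0, 1:]) (invariant_polys (?inf Q'))) =
      length (map (exact_exponent [:0, 1:]) (invariant_polys (?inf P')))" by simp
    fix r assume "r < length (map (exact_exponent [:0, 1:]) (invariant_polys (?inf Q')))"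
    then have r: "r < n" using len by simp
    have "order 0 (invariant_polys (?inf Q') ! r) = order 0 (invariant_polys (?inf P') ! r)"
      using order_0_smith_form_hom_subst_le[OF Q'(1) eP' eQ' sR r]
        order_0_smith_form_hom_subst_le[OF mp_equiv_sym[OF Q'(1)] eQ' eP' sR(2,1) r] by simp
    then show "map (exact_exponent [:0, 1:]) (invariant_polys (?inf Q')) ! r =
      map (exact_exponent [:0, 1:]) (invariant_polys (?inf P')) ! r"
      using smith_form_nonzero[OF sR(1)] smith_form_nonzero[OF sR(2)] r len
      by (simp add: exact_exponent_X)
  qed
  have dvd_rev: "[:0, 1:] ^ e dvd reversal_mp g A $$ (i, j) \<longleftrightarrow> (\<forall>l. g < l + e \<longrightarrow> coeff (A $$ (i, j)) l = 0)"
    if "e \<le> Suc g" "A \<in> carrier_mat n n" "entry_degrees_le g A" "i < n" "j < n" for e A i j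
    unfolding reversal_mp_hom_subst
    using X_power_dvd_reversal_iff[OF that(1) entry_degrees_leD[OF that(3,2,4,5)]] that by simp
  have transfer: "\<forall>l. g < l + e \<longrightarrow> coeff (B $$ (i, j)) l = 0"
    if "e \<le> Suc g" "mp_equiv n A' B'" "entry_degrees_le g A'" "entry_degrees_le g B'"
      "A = map_mat (?from g) A'" "B = map_mat (?from g) B'"
      "entry_degrees_le g A" "entry_degrees_le g B"
      "\<forall>i<n. \<forall>j<n. \<forall>l. g < l + e \<longrightarrow> coeff (A $$ (i, j)) l = 0" "i < n" "j < n" for e A B A' B' i j
  proof -
    have c: "A \<in> carrier_mat n n" "B \<in> carrier_mat n n"
      using mp_equiv_carrier[OF that(2)] that(5,6) by auto
    have "[:0, 1:] ^ e dvd ?inf B' $$ (i, j)"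
    proof (rule entries_power_dvd_hom_subst[OF that(2,3,4) _ _ that(10,11)])
      fix i j assume "i < n" "j < n"
      then show "[:0, 1:] ^ e dvd ?inf A' $$ (i, j)"
        using dvd_rev[OF that(1) c(1) that(7), of i j] that(9) unfolding that(5) rev by blast
    qed simp
    then show ?thesis using dvd_rev[OF that(1) c(2) that(8) that(10,11)] unfolding that(6) rev by blast
  qed
  have dP: "entry_degrees_le d P" "\<exists>i<n. \<exists>j<n. coeff (P $$ (i, j)) d \<noteq> 0"
    using d P unfolding degree_mp_eq_iff by auto
  have dg: "d \<le> g" using le d by simp
  have "degree_mp Q = Fin d"
    unfolding degree_mp_eq_iff
  proof
    have "\<forall>l. g < l + (g - d) \<longrightarrow> coeff (Q $$ (i, j)) l = 0" if "i < n" "j < n" for i j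
    proof (rule transfer[OF _ Q'(1) eP' eQ' P_eq Q_def eP eQ _ that])
      show "\<forall>i<n. \<forall>j<n. \<forall>l. g < l + (g - d) \<longrightarrow> coeff (P $$ (i, j)) l = 0"
      proof (intro allI impI)
        fix i j l assume ij: "i < n" "j < n" and "g < l + (g - d)"
        then have "d < l" using dg by simp
        then show "coeff (P $$ (i, j)) l = 0"
          using entry_degrees_leD[OF dP(1) P ij] by (intro coeff_eq_0) simp
      qed
    qed simp
    then show "entry_degrees_le d Q" using Q dg unfolding entry_degrees_le_def by (auto intro!: degree_le)
    show "\<exists>i<dim_row Q. \<exists>j<dim_col Q. coeff (Q $$ (i, j)) d \<noteq> 0"
    proof (rule ccontr)
      assume "\<not> ?thesis"
      then have z: "coeff (Q $$ (i, j)) d = 0" if "i < n" "j < n" for i j using Q that by auto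
      have "\<forall>l. g < l + (g - d + 1) \<longrightarrow> coeff (P $$ (i, j)) l = 0" if "i < n" "j < n" for i j
      proof (rule transfer[OF _ mp_equiv_sym[OF Q'(1)] eQ' eP' Q_def P_eq eQ eP _ that])
        show "\<forall>i<n. \<forall>j<n. \<forall>l. g < l + (g - d + 1) \<longrightarrow> coeff (Q $$ (i, j)) l = 0"
        proof (intro allI impI)
          fix i j l assume ij: "i < n" "j < n" and l: "g < l + (g - d + 1)"
          show "coeff (Q $$ (i, j)) l = 0"
          proof (cases "l = d")
            case False
            then have "d < l" using l dg by simp
            then show ?thesis
              using entry_degrees_leD[OF \<open>entry_degrees_le d Q\<close> Q ij] by (intro coeff_eq_0) simp
          qed (use z ij in simp)
        qed
      qed simp
      then show False using dP(2) dg by fastforce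
    qed
  qed
  then have "same_size_grade_degree_data g P Q"
    unfolding same_size_grade_degree_data_def complete_spectral_data_def infinite_spectral_structure_def
    using P Q le d inv pm by simp
  moreover have "quasi_triangular ?k Q"
    unfolding quasi_triangular_def Q_def
    using quasi_triangular_wrt_block_tri[OF Q'(2), of ?k "?from g"] Q'(3) by auto
  ultimately show ?thesis using regQ by blast
qed

theorem theorem4p9:
  fixes P :: "'a::field poly mat" and n g d k :: nat
  assumes "1 \<le> n"
    and "P \<in> carrier_mat n n"
    and "regular_mp P"
    and "degree_mp P \<le> Fin g"
    and "degree_mp P = Fin d"
    and "k = max_irreducible_degree P"
    and "\<not> strictly_regular_mp g P \<Longrightarrow> \<exists>\<omega>. poly (invariant_polys P ! (n - 1)) \<omega> \<noteq> 0"
  shows "(\<exists>Q. regular_mp Q \<and> quasi_triangular k Q \<and> same_size_grade_degree_data g P Q) \<and>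
    (strictly_regular_mp g P \<longrightarrow>
      (\<forall>Q. regular_mp Q \<and> quasi_triangular k Q \<and> same_size_grade_degree_data g P Q
         \<longrightarrow> strictly_regular_mp g Q) \<and>
      (\<exists>Q bs. regular_mp Q \<and> quasi_triangular_wrt k bs Q \<and> same_size_grade_degree_data g P Q \<and>
         strictly_regular_mp g Q \<and>
         (\<forall>a<length bs. \<forall>b<length bs. a \<noteq> b \<longrightarrow> degree_mp (block_mp bs Q a b) < Fin d)))"
proof -
  have ne: "det P \<noteq> 0" using assms(3) unfolding regular_mp_def by simp
  show ?thesis
  proof (cases "strictly_regular_mp g P")
    case True
    note Q = strictly_regular_quasi_triangularization[OF assms(1,2) True assms(4,5)]
    then have "\<exists>Q. regular_mp Q \<and> quasi_triangular k Q \<and> same_size_grade_degree_data g P Q"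
      unfolding assms(6) quasi_triangular_def by blast
    then show ?thesis
      using Q same_data_strictly_regular[OF True] unfolding assms(6) by blast
  next
    case False
    from assms(7)[OF False] obtain \<omega> where \<omega>: "poly (invariant_polys P ! (n - 1)) \<omega> \<noteq> 0" by blast
    note ss = invariant_polys_smith_form[OF assms(2) ne]
    have "poly (det P) \<omega> \<noteq> 0"
    proof
      assume "poly (det P) \<omega> = 0"
      then obtain r where r: "r < n" "poly (invariant_polys P ! r) \<omega> = 0"
        using poly_det_smith_form_zero_iff[OF ss] ss
        unfolding smith_form_def by (metis in_set_conv_nth)
      have "invariant_polys P ! r dvd invariant_polys P ! (n - 1)"
        by (rule smith_form_dvd_mono[OF ss]) (use r in auto)
      then show False using r(2) \<omega> by (auto elim!: dvdE)
    qed
    from quasi_triangularization_non_eigenvalue[OF assms(1,2) ne assms(4,5) this] False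
    show ?thesis unfolding assms(6) by blast
  qed
qed

end
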